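(* The Destructive Shift Bribery problem for the Maximin rule is in $\mathrm{P}$ (i.e., decidable in polynomial time).
   Context: **Elections.** An election is a pair $E=(C,V)$, where $C=\{c_1,\dots,c_m\}$ is a finite set of candidates and $V=\{v_1,\dots,v_n\}$ is a finite multiset of voters; each voter $v$ has a strict ranking (preference order) of all candidates from best to worst, and $\mathrm{pos}_v(c)\in\{1,\dots,m\}$ is the position of $c$ in $v$'s ranking (1 = best). $N_E(c,c')$ is the number of voters who prefer $c$ to $c'$. An election rule $\mathcal{R}$ maps each election $E$ to a set $\mathcal{R}(E)\subseteq C$ of (tied) winners; $c$ is the unique winner if $\mathcal{R}(E)=\{c\}$. **Destructive Shift Bribery for $\mathcal{R}$.** Input: an election $E=(C,V)$ with $m$ candidates and $n$ voters, a despised candidate $d\in C$, a budget $B$ (a nonnegative integer), and for each voter $v_i$ a price function $\rho_i$. Shifting $d$ back by $t$ positions in a vote moves $d$ $t$ places towards the end of the ranking, each passed candidate moving up by one place and all else unchanged. A price function for a voter $v$ with $j=\mathrm{pos}_v(d)$ is $\rho:\mathbb{N}\to\mathbb{N}\cup\{+\infty\}$ with $\rho(0)=0$, $\rho(i)\le\rho(i')$ for $i<i'\le m-j$, and $\rho(i)=+\infty$ for $i>m-j$; $\rho(i)$ is the cost of shifting $d$ back by $i$ positions in $v$'s ranking. Price functions are encoded by listing their values at all arguments where they are finite; numbers are in binary. Question: are there nonnegative integers $t_1,\dots,t_n$ with $\sum_i\rho_i(t_i)\le B$ such that, after shifting $d$ back by $t_i$ positions in the ranking of each $v_i$, $d$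 is not the unique $\mathcal{R}$-winner? **Maximin.** The Maximin score of $c$ is $\min_{c'\in C\setminus\{c\}}N_E(c,c')$; the candidates with the highest score are the winners. *)

theory Defs
  imports
    "HOL-Library.Extended_Nat"
    "HOL-Computational_Algebra.Polynomial"
begin

section \<open>Deterministic Turing machines and the class P\<close>

text \<open>
  Deterministic machines with a fixed number of two-way infinite tapes. States and tape symbols are
  natural numbers, and \<open>0\<close> is the blank. A tape is a pair \<open>(l, r)\<close>: \<open>r\<close> starts with the scanned
  cell and continues to the right, \<open>l\<close> lists the cells left of the head, nearest first. Cells beyond
  the ends of the two lists are blank.
\<close>

type_synonym tape = "nat list \<times> nat list"

datatype move = Move_Left | Stay | Move_Right

record tm =
  num_tapes :: nat
  num_states :: nat
  num_symbols :: nat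
  start :: nat
  accept :: nat
  reject :: nat
  delta :: "nat \<Rightarrow> nat list \<Rightarrow> nat \<times> (nat \<times> move) list"

text \<open>
  The values of \<open>delta\<close> outside the finite domain considered here are never used, so that a
  well-formed machine is a finite object.
\<close>

definition wf_tm :: "tm \<Rightarrow> bool" where
  "wf_tm M \<longleftrightarrow>
     0 < num_tapes M \<and> 0 < num_symbols M \<and>
     start M < num_states M \<and> accept M < num_states M \<and> reject M < num_states M \<and>
     accept M \<noteq> reject M \<and>
     (\<forall>q < num_states M. \<forall>xs \<in> lists {..<num_symbols M}. length xs = num_tapes M \<longrightarrow>
        (case delta M q xs of (q', as) \<Rightarrow>
           q' < num_states M \<and> length as = num_tapes M \<and> (\<forall>a \<in> set as. fst a < num_symbols M)))"

definition read_tape :: "tape \<Rightarrow> nat" where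
  "read_tape tp = (case snd tp of [] \<Rightarrow> 0 | x # _ \<Rightarrow> x)"

fun act_tape :: "nat \<times> move \<Rightarrow> tape \<Rightarrow> tape" where
  "act_tape (a, Stay) (l, r) = (l, a # tl r)"
| "act_tape (a, Move_Right) (l, r) = (a # l, tl r)"
| "act_tape (a, Move_Left) ([], r) = ([], 0 # a # tl r)"
| "act_tape (a, Move_Left) (x # l, r) = (l, x # a # tl r)"

type_synonym config = "nat \<times> tape list"

definition init_config :: "tm \<Rightarrow> nat list \<Rightarrow> config" where
  "init_config M w = (start M, ([], w) # replicate (num_tapes M - 1) ([], []))"

definition step :: "tm \<Rightarrow> config \<Rightarrow> config" where
  "step M c = (case c of (q, ts) \<Rightarrow>
     if q = accept M \<or> q = reject M then (q, ts)
     else (case delta M q (map read_tape ts) of (q', as) \<Rightarrow> (q', map2 act_tape as ts)))"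

definition decides_in_time :: "tm \<Rightarrow> nat set \<Rightarrow> nat list set \<Rightarrow> (nat \<Rightarrow> nat) \<Rightarrow> bool" where
  "decides_in_time M \<Sigma> L T \<longleftrightarrow>
     (\<forall>w \<in> lists \<Sigma>. \<exists>t \<le> T (length w).
        fst ((step M ^^ t) (init_config M w)) = (if w \<in> L then accept M else reject M))"

definition in_P :: "nat set \<Rightarrow> nat list set \<Rightarrow> bool" where
  "in_P \<Sigma> L \<longleftrightarrow>
     finite \<Sigma> \<and> 0 \<notin> \<Sigma> \<and> L \<subseteq> lists \<Sigma> \<and>
     (\<exists>M p. wf_tm M \<and> \<Sigma> \<subseteq> {..<num_symbols M} \<and> decides_in_time M \<Sigma> L (poly p))"


section \<open>Elections and the Maximin rule\<close>

text \<open>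
  A ranking lists the candidates from best to worst. The voters are given as an indexed family,
  because price functions are attached to individual voters.
\<close>

type_synonym 'c ranking = "'c list"
type_synonym 'c election = "'c set \<times> 'c ranking list"
type_synonym 'c rule = "'c election \<Rightarrow> 'c set"

definition is_election :: "'c election \<Rightarrow> bool" where
  "is_election E \<longleftrightarrow> finite (fst E) \<and> (\<forall>v \<in> set (snd E). distinct v \<and> set v = fst E)"

definition pos :: "'c ranking \<Rightarrow> 'c \<Rightarrow> nat" where
  "pos v c = Suc (length (takeWhile (\<lambda>x. x \<noteq> c) v))"

definition num_prefer :: "'c election \<Rightarrow> 'c \<Rightarrow> 'c \<Rightarrow> nat" where
  "num_prefer E c c' = length (filter (\<lambda>v. pos v c < pos v c') (snd E))"

definition maximin_score :: "'c election \<Rightarrow> 'c \<Rightarrow> nat" where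
  "maximin_score E c = Min (num_prefer E c ` (fst E - {c}))"

text \<open>
  If there is only one candidate, its score is the unspecified value \<open>Min {}\<close>, but it is the
  unique winner whatever that value is.
\<close>

definition maximin :: "'c rule" where
  "maximin E = {c \<in> fst E. \<forall>c' \<in> fst E. maximin_score E c' \<le> maximin_score E c}"


section \<open>Destructive Shift Bribery\<close>

definition shift_back :: "'c \<Rightarrow> nat \<Rightarrow> 'c ranking \<Rightarrow> 'c ranking" where
  "shift_back d t v =
     (let xs = takeWhile (\<lambda>x. x \<noteq> d) v; ys = tl (dropWhile (\<lambda>x. x \<noteq> d) v)
      in xs @ take t ys @ d # drop t ys)"

definition is_price_function :: "nat \<Rightarrow> nat \<Rightarrow> (nat \<Rightarrow> enat) \<Rightarrow> bool" where
  "is_price_function m j \<rho> \<longleftrightarrow>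
     \<rho> 0 = 0 \<and> (\<forall>i i'. i < i' \<and> i' \<le> m - j \<longrightarrow> \<rho> i \<le> \<rho> i') \<and> (\<forall>i. i > m - j \<longrightarrow> \<rho> i = \<infinity>)"

record 'c bribery_instance =
  election :: "'c election"
  despised :: 'c
  budget :: nat
  prices :: "(nat \<Rightarrow> enat) list"

definition valid_instance :: "'c bribery_instance \<Rightarrow> bool" where
  "valid_instance I \<longleftrightarrow>
     (case election I of (C, V) \<Rightarrow>
        is_election (C, V) \<and> despised I \<in> C \<and> length (prices I) = length V \<and>
        (\<forall>i < length V. is_price_function (card C) (pos (V ! i) (despised I)) (prices I ! i)))"

definition destructive_bribery_exists :: "'c rule \<Rightarrow> 'c bribery_instance \<Rightarrow> bool" where
  "destructive_bribery_exists R I \<longleftrightarrow>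
     (case election I of (C, V) \<Rightarrow>
        \<exists>ts. length ts = length V \<and>
          (\<Sum>i < length V. (prices I ! i) (ts ! i)) \<le> enat (budget I) \<and>
          R (C, map2 (shift_back (despised I)) ts V) \<noteq> {despised I})"


section \<open>Encoding of instances\<close>

text \<open>
  Words over \<open>{1, 2, 3, 4}\<close>: the symbols \<open>1\<close> and \<open>2\<close> are the binary digits zero and one, \<open>3\<close> ends a
  number and \<open>4\<close> ends a list of numbers. Numbers are written with the least significant digit first
  and without superfluous zeros (so that \<open>0\<close> has no digits).
\<close>

fun binary :: "nat \<Rightarrow> nat list" where
  "binary n = (if n = 0 then [] else (if even n then 1 else 2) # binary (n div 2))"

declare binary.simps [simp del]

definition encode_nat :: "nat \<Rightarrow> nat list" where
  "encode_nat n = binary n @ [3]"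

definition encode_nats :: "nat list \<Rightarrow> nat list" where
  "encode_nats ns = concat (map encode_nat ns) @ [4]"

text \<open>
  The arguments at which a price function is finite form an initial segment of the natural numbers,
  so the arguments themselves need not be recorded.
\<close>

definition finite_prices :: "(nat \<Rightarrow> enat) \<Rightarrow> nat list" where
  "finite_prices \<rho> = map (\<lambda>i. the_enat (\<rho> i)) (sorted_list_of_set {i. \<rho> i \<noteq> \<infinity>})"

text \<open>The candidates are taken to be \<open>1, ..., m\<close>, so that the candidate set is encoded by \<open>m\<close>.\<close>

definition encode_instance :: "nat bribery_instance \<Rightarrow> nat list" where
  "encode_instance I =
     encode_nat (card (fst (election I))) @ encode_nat (despised I) @ encode_nat (budget I) @
     concat (map2 (\<lambda>v \<rho>. encode_nats v @ encode_nats (finite_prices \<rho>))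
       (snd (election I)) (prices I))"

definition encodable :: "nat bribery_instance \<Rightarrow> bool" where
  "encodable I \<longleftrightarrow> valid_instance I \<and> (\<exists>m. fst (election I) = {1..m})"

definition Destructive_Shift_Bribery :: "nat rule \<Rightarrow> nat list set" where
  "Destructive_Shift_Bribery R =
     {encode_instance I | I. encodable I \<and> destructive_bribery_exists R I}"


subsection \<open>The encoding is injective\<close>

lemma binary_symbols: "set (binary n) \<subseteq> {1, 2}"
  by (induction n rule: binary.induct) (subst binary.simps, auto)

lemma binary_inj: "binary m = binary n \<Longrightarrow> m = n"
proof (induction m arbitrary: n rule: less_induct)
  case (less m)
  show ?case
  proof (cases "m = 0 \<or> n = 0")
    case True
    then show ?thesis using less.prems
      by (subst (asm) (1 2) binary.simps) (auto split: if_splits)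
  next
    case False
    have eq: "(if even m then 1 else (2::nat)) # binary (m div 2) =
        (if even n then 1 else 2) # binary (n div 2)"
      using less.prems False binary.simps[of m] binary.simps[of n] by simp
    then have "m div 2 = n div 2" using less.IH[of "m div 2" "n div 2"] False by simp
    moreover have "even m = even n" using eq by (auto split: if_splits)
    ultimately show ?thesis by (metis bit_eq_rec)
  qed
qed

lemma terminated_append_inj:
  assumes "xs @ z # us = ys @ z # vs" "z \<notin> set xs" "z \<notin> set ys"
  shows "xs = ys \<and> us = vs"
  using assms
proof (induction xs arbitrary: ys)
  case Nil
  then show ?case by (cases ys) auto
next
  case (Cons x xs)
  then show ?case by (cases ys) auto
qed

lemma encode_nat_append_inj:
  assumes "encode_nat m @ us = encode_nat n @ vs"
  shows "m = n \<and> us = vs"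
proof -
  have "3 \<notin> set (binary k)" for k using binary_symbols[of k] by auto
  then show ?thesis using assms terminated_append_inj[of "binary m" 3 us "binary n" vs]
    by (auto simp: encode_nat_def dest: binary_inj)
qed

lemma encode_nat_neq_4: "encode_nat n @ us \<noteq> 4 # vs"
  using binary_symbols[of n] by (cases "binary n") (auto simp: encode_nat_def)

lemma encode_nats_append_inj:
  "encode_nats ms @ us = encode_nats ns @ vs \<Longrightarrow> ms = ns \<and> us = vs"
proof (induction ms arbitrary: ns)
  case Nil
  then show ?case using encode_nat_neq_4 by (cases ns) (auto simp: encode_nats_def dest: sym)
next
  case (Cons m ms)
  show ?case
  proof (cases ns)
    case Nil
    then show ?thesis using Cons.prems encode_nat_neq_4 by (auto simp: encode_nats_def)
  next
    case (Cons n ns')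
    then have "encode_nat m @ (encode_nats ms @ us) = encode_nat n @ (encode_nats ns' @ vs)"
      using Cons.prems by (simp add: encode_nats_def)
    from encode_nat_append_inj[OF this] Cons.IH Cons show ?thesis by blast
  qed
qed

lemma finite_prices_inj:
  assumes "is_price_function m j \<rho>" "is_price_function m' j' \<sigma>"
    and eq: "finite_prices \<rho> = finite_prices \<sigma>"
  shows "\<rho> = \<sigma>"
proof -
  have seg: "\<exists>k. {i. \<tau> i \<noteq> \<infinity>} = {..<k}" if "is_price_function m j \<tau>" for m j and \<tau> :: "nat \<Rightarrow> enat"
  proof -
    let ?S = "{i. \<tau> i \<noteq> \<infinity>}"
    have fin: "finite ?S"
      by (rule finite_subset[of _ "{..m - j}"])
        (use that in \<open>auto simp: is_price_function_def not_le[symmetric]\<close>)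
    have down: "i \<in> ?S" if "i < i'" "i' \<in> ?S" for i i'
    proof -
      have "i' \<le> m - j" using \<open>is_price_function m j \<tau>\<close> that(2)
        by (auto simp: is_price_function_def not_le[symmetric])
      then have "\<tau> i \<le> \<tau> i'" using \<open>is_price_function m j \<tau>\<close> that(1)
        by (auto simp: is_price_function_def)
      then show ?thesis using that(2) by (metis enat_ord_simps(5) mem_Collect_eq)
    qed
    have "?S = {..<Suc (Max ?S)}" if "?S \<noteq> {}"
    proof (intro equalityI subsetI)
      fix i assume "i \<in> ?S" then show "i \<in> {..<Suc (Max ?S)}" using fin by (simp add: le_imp_less_Suc)
    next
      fix i assume "i \<in> {..<Suc (Max ?S)}"
      then show "i \<in> ?S" using down[of i "Max ?S"] Max_in[OF fin that]
        by (metis lessThan_iff less_Suc_eq)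
    qed
    then show ?thesis by (metis lessThan_0)
  qed
  have sl: "sorted_list_of_set {..<k} = [0..<k]" for k
    by (simp add: lessThan_atLeast0)
  obtain k where k: "{i. \<rho> i \<noteq> \<infinity>} = {..<k}" using seg assms(1) by blast
  obtain l where l: "{i. \<sigma> i \<noteq> \<infinity>} = {..<l}" using seg assms(2) by blast
  have e: "map (\<lambda>i. the_enat (\<rho> i)) [0..<k] = map (\<lambda>i. the_enat (\<sigma> i)) [0..<l]"
    using eq unfolding finite_prices_def k l sl .
  then have kl: "k = l" by (metis length_map length_upt diff_zero)
  show ?thesis
  proof
    fix i
    show "\<rho> i = \<sigma> i"
    proof (cases "i < k")
      case True
      then have "the_enat (\<rho> i) = the_enat (\<sigma> i)" using e kl by simp
      moreover have "\<rho> i \<noteq> \<infinity>" "\<sigma> i \<noteq> \<infinity>" using True k l kl by auto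
      ultimately show ?thesis by auto
    next
      case False
      then have "i \<notin> {i. \<rho> i \<noteq> \<infinity>}" "i \<notin> {i. \<sigma> i \<noteq> \<infinity>}" unfolding k l kl by simp_all
      then show ?thesis by (metis mem_Collect_eq)
    qed
  qed
qed

lemma encode_voters_inj:
  assumes "length V = length P" "length W = length Q"
    and "concat (map2 (\<lambda>v \<rho>. encode_nats v @ encode_nats (finite_prices \<rho>)) V P) =
      concat (map2 (\<lambda>v \<rho>. encode_nats v @ encode_nats (finite_prices \<rho>)) W Q)"
  shows "V = W \<and> map finite_prices P = map finite_prices Q"
  using assms
proof (induction V P arbitrary: W Q rule: list_induct2)
  case Nil
  then show ?case by (cases W; cases Q) (auto simp: encode_nats_def)
next
  case (Cons v V \<rho> P)
  show ?case
  proof (cases W)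
    case Nil
    then show ?thesis using Cons.prems by (auto simp: encode_nats_def)
  next
    case W: (Cons w W')
    then obtain \<sigma> Q' where Q: "Q = \<sigma> # Q'" using Cons.prems(1) by (cases Q) auto
    show ?thesis using Cons.prems Cons.IH[of W' Q'] unfolding W Q
      by (auto dest!: encode_nats_append_inj)
  qed
qed

lemma inj_on_encode_instance: "inj_on encode_instance (Collect encodable)"
proof (rule inj_onI, clarify)
  fix I J assume I: "encodable I" and J: "encodable J" and eq: "encode_instance I = encode_instance J"
  have len: "length (snd (election K)) = length (prices K)" if "encodable K" for K
    using that by (auto simp: encodable_def valid_instance_def)
  from eq have 1: "card (fst (election I)) = card (fst (election J))" "despised I = despised J"
      "budget I = budget J"
    and 2: "concat (map2 (\<lambda>v \<rho>. encode_nats v @ encode_nats (finite_prices \<rho>))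
        (snd (election I)) (prices I)) =
      concat (map2 (\<lambda>v \<rho>. encode_nats v @ encode_nats (finite_prices \<rho>))
        (snd (election J)) (prices J))"
    unfolding encode_instance_def by (blast dest: encode_nat_append_inj)+
  have V: "snd (election I) = snd (election J)"
    and P: "map finite_prices (prices I) = map finite_prices (prices J)"
    using encode_voters_inj[OF len[OF I] len[OF J] 2] by auto
  have C: "fst (election I) = fst (election J)"
    using I J 1(1) by (auto simp: encodable_def)
  have price: "\<exists>m j. is_price_function m j (prices K ! i)" if "encodable K" "i < length (prices K)" for K i
    using that by (fastforce simp: encodable_def valid_instance_def)
  have "prices I = prices J"
  proof (rule nth_equalityI)
    show len_eq: "length (prices I) = length (prices J)" using P by (metis length_map)
    fix i assume i: "i < length (prices I)"
    have "finite_prices (prices I ! i) = finite_prices (prices J ! i)"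
      using P i len_eq by (metis nth_map)
    then show "prices I ! i = prices J ! i"
      using price[OF I i] price[OF J] i len_eq finite_prices_inj by metis
  qed
  with V C 1 show "I = J" by (simp add: prod_eq_iff)
qed

end

theory Submission
  imports Defs
begin

text \<open>
  \<^bold>\<open>Combinatorics.\<close> Shifting \<open>d\<close> back only changes the comparisons involving \<open>d\<close>. So \<open>d\<close> fails to be
  the unique winner iff for some candidates \<open>c, c' \<noteq> d\<close> the number \<open>X\<close> of voters that rank \<open>d\<close>
  before \<open>c'\<close> after the bribery is at most \<open>N(c, d)\<close> and at most the fixed numbers \<open>N(c, x)\<close> for
  \<open>x \<noteq> d\<close>. If \<open>Y\<close> voters rank \<open>d\<close> before \<open>c\<close> after the bribery, then \<open>N(c, d) = n - Y\<close>. For each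
  pair \<open>(c, c')\<close> a dynamic program over the voters computes the least cost of every reachable
  \<open>(X, Y)\<close>; there are at most \<open>(n + 1)\<^sup>2\<close> pairs, and costs above the budget are dropped.

  \<^bold>\<open>Machines.\<close> Each tape is used as a stack holding binary trees in Polish notation. A program
  replaces the topmost tree of the first stack by the value of a function and leaves everything
  below untouched, so that programs can be composed, paired and iterated without any allocation of
  tapes. Hence the functions on encoded types that are computable in polynomial time are closed
  under composition, pairing, case distinction and folding over lists, provided that the
  intermediate states of a fold stay polynomially small, and the decision procedure is analysed as a
  functional program.
\<close>

section \<open>Structured programs over three stacks\<close>

text \<open>Prices and budget are written in binary, so a cost may be exponential in the input
  length and cannot index a table, whereas the two counts never exceed the number of voters. Both
  counts have to be tracked together because one shift, paid for once, may pass both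
  \<open>c\<close> and \<open>c'\<close>. Whether a goal is met depends on the counts alone, so the
  cheapest cost per pair of counts suffices. Binary numbers also constrain the programs: counting up
  to a number would be exponential, so numbers are coded by their bits and every loop runs along a
  list that is already present. Even the candidates have to be taken from a vote, because the number
  \<open>m\<close> by itself is exponentially larger than its encoding. Of the three stacks, the
  first holds the data, the second keeps values that are set aside, and the third is scratch space
  that is empty between programs. A run cannot lengthen a stack by more than its running time, so a
  time bound is at the same time a bound on the result, and sequential composition needs nothing
  else. Only iteration needs separate control of sizes.\<close>

datatype com =
    Skip
  | Push nat nat
  | Pop nat
  | Seq com com (infixr ";;" 60)
  | Cond nat "nat \<Rightarrow> bool" com com
  | While nat "nat \<Rightarrow> bool" com

type_synonym stacks = "nat \<Rightarrow> nat list"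

definition top0 :: "nat list \<Rightarrow> nat" where
  "top0 xs = (case xs of [] \<Rightarrow> 0 | x # _ \<Rightarrow> x)"

lemma top0_simps [simp]: "top0 [] = 0" "top0 (x # xs) = x"
  by (simp_all add: top0_def)

text \<open>The number bounds the steps of the compiled code: \<open>Push\<close> has to move the
  head and then write, and a conditional or a loop pays for a test and possibly a jump.
  \<open>Weaken\<close> makes it an upper bound, so that counts can be rounded freely.\<close>

inductive run :: "com \<Rightarrow> stacks \<Rightarrow> nat \<Rightarrow> stacks \<Rightarrow> bool" where
  Skip: "run Skip s 0 s"
| Push: "run (Push i a) s 2 (s(i := a # s i))"
| Pop: "run (Pop i) s 1 (s(i := tl (s i)))"
| Seq: "run c s T s' \<Longrightarrow> run d s' U s'' \<Longrightarrow> run (c ;; d) s (T + U) s''"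
| CondT: "P (top0 (s i)) \<Longrightarrow> run c s T s' \<Longrightarrow> run (Cond i P c d) s (T + 2) s'"
| CondF: "\<not> P (top0 (s i)) \<Longrightarrow> run d s T s' \<Longrightarrow> run (Cond i P c d) s (T + 2) s'"
| WhileT: "P (top0 (s i)) \<Longrightarrow> run c s T s' \<Longrightarrow> run (While i P c) s' U s'' \<Longrightarrow>
    run (While i P c) s (T + U + 2) s''"
| WhileF: "\<not> P (top0 (s i)) \<Longrightarrow> run (While i P c) s 1 s"
| Weaken: "run c s T s' \<Longrightarrow> T \<le> U \<Longrightarrow> run c s U s'"

text \<open>Symbols are the blank and the four input letters. Trees use 1 and 2; on the second stack
  3 also serves as a separator.\<close>

fun wf_com :: "com \<Rightarrow> bool" where
  "wf_com Skip = True"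
| "wf_com (Push i a) = (i < 3 \<and> a < 5)"
| "wf_com (Pop i) = (i < 3)"
| "wf_com (c ;; d) = (wf_com c \<and> wf_com d)"
| "wf_com (Cond i P c d) = (i < 3 \<and> wf_com c \<and> wf_com d)"
| "wf_com (While i P c) = (i < 3 \<and> wf_com c)"

section \<open>Compilation to Turing machines\<close>

text \<open>
  An instruction \<open>(i, g)\<close> scans tape \<open>i\<close>; if \<open>g\<close> maps the scanned symbol to \<open>(a, mv, q)\<close>, then
  \<open>a\<close> is written, the head of tape \<open>i\<close> makes the move \<open>mv\<close>, and control passes to instruction \<open>q\<close>.
\<close>

type_synonym instr = "nat \<times> (nat \<Rightarrow> nat \<times> move \<times> nat)"

fun code_len :: "com \<Rightarrow> nat" where
  "code_len Skip = 0"
| "code_len (Push i a) = 2"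
| "code_len (Pop i) = 1"
| "code_len (c ;; d) = code_len c + code_len d"
| "code_len (Cond i P c d) = code_len c + code_len d + 2"
| "code_len (While i P c) = code_len c + 2"

text \<open>\<open>Pop\<close> erases the cell before moving right, so all cells left of the head
  stay blank and a later \<open>Push\<close> can move back onto a blank cell. The instructions on
  tape 0 that ignore the scanned symbol are unconditional jumps.\<close>

fun compile :: "nat \<Rightarrow> com \<Rightarrow> instr list" where
  "compile pc Skip = []"
| "compile pc (Push i a) =
    [(i, \<lambda>x. (x, Move_Left, pc + 1)), (i, \<lambda>x. (a, Stay, pc + 2))]"
| "compile pc (Pop i) = [(i, \<lambda>x. (0, Move_Right, pc + 1))]"
| "compile pc (c ;; d) = compile pc c @ compile (pc + code_len c) d"
| "compile pc (Cond i P c d) =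
    [(i, \<lambda>x. (x, Stay, if P x then pc + 1 else pc + code_len c + 2))] @
    compile (pc + 1) c @
    [(0, \<lambda>x. (x, Stay, pc + code_len c + code_len d + 2))] @
    compile (pc + code_len c + 2) d"
| "compile pc (While i P c) =
    [(i, \<lambda>x. (x, Stay, if P x then pc + 1 else pc + code_len c + 2))] @
    compile (pc + 1) c @
    [(0, \<lambda>x. (x, Stay, pc))]"

lemma length_compile [simp]: "length (compile pc c) = code_len c"
  by (induction pc c rule: compile.induct) auto

definition wf_instr :: "nat \<Rightarrow> instr \<Rightarrow> bool" where
  "wf_instr n ins \<longleftrightarrow> fst ins < 3 \<and>
    (\<forall>x < 5. fst (snd ins x) < 5 \<and> snd (snd (snd ins x)) \<le> n)"

lemma wf_instr_mono: "wf_instr m ins \<Longrightarrow> m \<le> n \<Longrightarrow> wf_instr n ins"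
  unfolding wf_instr_def by (meson le_trans)

lemma wf_instr_compile:
  "wf_com c \<Longrightarrow> ins \<in> set (compile pc c) \<Longrightarrow> wf_instr (pc + code_len c) ins"
proof (induction pc c rule: compile.induct)
  case (4 pc c d)
  then show ?case by (auto simp: add.assoc intro: wf_instr_mono)
next
  case (5 pc i P c d)
  from 5(4) consider "ins = (i, \<lambda>x. (x, Stay, if P x then pc + 1 else pc + code_len c + 2))"
    | "ins \<in> set (compile (pc + 1) c)"
    | "ins = (0, \<lambda>x. (x, Stay, pc + code_len c + code_len d + 2))"
    | "ins \<in> set (compile (pc + code_len c + 2) d)"
    by auto
  then show ?case
    using 5(1-3) by cases (auto simp: wf_instr_def intro: wf_instr_mono[unfolded wf_instr_def] le_trans)
next
  case (6 pc i P c)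
  from 6(3) consider "ins = (i, \<lambda>x. (x, Stay, if P x then pc + 1 else pc + code_len c + 2))"
    | "ins \<in> set (compile (pc + 1) c)"
    | "ins = (0, \<lambda>x. (x, Stay, pc))"
    by auto
  then show ?case
    using 6(1-2) by cases (auto simp: wf_instr_def)
qed (auto simp: wf_instr_def)

text \<open>States are addresses of instructions. The two addresses just behind the program are the
  halting states, where \<open>delta\<close> only has to be well-formed.\<close>

definition machine :: "instr list \<Rightarrow> tm" where
  "machine prog = \<lparr> num_tapes = 3, num_states = length prog + 2, num_symbols = 5, start = 0,
     accept = length prog, reject = length prog + 1,
     delta = \<lambda>q xs.
       if q < length prog
       then case prog ! q of (i, g) \<Rightarrow> (case g (xs ! i) of (a, mv, q') \<Rightarrow>
         (q', map (\<lambda>j. if j = i then (a, mv) else (xs ! j, Stay)) [0..<3]))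
       else (q, replicate 3 (0, Stay)) \<rparr>"

lemma wf_machine:
  assumes "\<And>ins. ins \<in> set prog \<Longrightarrow> wf_instr (length prog + 1) ins"
  shows "wf_tm (machine prog)"
proof -
  have "case delta (machine prog) q xs of (q', as) \<Rightarrow>
      q' < num_states (machine prog) \<and> length as = num_tapes (machine prog) \<and>
      (\<forall>a \<in> set as. fst a < num_symbols (machine prog))"
    if q: "q < num_states (machine prog)" and xs: "xs \<in> lists {..<num_symbols (machine prog)}"
      and len: "length xs = num_tapes (machine prog)" for q xs
  proof (cases "q < length prog")
    case True
    obtain i g where ig: "prog ! q = (i, g)" by fastforce
    obtain a mv q' where g: "g (xs ! i) = (a, mv, q')" by (metis prod_cases3)
    have wf: "wf_instr (length prog + 1) (i, g)" using assms True ig by (metis nth_mem)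
    have sym: "xs ! j < 5" if "j < 3" for j
      using xs len that nth_mem[of j xs] by (force simp: machine_def lists_eq_set)
    then have "a < 5" "q' \<le> length prog + 1" using wf g by (fastforce simp: wf_instr_def)+
    with sym show ?thesis using True ig g by (auto simp: machine_def)
  qed (use q in \<open>auto simp: machine_def\<close>)
  then show ?thesis by (simp add: wf_tm_def) (simp add: machine_def)
qed

text \<open>Blanks are ignored on both sides because the lists of a tape are not determined by the
  stack: rewriting the scanned blank of an untouched empty tape already turns \<open>[]\<close> into
  \<open>[0]\<close>, and every \<open>Pop\<close> leaves a blank on the left.\<close>

definition stack_tape :: "tape \<Rightarrow> nat list \<Rightarrow> bool" where
  "stack_tape tp xs \<longleftrightarrow> set (fst tp) \<subseteq> {0} \<and> (\<exists>zs. snd tp = xs @ zs \<and> set zs \<subseteq> {0})"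

lemma stack_tapeE:
  assumes "stack_tape tp xs"
  obtains l zs where "tp = (l, xs @ zs)" "set l \<subseteq> {0}" "set zs \<subseteq> {0}"
  using assms by (cases tp) (auto simp: stack_tape_def)

lemma stack_tape_read: "stack_tape tp xs \<Longrightarrow> read_tape tp = top0 xs"
  by (erule stack_tapeE) (auto simp: read_tape_def top0_def split: list.splits)

lemma stack_tape_stay:
  assumes "stack_tape tp xs"
  shows "stack_tape (act_tape (read_tape tp, Stay) tp) xs"
  using assms
proof (rule stack_tapeE)
  fix l zs assume "tp = (l, xs @ zs)" "set l \<subseteq> {0}" "set zs \<subseteq> {0}"
  then show ?thesis by (cases xs; cases zs) (auto simp: stack_tape_def read_tape_def)
qed

lemma stack_tape_left:
  assumes "stack_tape tp xs"
  shows "stack_tape (act_tape (read_tape tp, Move_Left) tp) (0 # xs)"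
  using assms
proof (rule stack_tapeE)
  fix l zs assume "tp = (l, xs @ zs)" "set l \<subseteq> {0}" "set zs \<subseteq> {0}"
  then show ?thesis by (cases xs; cases zs; cases l) (auto simp: stack_tape_def read_tape_def)
qed

lemma stack_tape_right:
  assumes "stack_tape tp xs"
  shows "stack_tape (act_tape (0, Move_Right) tp) (tl xs)"
  using assms
proof (rule stack_tapeE)
  fix l zs assume "tp = (l, xs @ zs)" "set l \<subseteq> {0}" "set zs \<subseteq> {0}"
  then show ?thesis by (cases xs; cases zs) (auto simp: stack_tape_def)
qed

lemma stack_tape_write: "stack_tape tp (x # xs) \<Longrightarrow> stack_tape (act_tape (a, Stay) tp) (a # xs)"
  by (erule stack_tapeE) (auto simp: stack_tape_def)

definition stack_tapes :: "tape list \<Rightarrow> stacks \<Rightarrow> bool" where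
  "stack_tapes ts s \<longleftrightarrow> length ts = 3 \<and> (\<forall>i < 3. stack_tape (ts ! i) (s i))"

lemma step_machine:
  assumes "stack_tapes ts s" "q < length prog" "prog ! q = (i, g)" "i < 3"
    and "g (top0 (s i)) = (a, mv, q')"
    and "stack_tape (act_tape (a, mv) (ts ! i)) xs"
  shows "\<exists>ts'. step (machine prog) (q, ts) = (q', ts') \<and> stack_tapes ts' (s(i := xs))"
proof -
  let ?as = "map (\<lambda>j. if j = i then (a, mv) else (map read_tape ts ! j, Stay)) [0..<3]"
  have len: "length ts = 3" using assms(1) by (simp add: stack_tapes_def)
  have rd: "read_tape (ts ! i) = top0 (s i)"
    using assms(1,4) by (simp add: stack_tapes_def stack_tape_read)
  have "step (machine prog) (q, ts) = (q', map2 act_tape ?as ts)"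
    using assms(2-5) len rd by (simp add: step_def machine_def)
  moreover have "stack_tapes (map2 act_tape ?as ts) (s(i := xs))"
    using assms(1,4,6) len stack_tape_stay by (auto simp: stack_tapes_def)
  ultimately show ?thesis by blast
qed

section \<open>Simulation of runs by the machine\<close>

definition code_at :: "instr list \<Rightarrow> nat \<Rightarrow> instr list \<Rightarrow> bool" where
  "code_at prog pc is \<longleftrightarrow> (\<exists>as bs. prog = as @ is @ bs \<and> length as = pc)"

lemma code_at_append:
  assumes "code_at prog pc (is @ js)"
  shows "code_at prog pc is" "code_at prog (pc + length is) js"
proof -
  obtain as bs where *: "prog = as @ (is @ js) @ bs" "length as = pc"
    using assms by (auto simp: code_at_def)
  show "code_at prog pc is"
    unfolding code_at_def by (rule exI[of _ as], rule exI[of _ "js @ bs"]) (simp add: *)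
  show "code_at prog (pc + length is) js"
    unfolding code_at_def by (rule exI[of _ "as @ is"], rule exI[of _ bs]) (simp add: *)
qed

lemma code_at_Cons:
  assumes "code_at prog pc (ins # is)"
  shows "pc < length prog" "prog ! pc = ins" "code_at prog (pc + 1) is"
proof -
  show "pc < length prog" "prog ! pc = ins" using assms by (auto simp: code_at_def)
  show "code_at prog (pc + 1) is" using code_at_append(2)[of prog pc "[ins]" "is"] assms by simp
qed

lemma step_test:
  assumes "stack_tapes ts s" "code_at prog pc ((i, \<lambda>x. (x, Stay, h x)) # is)" "i < 3"
  shows "\<exists>ts'. step (machine prog) (pc, ts) = (h (top0 (s i)), ts') \<and> stack_tapes ts' s"
proof -
  have "stack_tape (ts ! i) (s i)" using assms by (simp add: stack_tapes_def)
  then have "stack_tape (act_tape (top0 (s i), Stay) (ts ! i)) (s i)"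
    using stack_tape_stay stack_tape_read by metis
  from step_machine[OF assms(1) code_at_Cons(1,2)[OF assms(2)] assms(3) refl this]
  show ?thesis by simp
qed

lemma funpow_chain:
  "(f ^^ t) a = b \<Longrightarrow> (f ^^ u) b = c \<Longrightarrow> (f ^^ (t + u)) a = c"
  by (metis add.commute comp_apply funpow_add)

text \<open>Induction is on the run, not on the command: after one round of a loop, what remains is
  a run of the same loop at the same address, to which the second induction hypothesis applies once
  control has jumped back.\<close>

theorem compile_correct:
  assumes "run c s T s'" "wf_com c" "code_at prog pc (compile pc c)" "stack_tapes ts s"
  shows "\<exists>t ts'. t \<le> T \<and> (step (machine prog) ^^ t) (pc, ts) = (pc + code_len c, ts') \<and>
    stack_tapes ts' s'"
  using assms
proof (induction arbitrary: pc ts rule: run.induct)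
  case (Skip s)
  then show ?case by (intro exI[of _ 0]) auto
next
  case (Push i a s)
  then have at: "code_at prog pc ((i, \<lambda>x. (x, Move_Left, pc + 1)) # [(i, \<lambda>x. (a, Stay, pc + 2))])"
    and i: "i < 3" by auto
  have "stack_tape (ts ! i) (s i)" using Push i by (simp add: stack_tapes_def)
  then have "stack_tape (act_tape (top0 (s i), Move_Left) (ts ! i)) (0 # s i)"
    using stack_tape_left stack_tape_read by metis
  from step_machine[OF Push(3) code_at_Cons(1,2)[OF at] i refl this] obtain ts1 where
    1: "step (machine prog) (pc, ts) = (pc + 1, ts1)" "stack_tapes ts1 (s(i := 0 # s i))" by auto
  have "stack_tape (ts1 ! i) (0 # s i)" using 1(2) i by (auto simp: stack_tapes_def)
  from step_machine[OF 1(2) code_at_Cons(1,2)[OF code_at_Cons(3)[OF at]] i refl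
      stack_tape_write[OF this]] obtain ts2 where
    2: "step (machine prog) (pc + 1, ts1) = (pc + 2, ts2)" "stack_tapes ts2 (s(i := a # s i))" by auto
  show ?case by (rule exI[of _ 2]) (use 1 2 in \<open>simp add: numeral_2_eq_2 fun_upd_def\<close>)
next
  case (Pop i s)
  then have at: "code_at prog pc ((i, \<lambda>x. (0, Move_Right, pc + 1)) # [])" and i: "i < 3" by auto
  have "stack_tape (ts ! i) (s i)" using Pop i by (simp add: stack_tapes_def)
  from step_machine[OF Pop(3) code_at_Cons(1,2)[OF at] i refl stack_tape_right[OF this]]
  obtain ts1 where
    "step (machine prog) (pc, ts) = (pc + 1, ts1)" "stack_tapes ts1 (s(i := tl (s i)))" by auto
  then show ?case by (intro exI[of _ 1]) (auto simp: fun_upd_def)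
next
  case (Seq c s T s' d U s'')
  have "code_at prog pc (compile pc c)" "code_at prog (pc + code_len c) (compile (pc + code_len c) d)"
    using Seq.prems(2) code_at_append by fastforce+
  with Seq obtain t ts1 where 1: "t \<le> T" "stack_tapes ts1 s'"
    "(step (machine prog) ^^ t) (pc, ts) = (pc + code_len c, ts1)" by fastforce
  with Seq.IH(2)[OF _ \<open>code_at prog (pc + code_len c) _\<close> 1(2)] Seq.prems(1) obtain u ts2 where
    2: "u \<le> U" "stack_tapes ts2 s''"
    "(step (machine prog) ^^ u) (pc + code_len c, ts1) = (pc + code_len c + code_len d, ts2)" by auto
  show ?case
    by (rule exI[of _ "t + u"]) (use 1 2 funpow_chain[OF 1(3) 2(3)] in \<open>auto simp: add.assoc\<close>)
next
  case (CondT P s i c T s' d)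
  let ?l = "code_len c" and ?r = "code_len d"
  note at = CondT.prems(2)[simplified]
  have at2: "code_at prog (pc + 1) (compile (pc + 1) c)"
    "code_at prog (pc + 1 + ?l) ((0, \<lambda>x. (x, Stay, pc + ?l + ?r + 2)) # compile (pc + ?l + 2) d)"
    using code_at_append[OF code_at_Cons(3)[OF at]] by auto
  obtain ts0 where 0: "step (machine prog) (pc, ts) = (pc + 1, ts0)" "stack_tapes ts0 s"
    using step_test[OF CondT.prems(3) at] CondT.prems(1) CondT.hyps(1) by auto
  obtain t ts1 where 1: "t \<le> T" "stack_tapes ts1 s'"
    "(step (machine prog) ^^ t) (pc + 1, ts0) = (pc + 1 + ?l, ts1)"
    using CondT.IH[OF _ at2(1) 0(2)] CondT.prems(1) by auto
  obtain ts2 where 2: "step (machine prog) (pc + 1 + ?l, ts1) = (pc + ?l + ?r + 2, ts2)"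
    "stack_tapes ts2 s'"
    using step_test[OF 1(2) at2(2)] by auto
  have "(step (machine prog) ^^ (1 + t + 1)) (pc, ts) = (pc + ?l + ?r + 2, ts2)"
    by (rule funpow_chain[OF funpow_chain[of 1]]) (use 0 1 2 in auto)
  then show ?case using 1(1) 2(2) by (intro exI[of _ "1 + t + 1"]) (auto simp: add.assoc)
next
  case (CondF P s i d T s' c)
  let ?l = "code_len c" and ?r = "code_len d"
  note at = CondF.prems(2)[simplified]
  have at2: "code_at prog (pc + ?l + 2) (compile (pc + ?l + 2) d)"
    using code_at_Cons(3)[OF code_at_append(2)[OF code_at_Cons(3)[OF at]]]
    by (simp add: add.commute add.left_commute)
  obtain ts0 where 0: "step (machine prog) (pc, ts) = (pc + ?l + 2, ts0)" "stack_tapes ts0 s"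
    using step_test[OF CondF.prems(3) at] CondF.prems(1) CondF.hyps(1) by auto
  obtain t ts1 where 1: "t \<le> T" "stack_tapes ts1 s'"
    "(step (machine prog) ^^ t) (pc + ?l + 2, ts0) = (pc + ?l + 2 + ?r, ts1)"
    using CondF.IH[OF _ at2 0(2)] CondF.prems(1) by auto
  have "(step (machine prog) ^^ (1 + t)) (pc, ts) = (pc + ?l + 2 + ?r, ts1)"
    by (rule funpow_chain) (use 0 1 in auto)
  then show ?case using 1 by (intro exI[of _ "1 + t"]) (auto simp: ac_simps)
next
  case (WhileT P s i c T s' U s'')
  let ?l = "code_len c"
  note at = WhileT.prems(2)[simplified]
  have at2: "code_at prog (pc + 1) (compile (pc + 1) c)"
    "code_at prog (pc + 1 + ?l) ((0, \<lambda>x. (x, Stay, pc)) # [])"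
    using code_at_append[OF code_at_Cons(3)[OF at]] by auto
  obtain ts0 where 0: "step (machine prog) (pc, ts) = (pc + 1, ts0)" "stack_tapes ts0 s"
    using step_test[OF WhileT.prems(3) at] WhileT.prems(1) WhileT.hyps(1) by auto
  obtain t ts1 where 1: "t \<le> T" "stack_tapes ts1 s'"
    "(step (machine prog) ^^ t) (pc + 1, ts0) = (pc + 1 + ?l, ts1)"
    using WhileT.IH(1)[OF _ at2(1) 0(2)] WhileT.prems(1) by auto
  obtain ts2 where 2: "step (machine prog) (pc + 1 + ?l, ts1) = (pc, ts2)" "stack_tapes ts2 s'"
    using step_test[OF 1(2) at2(2)] by auto
  obtain u ts3 where 3: "u \<le> U" "stack_tapes ts3 s''"
    "(step (machine prog) ^^ u) (pc, ts2) = (pc + code_len (While i P c), ts3)"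
    using WhileT.IH(2)[OF WhileT.prems(1,2) 2(2)] by auto
  have "(step (machine prog) ^^ (1 + t + 1 + u)) (pc, ts) = (pc + code_len (While i P c), ts3)"
    by (rule funpow_chain[OF funpow_chain[OF funpow_chain[of 1]]]) (use 0 1 2 3 in auto)
  then show ?case using 1(1) 3 by (intro exI[of _ "1 + t + 1 + u"]) auto
next
  case (WhileF P s i c)
  note at = WhileF.prems(2)[simplified]
  from step_test[OF WhileF.prems(3) at] WhileF.prems(1) WhileF.hyps(1) show ?case
    by (intro exI[of _ 1]) auto
next
  case (Weaken c s T s' U)
  then show ?case by (meson le_trans)
qed

section \<open>Binary trees on the stacks\<close>

datatype data = Leaf | Node data data

primrec code :: "data \<Rightarrow> nat list" where
  "code Leaf = [1]"
| "code (Node a b) = 2 # code a @ code b"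

abbreviation dsize :: "data \<Rightarrow> nat" where
  "dsize a \<equiv> length (code a)"

lemma code_symbols: "set (code a) \<subseteq> {1, 2}"
  by (induction a) auto

lemma dsize_pos: "1 \<le> dsize a"
  by (cases a) auto

lemma top0_code: "top0 (code a @ u) = (if a = Leaf then 1 else 2)"
  by (cases a) auto

definition st :: "nat list \<Rightarrow> nat list \<Rightarrow> nat list \<Rightarrow> stacks" where
  "st u v w = (\<lambda>i. if i = 0 then u else if i = 1 then v else if i = 2 then w else [])"

lemma st_simps [simp]:
  "st u v w 0 = u" "st u v w (Suc 0) = v" "st u v w 2 = w"
  "(st u v w)(0 := x) = st x v w" "(st u v w)(Suc 0 := x) = st u x w" "(st u v w)(2 := x) = st u v x"
  by (auto simp: st_def)

lemma run_weaken: "run c s T s' \<Longrightarrow> T \<le> U \<Longrightarrow> s' = t \<Longrightarrow> run c s U t"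
  using run.Weaken by blast

lemma run_Push: "s(i := a # s i) = t \<Longrightarrow> run (Push i a) s 2 t"
  using run.Push by blast

lemma run_Pop: "s(i := tl (s i)) = t \<Longrightarrow> run (Pop i) s 1 t"
  using run.Pop by blast

text \<open>Only \<open>Push\<close> lengthens a stack, by one symbol in two time units. Through
  \<open>does_size\<close>, time bounds therefore control the sizes of results.\<close>

lemma run_size: "run c s T s' \<Longrightarrow> length (s' i) \<le> length (s i) + T"
  by (induction rule: run.induct) auto

lemma run_WhileT:
  "run c s T s' \<Longrightarrow> run (While i P c) s' U s'' \<Longrightarrow> P (top0 (s i)) \<Longrightarrow> T + U + 2 \<le> V \<Longrightarrow>
   s = t \<Longrightarrow> run (While i P c) t V s''"
  using run.WhileT run.Weaken by blast

text \<open>Quantifying over \<open>u\<close> and \<open>v\<close> says that whatever lies below the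
  argument and on the second stack survives; this is what allows programs to be nested. The third
  stack must be empty because loops over it stop at its bottom.\<close>

definition does :: "com \<Rightarrow> data \<Rightarrow> nat \<Rightarrow> data \<Rightarrow> bool" where
  "does c a T b \<longleftrightarrow> (\<forall>u v. run c (st (code a @ u) v []) T (st (code b @ u) v []))"

lemma does_weaken: "does c a T b \<Longrightarrow> T \<le> U \<Longrightarrow> does c a U b"
  unfolding does_def using run.Weaken by blast

lemma does_size:
  assumes "does c a T b"
  shows "dsize b \<le> dsize a + T"
proof -
  have "run c (st (code a @ []) [] []) T (st (code b @ []) [] [])"
    using assms unfolding does_def by blast
  from run_size[OF this, of 0] show ?thesis by simp
qed

section \<open>Setting aside, deleting and duplicating the topmost tree\<close>

definition scan :: com where
  "scan = While 2 (\<lambda>x. x \<noteq> 0) (Cond 0 (\<lambda>x. x = 2)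
     (Pop 0 ;; Push 1 2 ;; Push 2 1) (Pop 0 ;; Push 1 1 ;; Pop 2))"

text \<open>
  Stack 2 counts, in unary, the subtrees that are still to be read, which makes the end of the
  topmost tree of stack 0 detectable.
\<close>

lemma run_scan:
  "run scan (st u (rev (code a) @ v) w) T s \<Longrightarrow>
   run scan (st (code a @ u) v (1 # w)) (T + 9 * dsize a) s"
proof (induction a arbitrary: u v w T)
  case Leaf
  have body: "run (Cond 0 (\<lambda>x. x = 2) (Pop 0 ;; Push 1 2 ;; Push 2 1) (Pop 0 ;; Push 1 1 ;; Pop 2))
      (st (1 # u) v (1 # w)) ((1 + (2 + 1)) + 2) (st u (1 # v) w)"
    by (rule run_weaken, rule run.CondF, simp, (rule run.Seq run.Push run.Pop)+, simp_all)
  have "run scan (st u (1 # v) w) T s" using Leaf by simp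
  from run_WhileT[OF body this[unfolded scan_def]] show ?case by (simp add: scan_def)
next
  case (Node a b)
  have body: "run (Cond 0 (\<lambda>x. x = 2) (Pop 0 ;; Push 1 2 ;; Push 2 1) (Pop 0 ;; Push 1 1 ;; Pop 2))
      (st (2 # code a @ code b @ u) v (1 # w)) ((1 + (2 + 2)) + 2)
      (st (code a @ code b @ u) (2 # v) (1 # 1 # w))"
    by (rule run_weaken, rule run.CondT, simp, (rule run.Seq run.Push run.Pop)+, simp_all)
  have "run scan (st (code b @ u) (rev (code a) @ 2 # v) (1 # w)) (T + 9 * dsize b) s"
    by (rule Node.IH(2)) (use Node.prems in simp)
  from Node.IH(1)[OF this]
  have "run scan (st (code a @ code b @ u) (2 # v) (1 # 1 # w)) (T + 9 * dsize b + 9 * dsize a) s" .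
  from run_WhileT[OF body this[unfolded scan_def]] show ?case by (simp add: scan_def)
qed

text \<open>The separator 3 occurs in no code, so \<open>unstash\<close> finds the end of the
  reversed tree without parsing it.\<close>

definition stash :: com where
  "stash = Push 1 3 ;; Push 2 1 ;; scan"

lemma run_stash: "run stash (st (code a @ u) v []) (14 * dsize a) (st u (rev (code a) @ 3 # v) [])"
proof -
  have 1: "run scan (st u (rev (code a) @ 3 # v) []) 1 (st u (rev (code a) @ 3 # v) [])"
    unfolding scan_def by (rule run.WhileF) simp
  show ?thesis unfolding stash_def
    by (rule run_weaken, rule run.Seq, rule run_Push, rule refl, rule run.Seq, rule run_Push,
        rule refl, simp, rule run_scan[OF 1, simplified]) (use dsize_pos[of a] in auto)
qed

definition unstash :: com where
  "unstash = While 1 (\<lambda>x. x \<noteq> 3) (Cond 1 (\<lambda>x. x = 2) (Pop 1 ;; Push 0 2) (Pop 1 ;; Push 0 1)) ;; Pop 1"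

lemma run_unstash_loop:
  assumes "set xs \<subseteq> {1, 2}"
  shows "run (While 1 (\<lambda>x. x \<noteq> 3) (Cond 1 (\<lambda>x. x = 2) (Pop 1 ;; Push 0 2) (Pop 1 ;; Push 0 1)))
    (st u (xs @ 3 # v) w) (7 * length xs + 1) (st (rev xs @ u) (3 # v) w)"
  using assms
proof (induction xs arbitrary: u)
  case Nil
  show ?case by (rule run_weaken, rule run.WhileF) auto
next
  case (Cons x xs)
  have body: "run (Cond 1 (\<lambda>x. x = 2) (Pop 1 ;; Push 0 2) (Pop 1 ;; Push 0 1))
      (st u (x # xs @ 3 # v) w) ((1 + 2) + 2) (st (x # u) (xs @ 3 # v) w)"
  proof (cases "x = 2")
    case True
    show ?thesis by (rule run_weaken, rule run.CondT, simp add: True, (rule run.Seq run.Push run.Pop)+, simp_all add: True)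
  next
    case False
    then have "x = 1" using Cons.prems by auto
    then show ?thesis by - (rule run_weaken, rule run.CondF, simp, (rule run.Seq run.Push run.Pop)+, simp_all)
  qed
  have x: "x \<noteq> 3" using Cons.prems by auto
  have "run (While 1 (\<lambda>x. x \<noteq> 3) (Cond 1 (\<lambda>x. x = 2) (Pop 1 ;; Push 0 2) (Pop 1 ;; Push 0 1)))
      (st (x # u) (xs @ 3 # v) w) (7 * length xs + 1) (st (rev xs @ x # u) (3 # v) w)"
    by (rule Cons.IH) (use Cons.prems in auto)
  from run.WhileT[OF _ body this] x show ?case
    by (auto intro: run_weaken)
qed

lemma run_unstash: "run unstash (st u (rev (code a) @ 3 # v) []) (9 * dsize a) (st (code a @ u) v [])"
proof -
  have "run (While 1 (\<lambda>x. x \<noteq> 3) (Cond 1 (\<lambda>x. x = 2) (Pop 1 ;; Push 0 2) (Pop 1 ;; Push 0 1)))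
      (st u (rev (code a) @ 3 # v) []) (7 * dsize a + 1) (st (code a @ u) (3 # v) [])"
    using run_unstash_loop[of "rev (code a)"] code_symbols[of a] by auto
  then show ?thesis unfolding unstash_def
    by - (rule run_weaken, rule run.Seq, assumption, rule run_Pop, rule refl,
        use dsize_pos[of a] in auto)
qed

definition discard :: com where
  "discard = Push 2 1 ;; While 2 (\<lambda>x. x \<noteq> 0) (Cond 0 (\<lambda>x. x = 2) (Pop 0 ;; Push 2 1) (Pop 0 ;; Pop 2))"

text \<open>Stated for an arbitrary continuation of the loop: within a \<open>Node\<close> the loop
  does not stop after the first subtree, and the run for the second subtree serves as the
  continuation of the run for the first.\<close>

lemma run_discard_loop:
  defines "W \<equiv> While 2 (\<lambda>x. x \<noteq> 0) (Cond 0 (\<lambda>x. x = 2) (Pop 0 ;; Push 2 1) (Pop 0 ;; Pop 2))"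
  shows "run W (st u v w) T s \<Longrightarrow> run W (st (code a @ u) v (1 # w)) (T + 7 * dsize a) s"
proof (induction a arbitrary: u w T)
  case Leaf
  have body: "run (Cond 0 (\<lambda>x. x = 2) (Pop 0 ;; Push 2 1) (Pop 0 ;; Pop 2))
      (st (1 # u) v (1 # w)) ((1 + 1) + 2) (st u v w)"
    by (rule run_weaken, rule run.CondF, simp, (rule run.Seq run.Push run.Pop)+, simp_all)
  from run_WhileT[OF body Leaf[unfolded W_def]] show ?case by (simp add: W_def)
next
  case (Node a b)
  have body: "run (Cond 0 (\<lambda>x. x = 2) (Pop 0 ;; Push 2 1) (Pop 0 ;; Pop 2))
      (st (2 # code a @ code b @ u) v (1 # w)) ((1 + 2) + 2)
      (st (code a @ code b @ u) v (1 # 1 # w))"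
    by (rule run_weaken, rule run.CondT, simp, (rule run.Seq run.Push run.Pop)+, simp_all)
  from Node.IH(1)[OF Node.IH(2)[OF Node.prems]]
  have "run W (st (code a @ code b @ u) v (1 # 1 # w)) (T + 7 * dsize b + 7 * dsize a) s" .
  from run_WhileT[OF body this[unfolded W_def]] show ?case by (simp add: W_def)
qed

lemma run_discard: "run discard (st (code a @ u) v []) (10 * dsize a) (st u v [])"
proof -
  have 1: "run (While 2 (\<lambda>x. x \<noteq> 0) (Cond 0 (\<lambda>x. x = 2) (Pop 0 ;; Push 2 1) (Pop 0 ;; Pop 2)))
      (st u v []) 1 (st u v [])"
    by (rule run.WhileF) simp
  show ?thesis unfolding discard_def
    by (rule run_weaken, rule run.Seq, rule run_Push, rule refl, simp,
        rule run_discard_loop[OF 1, simplified]) (use dsize_pos[of a] in auto)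
qed

definition copy_back :: com where
  "copy_back = While 1 (\<lambda>x. x \<noteq> 3)
     (Cond 1 (\<lambda>x. x = 2) (Pop 1 ;; Push 0 2 ;; Push 2 2) (Pop 1 ;; Push 0 1 ;; Push 2 1))"

definition move21 :: com where
  "move21 = While 2 (\<lambda>x. x \<noteq> 0) (Cond 2 (\<lambda>x. x = 2) (Pop 2 ;; Push 1 2) (Pop 2 ;; Push 1 1))"

text \<open>\<open>copy_back\<close> turns the stashed tree into two copies, on stacks 0 and 2, and
  leaves the separator in place. \<open>move21\<close> reverses the second copy onto that separator,
  which restores the situation that \<open>unstash\<close> expects.\<close>

definition dup :: com where
  "dup = stash ;; copy_back ;; move21 ;; unstash"

lemma run_copy_back:
  assumes "set xs \<subseteq> {1, 2}"
  shows "run copy_back (st u (xs @ 3 # v) w) (9 * length xs + 1) (st (rev xs @ u) (3 # v) (rev xs @ w))"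
  using assms
proof (induction xs arbitrary: u w)
  case Nil
  show ?case unfolding copy_back_def by (rule run_weaken, rule run.WhileF) auto
next
  case (Cons x xs)
  have body: "run (Cond 1 (\<lambda>x. x = 2) (Pop 1 ;; Push 0 2 ;; Push 2 2) (Pop 1 ;; Push 0 1 ;; Push 2 1))
      (st u (x # xs @ 3 # v) w) ((1 + (2 + 2)) + 2) (st (x # u) (xs @ 3 # v) (x # w))"
  proof (cases "x = 2")
    case True
    show ?thesis by (rule run_weaken, rule run.CondT, simp add: True, (rule run.Seq run.Push run.Pop)+, simp_all add: True)
  next
    case False
    then have "x = 1" using Cons.prems by auto
    then show ?thesis by - (rule run_weaken, rule run.CondF, simp, (rule run.Seq run.Push run.Pop)+, simp_all)
  qed
  have x: "x \<noteq> 3" using Cons.prems by auto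
  have "run copy_back (st (x # u) (xs @ 3 # v) (x # w)) (9 * length xs + 1)
      (st (rev xs @ x # u) (3 # v) (rev xs @ x # w))"
    by (rule Cons.IH) (use Cons.prems in auto)
  from run.WhileT[OF _ body this[unfolded copy_back_def]] x show ?case
    by (auto intro: run_weaken simp: copy_back_def)
qed

lemma run_move21:
  assumes "set xs \<subseteq> {1, 2}"
  shows "run move21 (st u v xs) (7 * length xs + 1) (st u (rev xs @ v) [])"
  using assms
proof (induction xs arbitrary: v)
  case Nil
  show ?case unfolding move21_def by (rule run_weaken, rule run.WhileF) auto
next
  case (Cons x xs)
  have body: "run (Cond 2 (\<lambda>x. x = 2) (Pop 2 ;; Push 1 2) (Pop 2 ;; Push 1 1))
      (st u v (x # xs)) ((1 + 2) + 2) (st u (x # v) xs)"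
  proof (cases "x = 2")
    case True
    show ?thesis by (rule run_weaken, rule run.CondT, simp add: True, (rule run.Seq run.Push run.Pop)+, simp_all add: True)
  next
    case False
    then have "x = 1" using Cons.prems by auto
    then show ?thesis by - (rule run_weaken, rule run.CondF, simp, (rule run.Seq run.Push run.Pop)+, simp_all)
  qed
  have x: "x \<noteq> 0" using Cons.prems by auto
  have "run move21 (st u (x # v) xs) (7 * length xs + 1) (st u (rev xs @ x # v) [])"
    by (rule Cons.IH) (use Cons.prems in auto)
  from run.WhileT[OF _ body this[unfolded move21_def]] x show ?case
    by (auto intro: run_weaken simp: move21_def)
qed

lemma run_dup: "run dup (st (code a @ u) v []) (42 * dsize a) (st (code a @ code a @ u) v [])"
proof -
  have 1: "run copy_back (st u (rev (code a) @ 3 # v) []) (9 * dsize a + 1) (st (code a @ u) (3 # v) (code a))"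
    using run_copy_back[of "rev (code a)" u v "[]"] code_symbols[of a] by simp
  have 2: "run move21 (st (code a @ u) (3 # v) (code a)) (7 * dsize a + 1)
      (st (code a @ u) (rev (code a) @ 3 # v) [])"
    using run_move21[of "code a"] code_symbols[of a] by simp
  show ?thesis unfolding dup_def
    by (rule run_weaken, rule run.Seq, rule run_stash, rule run.Seq, rule 1, rule run.Seq, rule 2,
        rule run_unstash) (use dsize_pos[of a] in auto)
qed

section \<open>Sequencing, projections, pairing, branching and constants on trees\<close>

lemma does_Skip: "does Skip a 0 a"
  by (simp add: does_def run.Skip)

lemma does_Seq: "does c a T b \<Longrightarrow> does d b U e \<Longrightarrow> does (c ;; d) a (T + U) e"
  unfolding does_def using run.Seq by blast

definition car :: com where
  "car = Pop 0 ;; stash ;; discard ;; unstash"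

definition cdr :: com where
  "cdr = Pop 0 ;; discard"

lemma does_car: "does car (Node a b) (34 * dsize (Node a b)) a"
  unfolding does_def
proof (intro allI)
  fix u v
  show "run car (st (code (Node a b) @ u) v []) (34 * dsize (Node a b)) (st (code a @ u) v [])"
    unfolding car_def
    by (rule run_weaken, rule run.Seq, rule run_Pop, rule refl, simp, rule run.Seq, rule run_stash,
        rule run.Seq, rule run_discard, rule run_unstash) (use dsize_pos[of a] in auto)
qed

lemma does_cdr: "does cdr (Node a b) (34 * dsize (Node a b)) b"
  unfolding does_def
proof (intro allI)
  fix u v
  show "run cdr (st (code (Node a b) @ u) v []) (34 * dsize (Node a b)) (st (code b @ u) v [])"
    unfolding cdr_def
    by (rule run_weaken, rule run.Seq, rule run_Pop, rule refl, simp, rule run_discard)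
      (use dsize_pos[of a] in auto)
qed

definition mk_pair :: "com \<Rightarrow> com \<Rightarrow> com" where
  "mk_pair c d = dup ;; c ;; stash ;; d ;; unstash ;; Push 0 2"

lemma does_pair:
  assumes "does c a T b" "does d a U e"
  shows "does (mk_pair c d) a (68 * dsize a + 24 * T + U) (Node b e)"
  unfolding does_def
proof (intro allI)
  fix u v
  have c: "run c (st (code a @ code a @ u) v []) T (st (code b @ code a @ u) v [])"
    using assms(1) by (simp add: does_def)
  have d: "run d (st (code a @ u) (rev (code b) @ 3 # v) []) U (st (code e @ u) (rev (code b) @ 3 # v) [])"
    using assms(2) by (simp add: does_def)
  show "run (mk_pair c d) (st (code a @ u) v []) (68 * dsize a + 24 * T + U) (st (code (Node b e) @ u) v [])"
    unfolding mk_pair_def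
    \<comment> \<open>The intermediate result \<open>b\<close> is stashed and unstashed for 23 steps
      per symbol, and \<open>dsize b\<close> is at most \<open>dsize a + T\<close>; hence the factor
      24 = 1 + 23 of \<open>T\<close>. The factor of \<open>dsize a\<close> is 42 + 23, rounded up
      to absorb the last push.\<close>
    by (rule run_weaken, rule run.Seq, rule run_dup, rule run.Seq, rule c, rule run.Seq, rule run_stash,
        rule run.Seq, rule d, rule run.Seq, rule run_unstash, rule run_Push, rule refl)
      (use does_size[OF assms(1)] dsize_pos[of a] in auto)
qed

definition branch :: "com \<Rightarrow> com \<Rightarrow> com \<Rightarrow> com" where
  "branch h c d = dup ;; h ;; Cond 0 (\<lambda>x. x = 2) (discard ;; c) (discard ;; d)"

lemma does_branch:
  assumes "does h a T b" "does (if b = Leaf then d else c) a U e"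
  shows "does (branch h c d) a (54 * dsize a + 11 * T + U) e"
  unfolding does_def
proof (intro allI)
  fix u v
  have h: "run h (st (code a @ code a @ u) v []) T (st (code b @ code a @ u) v [])"
    using assms(1) by (simp add: does_def)
  have cd: "run (if b = Leaf then d else c) (st (code a @ u) v []) U (st (code e @ u) v [])"
    using assms(2) by (simp add: does_def)
  have "run (Cond 0 (\<lambda>x. x = 2) (discard ;; c) (discard ;; d)) (st (code b @ code a @ u) v [])
      ((10 * dsize b + U) + 2) (st (code e @ u) v [])"
  proof (cases "b = Leaf")
    case True
    show ?thesis
      by (rule run.CondF, simp add: True, rule run.Seq, rule run_discard) (use cd True in simp)
  next
    case False
    show ?thesis
      by (rule run.CondT, simp add: False top0_code, rule run.Seq, rule run_discard)
        (use cd False in simp)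
  qed
  then show "run (branch h c d) (st (code a @ u) v []) (54 * dsize a + 11 * T + U) (st (code e @ u) v [])"
    unfolding branch_def
    by - (rule run_weaken, rule run.Seq, rule run_dup, rule run.Seq, rule h, assumption,
        use does_size[OF assms(1)] dsize_pos[of a] in auto)
qed

fun push_code :: "nat list \<Rightarrow> com" where
  "push_code [] = Skip"
| "push_code (x # xs) = push_code xs ;; Push 0 x"

lemma run_push_code: "run (push_code xs) (st u v w) (2 * length xs) (st (xs @ u) v w)"
proof (induction xs)
  case (Cons x xs)
  show ?case unfolding push_code.simps
    by (rule run_weaken, rule run.Seq, rule Cons, rule run_Push, rule refl) auto
qed (use run.Skip in simp)

lemma wf_push_code: "set xs \<subseteq> {..<5} \<Longrightarrow> wf_com (push_code xs)"
  by (induction xs) auto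

lemma code_lt5: "set (code a) \<subseteq> {..<5}"
  using code_symbols[of a] by fastforce

definition const_com :: "data \<Rightarrow> com" where
  "const_com b = discard ;; push_code (code b)"

lemma does_const: "does (const_com b) a (10 * dsize a + 2 * dsize b) b"
  unfolding does_def const_com_def using run.Seq run_discard run_push_code by blast

section \<open>Iteration over lists\<close>

primrec dlist :: "data list \<Rightarrow> data" where
  "dlist [] = Leaf"
| "dlist (a # as) = Node a (dlist as)"

definition fold_body :: "com \<Rightarrow> com" where
  "fold_body c = mk_pair (car ;; cdr) (mk_pair (car ;; car) cdr ;; c)"

text \<open>Dropping the root symbol of the pair exposes the root of the list, which the loop can
  test for emptiness. The body puts the root symbol back while it works on the pair; the last
  \<open>Pop\<close> removes the code of the empty list.\<close>

definition fold_com :: "com \<Rightarrow> com" where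
  "fold_com c = Pop 0 ;; While 0 (\<lambda>x. x = 2) (Push 0 2 ;; fold_body c ;; Pop 0) ;; Pop 0"

lemma does_fold_body:
  assumes "does c (Node a s) T s'"
  shows "does (fold_body c) (Node (Node a l) s) (4000 * dsize (Node (Node a l) s) + T) (Node l s')"
proof -
  let ?N = "dsize (Node (Node a l) s)"
  have le: "dsize (Node a l) \<le> ?N" by simp
  have 1: "does (car ;; cdr) (Node (Node a l) s) (68 * ?N) l"
    by (rule does_weaken[OF does_Seq[OF does_car does_cdr]]) (use le in linarith)
  have 2: "does (car ;; car) (Node (Node a l) s) (68 * ?N) a"
    by (rule does_weaken[OF does_Seq[OF does_car does_car]]) (use le in linarith)
  have 3: "does (mk_pair (car ;; car) cdr ;; c) (Node (Node a l) s) (68 * ?N + 24 * (68 * ?N) + 34 * ?N + T) s'"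
    by (rule does_Seq[OF does_pair[OF 2 does_cdr] assms])
  \<comment> \<open>The factor obtained is 68 + 24 * 68 + (68 + 24 * 68 + 34) = 3434.\<close>
  show ?thesis unfolding fold_body_def
    by (rule does_weaken[OF does_pair[OF 1 3]]) linarith
qed

text \<open>The states are given as a sequence \<open>\<sigma>\<close>, so \<open>c\<close> has to
  be correct and fast only on the data that actually occur. The bounds \<open>T\<close>,
  \<open>M\<close> and \<open>L\<close> are uniform over the rounds; the induction shifts
  \<open>\<sigma>\<close> by one.\<close>

lemma run_fold_loop:
  assumes "\<And>i. i < length xs \<Longrightarrow> does c (Node (xs ! i) (\<sigma> i)) T (\<sigma> (Suc i))"
    and "\<And>i. i \<le> length xs \<Longrightarrow> dsize (\<sigma> i) \<le> M" and "dsize (dlist xs) \<le> L"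
  shows "run (While 0 (\<lambda>x. x = 2) (Push 0 2 ;; fold_body c ;; Pop 0))
    (st (code (dlist xs) @ code (\<sigma> 0) @ u) v [])
    (length xs * (4000 * (L + M + 1) + T + 5) + 1)
    (st (code Leaf @ code (\<sigma> (length xs)) @ u) v [])"
  using assms
proof (induction xs arbitrary: \<sigma>)
  case Nil
  show ?case by (rule run_weaken, rule run.WhileF) auto
next
  case (Cons x xs)
  let ?W = "While 0 (\<lambda>x. x = 2) (Push 0 2 ;; fold_body c ;; Pop 0)"
  let ?C = "4000 * (L + M + 1) + T + 5"
  let ?d = "Node (Node x (dlist xs)) (\<sigma> 0)"
  have "does (fold_body c) ?d (4000 * dsize ?d + T) (Node (dlist xs) (\<sigma> 1))"
    by (rule does_fold_body) (use Cons.prems(1)[of 0] in simp)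
  moreover have "dsize ?d \<le> L + M + 1" using Cons.prems(2)[of 0] Cons.prems(3) by simp
  ultimately have "does (fold_body c) ?d (4000 * (L + M + 1) + T) (Node (dlist xs) (\<sigma> 1))"
    by (elim does_weaken) simp
  then have F: "run (fold_body c) (st (2 # code (dlist (x # xs)) @ code (\<sigma> 0) @ u) v [])
      (4000 * (L + M + 1) + T) (st (2 # code (dlist xs) @ code (\<sigma> 1) @ u) v [])"
    by (simp add: does_def)
  have body: "run (Push 0 2 ;; fold_body c ;; Pop 0) (st (code (dlist (x # xs)) @ code (\<sigma> 0) @ u) v [])
      (2 + ((4000 * (L + M + 1) + T) + 1)) (st (code (dlist xs) @ code (\<sigma> 1) @ u) v [])"
    by (rule run.Seq, rule run_Push, rule refl, subst st_simps, subst st_simps, rule run.Seq, rule F,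
        rule run_Pop) simp
  have "run ?W (st (code (dlist xs) @ code (\<sigma> (Suc 0)) @ u) v []) (length xs * ?C + 1)
      (st (code Leaf @ code (\<sigma> (Suc (length xs))) @ u) v [])"
  proof (rule Cons.IH)
    fix i assume "i < length xs"
    then show "does c (Node (xs ! i) (\<sigma> (Suc i))) T (\<sigma> (Suc (Suc i)))"
      using Cons.prems(1)[of "Suc i"] by simp
  qed (use Cons.prems(2,3) in auto)
  then have IH: "run ?W (st (code (dlist xs) @ code (\<sigma> 1) @ u) v []) (length xs * ?C + 1)
      (st (code Leaf @ code (\<sigma> (Suc (length xs))) @ u) v [])" by simp
  have "run ?W (st (code (dlist (x # xs)) @ code (\<sigma> 0) @ u) v [])
     ((2 + ((4000 * (L + M + 1) + T) + 1)) + (length xs * ?C + 1) + 2)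
     (st (code Leaf @ code (\<sigma> (Suc (length xs))) @ u) v [])"
    by (rule run.WhileT[OF _ body IH]) simp
  then show ?case by (rule run_weaken) (auto simp: algebra_simps)
qed

lemma does_fold:
  assumes "\<And>i. i < length xs \<Longrightarrow> does c (Node (xs ! i) (\<sigma> i)) T (\<sigma> (Suc i))"
    and "\<And>i. i \<le> length xs \<Longrightarrow> dsize (\<sigma> i) \<le> M"
  shows "does (fold_com c) (Node (dlist xs) (\<sigma> 0))
    (length xs * (4000 * (dsize (dlist xs) + M + 1) + T + 5) + 3) (\<sigma> (length xs))"
  unfolding does_def
proof (intro allI)
  fix u v
  have "run (While 0 (\<lambda>x. x = 2) (Push 0 2 ;; fold_body c ;; Pop 0))
    (st (code (dlist xs) @ code (\<sigma> 0) @ u) v [])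
    (length xs * (4000 * (dsize (dlist xs) + M + 1) + T + 5) + 1)
    (st (code Leaf @ code (\<sigma> (length xs)) @ u) v [])"
    using assms by (rule run_fold_loop) auto
  then show "run (fold_com c) (st (code (Node (dlist xs) (\<sigma> 0)) @ u) v [])
      (length xs * (4000 * (dsize (dlist xs) + M + 1) + T + 5) + 3) (st (code (\<sigma> (length xs)) @ u) v [])"
    unfolding fold_com_def
    by - (rule run_weaken, rule run.Seq, rule run_Pop, rule refl, simp, rule run.Seq, simp,
        rule run_Pop, rule refl, simp_all)
qed

lemma wf_combinators [simp]:
  "wf_com stash" "wf_com unstash" "wf_com discard" "wf_com dup" "wf_com car" "wf_com cdr"
  "wf_com (mk_pair c d) \<longleftrightarrow> wf_com c \<and> wf_com d"
  "wf_com (branch h c d) \<longleftrightarrow> wf_com h \<and> wf_com c \<and> wf_com d"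
  "wf_com (const_com b)" "wf_com (fold_com c) \<longleftrightarrow> wf_com c"
  using wf_push_code[OF code_lt5]
  by (auto simp: stash_def scan_def unstash_def discard_def dup_def copy_back_def move21_def car_def
      cdr_def mk_pair_def branch_def const_com_def fold_com_def fold_body_def)

section \<open>Polynomial-time functions between encoded types\<close>

class coded =
  fixes encd :: "'a \<Rightarrow> data"

instantiation bool :: coded
begin
definition encd_bool :: "bool \<Rightarrow> data" where
  "encd_bool b = (if b then Node Leaf Leaf else Leaf)"
instance ..
end

instantiation prod :: (coded, coded) coded
begin
definition encd_prod :: "'a \<times> 'b \<Rightarrow> data" where
  "encd_prod p = Node (encd (fst p)) (encd (snd p))"
instance ..
end

instantiation list :: (coded) coded
begin
definition encd_list :: "'a list \<Rightarrow> data" where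
  "encd_list xs = dlist (map encd xs)"
instance ..
end

lemma encd_simps [simp]:
  "encd (a, b) = Node (encd a) (encd b)" "encd [] = Leaf" "encd (x # xs) = Node (encd x) (encd xs)"
  by (simp_all add: encd_prod_def encd_list_def)

definition csize :: "'a::coded \<Rightarrow> nat" where
  "csize x = dsize (encd x)"

lemma csize_pos: "1 \<le> csize x"
  using dsize_pos[of "encd x"] by (simp only: csize_def)

lemma csize_simps [simp]:
  "csize (a, b) = csize a + csize b + 1" "csize [] = 1" "csize (x # xs) = csize x + csize xs + 1"
  by (simp_all add: csize_def)

lemma csize_bool: "csize (b :: bool) \<le> 3"
  by (simp add: csize_def encd_bool_def)

lemma csize_append: "csize (xs @ ys) + 1 = csize xs + csize ys"
  by (induction xs) auto

lemma length_le_csize: "length xs \<le> csize xs"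
  by (induction xs) auto

lemma csize_mem: "x \<in> set xs \<Longrightarrow> csize x \<le> csize xs"
  by (induction xs) auto

lemma csize_tl: "csize (tl xs) \<le> csize xs"
  by (cases xs) auto

lemma csize_le_length_mult: "(\<And>x. x \<in> set xs \<Longrightarrow> csize x \<le> b) \<Longrightarrow> csize xs \<le> length xs * (b + 1) + 1"
  by (induction xs) (fastforce simp: algebra_simps)+

text \<open>Coefficients are natural numbers. Monotonicity is what allows one bound to be
  substituted into another.\<close>

lemma poly_mono: "m \<le> n \<Longrightarrow> poly (p :: nat poly) m \<le> poly p n"
  by (induction p) (auto intro: add_mono mult_mono)

section \<open>Bounds polynomial in the size of the code\<close>

definition polybound :: "('a::coded \<Rightarrow> nat) \<Rightarrow> bool" where
  "polybound b \<longleftrightarrow> (\<exists>p. \<forall>x. b x \<le> poly p (csize x))"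

lemma polybound_const: "polybound (\<lambda>x. n)"
  unfolding polybound_def by (rule exI[of _ "[:n:]"]) simp

lemma polybound_csize_id: "polybound (\<lambda>x. csize x)"
  unfolding polybound_def by (rule exI[of _ "[:0, 1:]"]) simp

lemma polybound_add: "polybound b \<Longrightarrow> polybound c \<Longrightarrow> polybound (\<lambda>x. b x + c x)"
  unfolding polybound_def
proof (elim exE)
  fix p q assume "\<forall>x. b x \<le> poly p (csize x)" "\<forall>x. c x \<le> poly q (csize x)"
  then show "\<exists>p. \<forall>x. b x + c x \<le> poly p (csize x)"
    by (intro exI[of _ "p + q"]) (simp add: add_mono)
qed

lemma polybound_mult: "polybound b \<Longrightarrow> polybound c \<Longrightarrow> polybound (\<lambda>x. b x * c x)"
  unfolding polybound_def
proof (elim exE)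
  fix p q assume "\<forall>x. b x \<le> poly p (csize x)" "\<forall>x. c x \<le> poly q (csize x)"
  then show "\<exists>p. \<forall>x. b x * c x \<le> poly p (csize x)"
    by (intro exI[of _ "p * q"]) (simp add: mult_mono)
qed

lemma polybound_mono: "polybound c \<Longrightarrow> (\<And>x. b x \<le> c x) \<Longrightarrow> polybound b"
  unfolding polybound_def by (meson le_trans)

lemma polybound_poly: "polybound b \<Longrightarrow> polybound (\<lambda>x. poly p (b x))"
  unfolding polybound_def
proof (elim exE)
  fix q assume "\<forall>x. b x \<le> poly q (csize x)"
  then show "\<exists>q. \<forall>x. poly p (b x) \<le> poly q (csize x)"
    by (intro exI[of _ "pcompose p q"]) (simp add: poly_pcompose poly_mono)
qed

lemma polybound_comp_size: "polybound b \<Longrightarrow> polybound (\<lambda>x. csize (f x)) \<Longrightarrow> polybound (\<lambda>x. b (f x))"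
  by (subst (asm) (1) polybound_def) (auto intro: polybound_mono polybound_poly)

section \<open>Polynomial-time functions and their basic closure properties\<close>

definition polytime :: "('a::coded \<Rightarrow> 'b::coded) \<Rightarrow> bool" where
  "polytime f \<longleftrightarrow> (\<exists>c T. wf_com c \<and> polybound T \<and> (\<forall>x. does c (encd x) (T x) (encd (f x))))"

lemma polytimeE:
  assumes "polytime f"
  obtains c T where "wf_com c" "polybound T" "\<And>x. does c (encd x) (T x) (encd (f x))"
  using assms unfolding polytime_def by blast

lemma polytimeI:
  "wf_com c \<Longrightarrow> (\<And>x. does c (encd x) (T x) (encd (f x))) \<Longrightarrow> polybound T \<Longrightarrow> polytime f"
  unfolding polytime_def by blast

lemma polybound_size: "polytime f \<Longrightarrow> polybound (\<lambda>x. csize (f x))"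
proof (erule polytimeE)
  fix c T assume "polybound T" "\<And>x. does c (encd x) (T x) (encd (f x))"
  then show ?thesis using does_size
    by (intro polybound_mono[OF polybound_add[OF polybound_csize_id \<open>polybound T\<close>]])
      (unfold csize_def, blast)
qed

lemma polybound_comp: "polybound b \<Longrightarrow> polytime f \<Longrightarrow> polybound (\<lambda>x. b (f x))"
  by (rule polybound_comp_size[OF _ polybound_size])

lemma polybound_length: "polytime f \<Longrightarrow> polybound (\<lambda>x. length (f x))"
  by (rule polybound_mono[OF polybound_size]) (auto simp: length_le_csize)

named_theorems polybound_intros
named_theorems polytime_intros

lemmas [polybound_intros] =
  polybound_const polybound_csize_id polybound_add polybound_mult polybound_size polybound_length

lemma polytime_id [polytime_intros]: "polytime (\<lambda>x. x)"
  by (rule polytimeI[of Skip "\<lambda>_. 0"]) (auto intro: does_Skip polybound_intros)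

lemma polytime_comp:
  assumes "polytime g" "polytime f"
  shows "polytime (\<lambda>x. g (f x))"
proof -
  obtain c T where c: "wf_com c" "polybound T" "\<And>x. does c (encd x) (T x) (encd (f x))"
    using assms(2) by (rule polytimeE) blast
  obtain d U where d: "wf_com d" "polybound U" "\<And>x. does d (encd x) (U x) (encd (g x))"
    using assms(1) by (rule polytimeE) blast
  show ?thesis
    by (rule polytimeI[of "c ;; d", OF _ does_Seq[OF c(3) d(3)]])
      (simp add: c d, intro polybound_add c polybound_comp[OF d(2)] assms)
qed

lemma polytime_const [polytime_intros]: "polytime (\<lambda>x. k)"
  by (rule polytimeI[of "const_com (encd k)", OF _ does_const])
    (simp, unfold csize_def[symmetric], intro polybound_intros)

lemma polytime_Pair [polytime_intros]:
  assumes "polytime f" "polytime g"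
  shows "polytime (\<lambda>x. (f x, g x))"
proof -
  obtain c T where c: "wf_com c" "polybound T" "\<And>x. does c (encd x) (T x) (encd (f x))"
    using assms(1) by (rule polytimeE) blast
  obtain d U where d: "wf_com d" "polybound U" "\<And>x. does d (encd x) (U x) (encd (g x))"
    using assms(2) by (rule polytimeE) blast
  show ?thesis
    by (rule polytimeI[of "mk_pair c d"], simp add: c d, unfold encd_simps, rule does_pair[OF c(3) d(3)])
      (intro polybound_intros c d, simp flip: csize_def, intro polybound_intros)
qed

lemma polytime_Cons [polytime_intros]:
  assumes "polytime f" "polytime g"
  shows "polytime (\<lambda>x. f x # g x)"
proof -
  obtain c T where c: "wf_com c" "polybound T" "\<And>x. does c (encd x) (T x) (encd (f x, g x))"
    using polytime_Pair[OF assms] by (rule polytimeE) blast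
  then show ?thesis by (intro polytimeI[of c T]) simp_all
qed

lemma polytime_fst [polytime_intros]:
  assumes "polytime f"
  shows "polytime (\<lambda>x. fst (f x))"
proof (rule polytime_comp[OF _ assms])
  show "polytime (fst :: 'b \<times> 'c \<Rightarrow> 'b)"
    by (rule polytimeI[of car], simp, unfold encd_prod_def, rule does_car)
      (simp flip: encd_prod_def csize_def, intro polybound_intros)
qed

lemma polytime_snd [polytime_intros]:
  assumes "polytime f"
  shows "polytime (\<lambda>x. snd (f x))"
proof (rule polytime_comp[OF _ assms])
  show "polytime (snd :: 'b \<times> 'c \<Rightarrow> 'c)"
    by (rule polytimeI[of cdr], simp, unfold encd_prod_def, rule does_cdr)
      (simp flip: encd_prod_def csize_def, intro polybound_intros)
qed

text \<open>\<open>polytime\<close> speaks of one argument, so a function of several arguments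
  enters in uncurried form. This is also how rules for terms with bound variables treat the
  environment together with the bound value.\<close>

lemma polytime_comp2:
  "polytime (\<lambda>p. h (fst p) (snd p)) \<Longrightarrow> polytime f \<Longrightarrow> polytime g \<Longrightarrow> polytime (\<lambda>x. h (f x) (g x))"
  using polytime_comp[of "\<lambda>p. h (fst p) (snd p)" "\<lambda>x. (f x, g x)"] polytime_Pair by auto

lemma polytime_comp3:
  "polytime (\<lambda>p. h (fst p) (fst (snd p)) (snd (snd p))) \<Longrightarrow> polytime f \<Longrightarrow> polytime g \<Longrightarrow> polytime k \<Longrightarrow>
   polytime (\<lambda>x. h (f x) (g x) (k x))"
  using polytime_comp[of "\<lambda>p. h (fst p) (fst (snd p)) (snd (snd p))" "\<lambda>x. (f x, g x, k x)"]
  by (simp add: polytime_Pair)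

lemma polytime_if [polytime_intros]:
  assumes "polytime b" "polytime f" "polytime g"
  shows "polytime (\<lambda>x. if b x then f x else g x)"
proof -
  obtain h S where h: "wf_com h" "polybound S" "\<And>x. does h (encd x) (S x) (encd (b x))"
    using assms(1) by (rule polytimeE) blast
  obtain c T where c: "wf_com c" "polybound T" "\<And>x. does c (encd x) (T x) (encd (f x))"
    using assms(2) by (rule polytimeE) blast
  obtain d U where d: "wf_com d" "polybound U" "\<And>x. does d (encd x) (U x) (encd (g x))"
    using assms(3) by (rule polytimeE) blast
  have cd: "does (if encd (b x) = Leaf then d else c) (encd x) (T x + U x)
      (encd (if b x then f x else g x))" for x
    using does_weaken[OF c(3)] does_weaken[OF d(3)] by (simp add: encd_bool_def)
  show ?thesis
    by (rule polytimeI[of "branch h c d", OF _ does_branch[OF h(3) cd]])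
      (use h c d in \<open>auto intro!: polybound_intros simp flip: csize_def\<close>)
qed

lemma polytime_case_list [polytime_intros]:
  assumes "polytime l" "polytime f" "polytime (\<lambda>p. g (fst p) (fst (snd p)) (snd (snd p)))"
  shows "polytime (\<lambda>x. case l x of [] \<Rightarrow> f x | y # ys \<Rightarrow> g x y ys)"
proof -
  obtain h S where h: "wf_com h" "polybound S" "\<And>x. does h (encd x) (S x) (encd (l x))"
    using assms(1) by (rule polytimeE) blast
  obtain c T where c: "wf_com c" "polybound T" "\<And>x. does c (encd x) (T x) (encd (f x))"
    using assms(2) by (rule polytimeE) blast
  obtain d U where d: "wf_com d" "polybound U"
    "\<And>p. does d (encd p) (U p) (encd (g (fst p) (fst (snd p)) (snd (snd p))))"
    using assms(3) by (rule polytimeE) blast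
  obtain p where p: "\<And>y. U y \<le> poly p (csize y)" using d(2) unfolding polybound_def by blast
  let ?d = "mk_pair Skip h ;; d"
  define V where "V x = T x + (68 * csize x + S x) + poly p (csize x + csize (l x) + 1)" for x
  have cd: "does (if encd (l x) = Leaf then c else ?d) (encd x) (V x)
      (encd (case l x of [] \<Rightarrow> f x | y # ys \<Rightarrow> g x y ys))" for x
  proof (cases "l x")
    case Nil
    then show ?thesis using does_weaken[OF c(3)] by (simp add: V_def)
  next
    case (Cons y ys)
    have "does (mk_pair Skip h) (encd x) (68 * dsize (encd x) + 24 * 0 + S x) (encd (x, l x))"
      using does_pair[OF does_Skip h(3)] by simp
    \<comment> \<open>The codes of \<open>(x, y # ys)\<close> and \<open>(x, y, ys)\<close>
      coincide, so pairing \<open>x\<close> with \<open>l x\<close> already yields the argument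
      tuple of \<open>g\<close>.\<close>
    then have "does (mk_pair Skip h) (encd x) (68 * csize x + S x) (encd (x, y, ys))"
      by (simp add: Cons csize_def)
    from does_Seq[OF this d(3)]
    have "does ?d (encd x) ((68 * csize x + S x) + U (x, y, ys)) (encd (g x y ys))" by simp
    moreover have "csize (x, y, ys) \<le> csize x + csize (l x) + 1" by (simp add: Cons)
    then have "U (x, y, ys) \<le> poly p (csize x + csize (l x) + 1)"
      using p poly_mono le_trans by blast
    ultimately show ?thesis by (simp add: Cons V_def does_weaken)
  qed
  have "polybound V" unfolding V_def
    by (intro polybound_intros polybound_poly c h assms)
  then show ?thesis
    by (intro polytimeI[of "branch h ?d c", OF _ does_branch[OF h(3) cd]])
      (use h c d in \<open>auto intro!: polybound_intros simp flip: csize_def\<close>)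
qed

text \<open>
  A loop whose body runs in polynomial time may still build up an exponentially large state, so
  a polynomial bound on all intermediate states has to be supplied.
\<close>

lemma polytime_fold_bounded:
  assumes xs: "polytime xs" and s: "polytime s"
    and f: "polytime (\<lambda>p. f (fst p) (fst (snd p)) (snd (snd p)))"
    and B: "polybound B" and le: "\<And>e n. csize (fold (f e) (take n (xs e)) (s e)) \<le> B e"
  shows "polytime (\<lambda>e. fold (f e) (xs e) (s e))"
proof -
  \<comment> \<open>The body of \<open>fold_com\<close> sees only the current element and the state;
    therefore the environment \<open>e\<close> travels inside the state and is projected away at the
    end.\<close>
  have "polytime (\<lambda>e. (xs e, (e, s e)))" by (intro polytime_intros xs s)
  then obtain c T where c: "wf_com c" "polybound T" "\<And>e. does c (encd e) (T e) (encd (xs e, (e, s e)))"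
    by (rule polytimeE) blast
  have "polytime (\<lambda>p. (fst (snd p), f (fst (snd p)) (fst p) (snd (snd p))))"
    by (intro polytime_intros polytime_comp3[OF f])
  then obtain d U where d: "wf_com d" "polybound U"
    "\<And>p. does d (encd p) (U p) (encd (fst (snd p), f (fst (snd p)) (fst p) (snd (snd p))))"
    by (rule polytimeE) blast
  obtain p where p: "\<And>y. U y \<le> poly p (csize y)" using d(2) unfolding polybound_def by blast
  let ?M = "\<lambda>e. csize (xs e) + (csize e + B e + 1) + 1"
  let ?F = "\<lambda>e. length (xs e) * (4000 * (csize (xs e) + (csize e + B e + 1) + 1) + poly p (?M e) + 5) + 3"
  have F: "does (fold_com d) (encd (xs e, (e, s e))) (?F e) (encd (e, fold (f e) (xs e) (s e)))" for e
  proof -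
    define \<sigma> where "\<sigma> i = encd (e, fold (f e) (take i (xs e)) (s e))" for i
    have "does (fold_com d) (Node (dlist (map encd (xs e))) (\<sigma> 0))
      (length (map encd (xs e)) * (4000 * (dsize (dlist (map encd (xs e))) + (csize e + B e + 1) + 1) + poly p (?M e) + 5) + 3)
      (\<sigma> (length (map encd (xs e))))"
    proof (rule does_fold)
      fix i assume "i < length (map encd (xs e))"
      then have i: "i < length (xs e)" by simp
      let ?q = "(xs e ! i, (e, fold (f e) (take i (xs e)) (s e)))"
      have "does d (encd ?q) (U ?q) (\<sigma> (Suc i))"
        using d(3)[of ?q] i by (simp add: \<sigma>_def take_Suc_conv_app_nth)
      moreover have "csize ?q \<le> ?M e" using le[of e i] csize_mem[OF nth_mem[OF i]] by simp
      then have "U ?q \<le> poly p (?M e)" using p poly_mono le_trans by blast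
      ultimately show "does d (Node (map encd (xs e) ! i) (\<sigma> i)) (poly p (?M e)) (\<sigma> (Suc i))"
        using i by (auto simp: \<sigma>_def intro: does_weaken)
    next
      fix i show "dsize (\<sigma> i) \<le> csize e + B e + 1"
        using le[of e i] by (simp add: \<sigma>_def csize_def)
    qed
    then show ?thesis by (simp add: \<sigma>_def csize_def encd_list_def)
  qed
  have "polytime (\<lambda>e. (e, fold (f e) (xs e) (s e)))"
    by (rule polytimeI[of "c ;; fold_com d", OF _ does_Seq[OF c(3) F]])
      (simp add: c d, intro polybound_intros polybound_poly c xs s B)
  from polytime_snd[OF this] show ?thesis by simp
qed

text \<open>The growth in one round depends on the environment and the element but not on the state,
  so it cannot compound: the total is at most the number of rounds times the largest growth.\<close>

lemma polytime_fold_additive: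
  assumes xs: "polytime xs" and s: "polytime s"
    and f: "polytime (\<lambda>p. f (fst p) (fst (snd p)) (snd (snd p)))"
    and B: "polybound B" and le: "\<And>e a s. csize (f e a s) \<le> csize s + B (e, a)"
  shows "polytime (\<lambda>e. fold (f e) (xs e) (s e))"
proof -
  obtain p where p: "\<And>y. B y \<le> poly p (csize y)" using B unfolding polybound_def by blast
  have ind: "csize (fold (f e) ys t) \<le> csize t + length ys * b" if "\<forall>a \<in> set ys. B (e, a) \<le> b" for e ys t b
    using that
  proof (induction ys arbitrary: t)
    case (Cons a ys)
    then have "csize (fold (f e) ys (f e a t)) \<le> csize (f e a t) + length ys * b" by simp
    also have "csize (f e a t) \<le> csize t + b" using le[of e a t] Cons.prems by force
    finally show ?case by simp
  qed simp
  show ?thesis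
  proof (rule polytime_fold_bounded[OF xs s f])
    fix e n
    let ?b = "poly p (csize e + csize (xs e) + 1)"
    have "B (e, a) \<le> ?b" if "a \<in> set (take n (xs e))" for a
    proof -
      have "csize (e, a) \<le> csize e + csize (xs e) + 1"
        using csize_mem[of a "xs e"] that by (auto dest: in_set_takeD)
      then show ?thesis using p poly_mono le_trans by blast
    qed
    then have "csize (fold (f e) (take n (xs e)) (s e)) \<le> csize (s e) + length (take n (xs e)) * ?b"
      by (intro ind) blast
    also have "\<dots> \<le> csize (s e) + length (xs e) * ?b" by simp
    finally show "csize (fold (f e) (take n (xs e)) (s e)) \<le> csize (s e) + length (xs e) * ?b" .
  qed (intro polybound_intros polybound_poly xs s)
qed

text \<open>For folds in which every new state is small whatever the previous one was, as for the
  table of the dynamic program.\<close>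

lemma polytime_fold_absolute:
  assumes xs: "polytime xs" and s: "polytime s"
    and f: "polytime (\<lambda>p. f (fst p) (fst (snd p)) (snd (snd p)))"
    and B: "polybound B" and le: "\<And>e a s. csize (f e a s) \<le> B (e, a)"
  shows "polytime (\<lambda>e. fold (f e) (xs e) (s e))"
  by (rule polytime_fold_additive[OF xs s f B]) (use le in \<open>simp add: trans_le_add2\<close>)

text \<open>Programs see only codes, so functions into different types can share one program; for
  instance, \<open>bits\<close> is computed by the identity.\<close>

lemma polytime_cong_encd: "polytime f \<Longrightarrow> (\<And>x. encd (f x) = encd (g x)) \<Longrightarrow> polytime g"
  by (simp add: polytime_def)

section \<open>Boolean connectives and list functions\<close>

lemma polytime_not [polytime_intros]: "polytime b \<Longrightarrow> polytime (\<lambda>x. \<not> b x)"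
  by (rule polytime_cong_encd[of "\<lambda>x. if b x then False else True"]) (intro polytime_intros, auto)

lemma polytime_conj [polytime_intros]: "polytime b \<Longrightarrow> polytime c \<Longrightarrow> polytime (\<lambda>x. b x \<and> c x)"
  by (rule polytime_cong_encd[of "\<lambda>x. if b x then c x else False"]) (intro polytime_intros, auto)

lemma polytime_disj [polytime_intros]: "polytime b \<Longrightarrow> polytime c \<Longrightarrow> polytime (\<lambda>x. b x \<or> c x)"
  using polytime_not[OF polytime_conj[OF polytime_not polytime_not, of b c]] by simp

lemma polytime_null [polytime_intros]: "polytime f \<Longrightarrow> polytime (\<lambda>x. f x = [])"
  by (rule polytime_cong_encd[of "\<lambda>x. case f x of [] \<Rightarrow> True | y # ys \<Rightarrow> False"])
    (intro polytime_intros, auto split: list.split)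

lemma polytime_tl [polytime_intros]: "polytime f \<Longrightarrow> polytime (\<lambda>x. tl (f x))"
  by (rule polytime_cong_encd[of "\<lambda>x. case f x of [] \<Rightarrow> [] | y # ys \<Rightarrow> ys"])
    (intro polytime_intros, auto split: list.split)

lemma polytime_rev [polytime_intros]:
  assumes "polytime f"
  shows "polytime (\<lambda>x. rev (f x))"
proof -
  have "polytime (\<lambda>x. fold (\<lambda>a s. a # s) (f x) [])"
    by (rule polytime_fold_additive[where B = "\<lambda>p. csize p"])
      (intro polytime_intros polybound_intros assms | simp)+
  then show ?thesis by (simp add: fold_Cons_rev)
qed

lemma polytime_append [polytime_intros]:
  assumes "polytime f" "polytime g"
  shows "polytime (\<lambda>x. f x @ g x)"
proof -
  have "polytime (\<lambda>x. fold (\<lambda>a s. a # s) (rev (f x)) (g x))"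
    by (rule polytime_fold_additive[where B = "\<lambda>p. csize p"])
      (intro polytime_intros polybound_intros assms | simp)+
  then show ?thesis by (simp add: fold_Cons_rev)
qed

lemma polytime_foldr_additive:
  assumes "polytime xs" "polytime s" "polytime (\<lambda>p. f (fst p) (fst (snd p)) (snd (snd p)))"
    and "polybound B" "\<And>e a s. csize (f e a s) \<le> csize s + B (e, a)"
  shows "polytime (\<lambda>e. foldr (f e) (xs e) (s e))"
  unfolding foldr_conv_fold
  by (rule polytime_fold_additive[where B = B]) (intro polytime_intros assms)+

lemma polytime_map [polytime_intros]:
  assumes xs: "polytime xs" and f: "polytime (\<lambda>p. f (fst p) (snd p))"
  shows "polytime (\<lambda>e. map (f e) (xs e))"
proof -
  have "polytime (\<lambda>e. foldr (\<lambda>a s. f e a # s) (xs e) [])"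
    by (rule polytime_foldr_additive[where B = "\<lambda>p. csize (f (fst p) (snd p)) + 1"])
      (intro polytime_intros polybound_intros xs f polytime_comp2[OF f] | simp)+
  moreover have "foldr (\<lambda>a s. f e a # s) ys [] = map (f e) ys" for e ys by (induction ys) auto
  ultimately show ?thesis by simp
qed

lemma polytime_concat [polytime_intros]:
  assumes xs: "polytime xs"
  shows "polytime (\<lambda>e. concat (xs e))"
proof -
  have le: "csize (a @ s) \<le> csize s + csize (e, a)" for e :: 'a and a s :: "'b list"
    using csize_append[of a s] by simp
  have "polytime (\<lambda>e. foldr (\<lambda>a s. a @ s) (xs e) [])"
    by (rule polytime_foldr_additive[where B = "\<lambda>p. csize p", OF _ _ _ _ le])
      (intro polytime_intros polybound_intros xs)+
  then show ?thesis by (simp add: concat_conv_foldr)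
qed

lemma polytime_filter [polytime_intros]:
  assumes xs: "polytime xs" and P: "polytime (\<lambda>p. P (fst p) (snd p))"
  shows "polytime (\<lambda>e. filter (P e) (xs e))"
proof -
  have "polytime (\<lambda>e. foldr (\<lambda>a s. if P e a then a # s else s) (xs e) [])"
    by (rule polytime_foldr_additive[where B = "\<lambda>p. csize p"])
      (intro polytime_intros polybound_intros xs polytime_comp2[OF P] | simp)+
  moreover have "foldr (\<lambda>a s. if P e a then a # s else s) ys [] = filter (P e) ys" for e ys
    by (induction ys) auto
  ultimately show ?thesis by simp
qed

lemma polytime_Bex [polytime_intros]:
  assumes "polytime xs" "polytime (\<lambda>p. P (fst p) (snd p))"
  shows "polytime (\<lambda>e. \<exists>a \<in> set (xs e). P e a)"
proof -
  have "polytime (\<lambda>e. filter (P e) (xs e) \<noteq> [])" by (intro polytime_intros assms)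
  then show ?thesis by (simp add: filter_empty_conv)
qed

lemma polytime_Ball [polytime_intros]:
  assumes "polytime xs" "polytime (\<lambda>p. P (fst p) (snd p))"
  shows "polytime (\<lambda>e. \<forall>a \<in> set (xs e). P e a)"
proof -
  have "polytime (\<lambda>e. \<not> (\<exists>a \<in> set (xs e). \<not> P e a))" by (intro polytime_intros assms)
  then show ?thesis by simp
qed

text \<open>An empty accumulator doubles as the flag that elements are still being dropped: once one
  has been kept, the accumulator stays nonempty.\<close>

lemma fold_dropWhile:
  "fold (\<lambda>a s. if s = [] \<and> P a then [] else a # s) xs s =
    (if s = [] then rev (dropWhile P xs) else rev xs @ s)"
  by (induction xs arbitrary: s) auto

lemma polytime_dropWhile [polytime_intros]:
  assumes xs: "polytime xs" and P: "polytime (\<lambda>p. P (fst p) (snd p))"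
  shows "polytime (\<lambda>e. dropWhile (P e) (xs e))"
proof -
  have "polytime (\<lambda>e. rev (fold (\<lambda>a s. if s = [] \<and> P e a then [] else a # s) (xs e) []))"
    by (intro polytime_rev polytime_fold_additive[where B = "\<lambda>p. csize p"])
      (intro polytime_intros polybound_intros xs polytime_comp2[OF P] | simp)+
  then show ?thesis by (simp add: fold_dropWhile)
qed

section \<open>Binary arithmetic in polynomial time\<close>

fun bits :: "nat \<Rightarrow> bool list" where
  "bits n = (if n = 0 then [] else odd n # bits (n div 2))"

declare bits.simps [simp del]

primrec bval :: "bool list \<Rightarrow> nat" where
  "bval [] = 0"
| "bval (b # bs) = of_bool b + 2 * bval bs"

lemma bits_0 [simp]: "bits 0 = []"
  by (simp add: bits.simps)

lemma bval_bits [simp]: "bval (bits n) = n"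
proof (induction n rule: bits.induct)
  case (1 n)
  then show ?case by (subst bits.simps) (auto simp: odd_two_times_div_two_succ)
qed

text \<open>On codes, \<open>bval\<close> merely strips zeros at the most significant end.
  \<open>foldr\<close> meets those digits first, while its result is still empty.\<close>

lemma bits_bval: "bits (bval bs) = foldr (\<lambda>b s. if \<not> b \<and> s = [] then [] else b # s) bs []"
proof (induction bs)
  case (Cons b bs)
  have "bits (bval (b # bs)) = (if \<not> b \<and> bits (bval bs) = [] then [] else b # bits (bval bs))"
  proof (cases "bval (b # bs) = 0")
    case True
    then show ?thesis by simp
  next
    case False
    have "bits (bval bs) \<noteq> []" if "\<not> b"
      using False that by (subst bits.simps) auto
    then show ?thesis using False by (subst bits.simps) auto
  qed
  then show ?case using Cons by simp
qed simp

lemma bval_less: "bval bs < 2 ^ length bs"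
  by (induction bs) auto

lemma length_bits_le: "length (bits n) \<le> n"
proof (induction n rule: bits.induct)
  case (1 n)
  then show ?case by (subst bits.simps) auto
qed

lemma length_bits_mono: "m \<le> n \<Longrightarrow> length (bits m) \<le> length (bits n)"
proof (induction n arbitrary: m rule: bits.induct)
  case (1 n)
  show ?case
  proof (cases "m = 0")
    case False
    then have "length (bits (m div 2)) \<le> length (bits (n div 2))"
      using 1 by (simp add: div_le_mono)
    then show ?thesis using False 1(2) by (subst (1 2) bits.simps) simp
  qed simp
qed

instantiation nat :: coded
begin
definition encd_nat :: "nat \<Rightarrow> data" where
  "encd_nat n = encd (bits n)"
instance ..
end

lemma csize_nat: "csize (n :: nat) = csize (bits n)"
  by (simp add: csize_def encd_nat_def)

lemma csize_bools: "2 * length bs + 1 \<le> csize (bs :: bool list)" "csize (bs :: bool list) \<le> 4 * length bs + 1"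
  by (induction bs) (auto simp: csize_def encd_bool_def)

text \<open>Sizes of codes are not monotone, since the digit one takes more symbols than the digit
  zero: 7 has a larger code than 8. Each digit contributes between 2 and 4 symbols, hence the factor
  2.\<close>

lemma csize_nat_mono: "(m :: nat) \<le> n \<Longrightarrow> csize m \<le> 2 * csize n"
  using length_bits_mono[of m n] csize_bools(2)[of "bits m"] csize_bools(1)[of "bits n"]
  by (simp add: csize_nat)

lemma csize_nat_le: "csize (n :: nat) \<le> 4 * n + 1"
  using length_bits_le[of n] csize_bools(2)[of "bits n"] by (simp add: csize_nat)

lemma polytime_bits [polytime_intros]: "polytime f \<Longrightarrow> polytime (\<lambda>x. bits (f x))"
  by (erule polytime_cong_encd) (simp add: encd_nat_def)

lemma polytime_bval [polytime_intros]:
  assumes "polytime f"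
  shows "polytime (\<lambda>x. bval (f x))"
proof -
  have "polytime (\<lambda>x. foldr (\<lambda>b s. if \<not> b \<and> s = [] then [] else b # s) (f x) [])"
    by (rule polytime_foldr_additive[where B = "\<lambda>p. csize p"])
      (intro polytime_intros polybound_intros assms | simp)+
  then show ?thesis by (rule polytime_cong_encd) (simp add: encd_nat_def bits_bval)
qed

section \<open>Comparison of binary numbers\<close>

definition hd_bit :: "bool list \<Rightarrow> bool" where
  "hd_bit bs = (case bs of [] \<Rightarrow> False | b # _ \<Rightarrow> b)"

lemma polytime_hd_bit [polytime_intros]: "polytime f \<Longrightarrow> polytime (\<lambda>x. hd_bit (f x))"
  unfolding hd_bit_def by (intro polytime_intros)

lemma bval_hd_tl: "bval bs = of_bool (hd_bit bs) + 2 * bval (tl bs)"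
  by (cases bs) (auto simp: hd_bit_def)

text \<open>Digits are compared from the least significant end. The flag is the verdict on the lower
  digits and is overruled whenever the current digits differ; starting it with \<open>True\<close>
  yields \<le> instead of <.\<close>

definition le_step :: "bool list \<times> bool list \<times> bool \<Rightarrow> bool list \<times> bool list \<times> bool" where
  "le_step s = (tl (fst s), tl (fst (snd s)),
     if hd_bit (fst s) then hd_bit (fst (snd s)) \<and> snd (snd s)
     else hd_bit (fst (snd s)) \<or> snd (snd s))"

lemma le_digit:
  "A < B \<or> A = B \<and> (if x then y \<and> b else y \<or> b) \<longleftrightarrow>
   of_bool x + 2 * A < of_bool y + 2 * B \<or> of_bool x + 2 * A = of_bool y + 2 * B \<and> b"
  for A B :: nat
  by (cases x; cases y; cases b; simp; presburger)

lemma fold_le_step: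
  "length as \<le> length L \<Longrightarrow> length bs \<le> length L \<Longrightarrow>
   snd (snd (fold (\<lambda>_. le_step) L (as, bs, b))) \<longleftrightarrow> bval as < bval bs \<or> bval as = bval bs \<and> b"
proof (induction L arbitrary: as bs b)
  case (Cons x L)
  then have "length (tl as) \<le> length L" "length (tl bs) \<le> length L" by auto
  note IH = Cons.IH[OF this]
  let ?b = "if hd_bit as then hd_bit bs \<and> b else hd_bit bs \<or> b"
  have "le_step (as, bs, b) = (tl as, tl bs, ?b)" by (simp add: le_step_def)
  then have "snd (snd (fold (\<lambda>_. le_step) (x # L) (as, bs, b))) \<longleftrightarrow>
      bval (tl as) < bval (tl bs) \<or> bval (tl as) = bval (tl bs) \<and> ?b"
    by (simp only: fold_simps comp_apply IH)
  also have "\<dots> \<longleftrightarrow> bval as < bval bs \<or> bval as = bval bs \<and> b"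
    unfolding bval_hd_tl[of as] bval_hd_tl[of bs] by (rule le_digit)
  finally show ?case .
qed simp

lemma polytime_le [polytime_intros]:
  fixes f g :: "'a::coded \<Rightarrow> nat"
  assumes "polytime f" "polytime g"
  shows "polytime (\<lambda>x. f x \<le> g x)"
proof -
  have le: "csize (le_step s) \<le> csize s + 3" for s
    using csize_tl[of "fst s"] csize_tl[of "fst (snd s)"] csize_bool[of "snd (snd (le_step s))"]
    by (cases s) (auto simp: le_step_def)
  \<comment> \<open>The list folded over is only a clock, long enough for both operands.\<close>
  have "polytime (\<lambda>x. snd (snd (fold (\<lambda>_. le_step) (bits (f x) @ bits (g x)) (bits (f x), bits (g x), True))))"
    by (intro polytime_snd polytime_fold_additive[where B = "\<lambda>_. 3", OF _ _ _ _ le])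
      (unfold le_step_def, (intro polytime_intros polybound_intros assms)+)
  then show ?thesis by (simp add: fold_le_step order_le_less del: fold_append)
qed

lemma polytime_less [polytime_intros]:
  fixes f g :: "'a::coded \<Rightarrow> nat"
  assumes "polytime f" "polytime g"
  shows "polytime (\<lambda>x. f x < g x)"
  unfolding not_le[symmetric] by (intro polytime_intros assms)

lemma polytime_eq_nat [polytime_intros]:
  fixes f g :: "'a::coded \<Rightarrow> nat"
  assumes "polytime f" "polytime g"
  shows "polytime (\<lambda>x. f x = g x)"
  unfolding order_eq_iff by (intro polytime_intros assms)

section \<open>Addition and counting\<close>

definition add_step ::
  "bool list \<times> bool list \<times> bool \<times> bool list \<Rightarrow> bool list \<times> bool list \<times> bool \<times> bool list" where
  "add_step s = (tl (fst s), tl (fst (snd s)),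
     (if fst (snd (snd s)) then hd_bit (fst s) \<or> hd_bit (fst (snd s))
      else hd_bit (fst s) \<and> hd_bit (fst (snd s))),
     (if hd_bit (fst s) then (if hd_bit (fst (snd s)) then fst (snd (snd s)) else \<not> fst (snd (snd s)))
      else (if hd_bit (fst (snd s)) then \<not> fst (snd (snd s)) else fst (snd (snd s))))
     # snd (snd (snd s)))"

lemma bval_snoc: "bval (bs @ [b]) = bval bs + 2 ^ length bs * of_bool b"
  by (induction bs) auto

text \<open>The invariant of schoolbook addition: the digits written so far plus, shifted by their
  number, what is still to be added including the carry.\<close>

lemma fold_add_step:
  "fold (\<lambda>_. add_step) L (as, bs, c, out) = (as', bs', c', out') \<Longrightarrow>
   length out' = length out + length L \<and>
   bval (rev out') + 2 ^ length out' * (bval as' + bval bs' + of_bool c') =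
   bval (rev out) + 2 ^ length out * (bval as + bval bs + of_bool c)"
proof (induction L arbitrary: as bs c out)
  case (Cons x L)
  obtain as1 bs1 c1 out1 where s: "add_step (as, bs, c, out) = (as1, bs1, c1, out1)"
    by (metis prod_cases4)
  have "length out1 = length out + 1 \<and>
    bval (rev out1) + 2 ^ length out1 * (bval as1 + bval bs1 + of_bool c1) =
    bval (rev out) + 2 ^ length out * (bval as + bval bs + of_bool c)"
    using s
    by (auto simp: add_step_def bval_snoc bval_hd_tl[of as] bval_hd_tl[of bs] algebra_simps split: if_splits)
  then show ?case using Cons.IH[of as1 bs1 c1 out1] Cons.prems s by auto
qed auto

lemma polytime_plus [polytime_intros]:
  fixes f g :: "'a::coded \<Rightarrow> nat"
  assumes "polytime f" "polytime g"
  shows "polytime (\<lambda>x. f x + g x)"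
proof -
  have le: "csize (add_step s) \<le> csize s + 10" for s
    using csize_tl[of "fst s"] csize_tl[of "fst (snd s)"] csize_bool[of "fst (snd (snd (add_step s)))"]
      csize_bool[of "hd (snd (snd (snd (add_step s))))"]
    by (cases s) (simp add: add_step_def)
  \<comment> \<open>The additional \<open>True\<close> lets the clock tick once more, for the final
    carry. It ensures \<open>m + n < 2 ^ length ?L\<close>, from which the invariant shows that
    nothing is left over.\<close>
  let ?fold = "\<lambda>m n. snd (snd (snd (fold (\<lambda>_. add_step) (bits m @ bits n @ [True]) (bits m, bits n, False, []))))"
  have "polytime (\<lambda>x. bval (rev (?fold (f x) (g x))))"
    by (intro polytime_bval polytime_rev polytime_snd polytime_fold_additive[where B = "\<lambda>_. 10", OF _ _ _ _ le])
      (unfold add_step_def, (intro polytime_intros polybound_intros assms)+)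
  moreover have "bval (rev (?fold m n)) = m + n" for m n
  proof -
    let ?L = "bits m @ bits n @ [True]"
    obtain as bs c out where r: "fold (\<lambda>_. add_step) ?L (bits m, bits n, False, []) = (as, bs, c, out)"
      by (metis prod_cases4)
    from fold_add_step[OF r] have len: "length out = length ?L"
      and eq: "bval (rev out) + 2 ^ length ?L * (bval as + bval bs + of_bool c) = m + n" by auto
    let ?l = "length (bits m) + length (bits n)"
    have "(2::nat) ^ length (bits m) \<le> 2 ^ ?l" "(2::nat) ^ length (bits n) \<le> 2 ^ ?l"
      by (rule power_increasing; simp)+
    then have "m < 2 ^ ?l" "n < 2 ^ ?l"
      using bval_less[of "bits m"] bval_less[of "bits n"] by (simp_all only: bval_bits less_le_trans)
    then have small: "m + n < 2 ^ length ?L" by simp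
    have "bval as + bval bs + of_bool c = 0"
    proof (rule ccontr)
      assume "bval as + bval bs + of_bool c \<noteq> 0"
      then have "2 ^ length ?L * 1 \<le> 2 ^ length ?L * (bval as + bval bs + of_bool c)"
        by (intro mult_le_mono2) (simp only: One_nat_def Suc_le_eq neq0_conv)
      with eq small show False by linarith
    qed
    then show ?thesis using eq r by (simp del: fold_append)
  qed
  ultimately show ?thesis by (simp only:)
qed

lemma polytime_Suc [polytime_intros]: "polytime f \<Longrightarrow> polytime (\<lambda>x. Suc (f x))"
  unfolding Suc_eq_plus1 by (intro polytime_intros)

lemma polytime_length [polytime_intros]:
  assumes xs: "polytime xs"
  shows "polytime (\<lambda>e. length (xs e))"
proof -
  have fold: "fold (\<lambda>_. Suc) ys k = k + length ys" for ys :: "'b list" and k :: nat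
    by (induction ys arbitrary: k) auto
  have "polytime (\<lambda>e. fold (\<lambda>_. Suc) (xs e) 0)"
  proof (rule polytime_fold_bounded[where B = "\<lambda>e. 4 * length (xs e) + 1"])
    fix e n
    show "csize (fold (\<lambda>_. Suc) (take n (xs e)) 0) \<le> 4 * length (xs e) + 1"
      using csize_nat_le[of "length (take n (xs e))"] unfolding fold by simp
  qed (intro polytime_intros polybound_intros xs)+
  then show ?thesis by (simp add: fold)
qed

section \<open>Polynomial-time predicates on words are in P\<close>

definition by_symbol :: "nat \<Rightarrow> (nat \<Rightarrow> com) \<Rightarrow> com" where
  "by_symbol i c = Cond i (\<lambda>x. x = 1) (c 1) (Cond i (\<lambda>x. x = 2) (c 2) (Cond i (\<lambda>x. x = 3) (c 3) (c 4)))"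

lemma run_by_symbol:
  assumes "run (c (top0 (s i))) s T s'" "top0 (s i) \<in> {1, 2, 3, 4}"
  shows "run (by_symbol i c) s (T + 6) s'"
proof -
  consider "top0 (s i) = 1" | "top0 (s i) = 2" | "top0 (s i) = 3" | "top0 (s i) = 4" using assms(2) by auto
  then show ?thesis
  proof cases
    case 1
    have "run (by_symbol i c) s (T + 2) s'"
      unfolding by_symbol_def by (rule run.CondT) (use 1 assms(1) in simp_all)
    then show ?thesis by (rule run.Weaken) simp
  next
    case 2
    have "run (by_symbol i c) s (T + 2 + 2) s'"
      unfolding by_symbol_def by (rule run.CondF, simp add: 2, rule run.CondT) (use 2 assms(1) in simp_all)
    then show ?thesis by (rule run.Weaken) simp
  next
    case 3
    have "run (by_symbol i c) s (T + 2 + 2 + 2) s'"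
      unfolding by_symbol_def
      by (rule run.CondF, simp add: 3, rule run.CondF, simp add: 3, rule run.CondT) (use 3 assms(1) in simp_all)
    then show ?thesis by (rule run.Weaken) simp
  next
    case 4
    have "run (by_symbol i c) s (T + 2 + 2 + 2) s'"
      unfolding by_symbol_def
      by (rule run.CondF, simp add: 4, rule run.CondF, simp add: 4, rule run.CondF) (use 4 assms(1) in simp_all)
    then show ?thesis by (rule run.Weaken) simp
  qed
qed

text \<open>The code of a list has its head on top of the stack and is therefore built from the last
  element; reversing the input first makes that element accessible.\<close>

definition move_input :: com where
  "move_input = While 0 (\<lambda>x. x \<noteq> 0) (by_symbol 0 (\<lambda>a. Pop 0 ;; Push 1 a))"

lemma run_move_input:
  "w \<in> lists {1, 2, 3, 4} \<Longrightarrow> run move_input (st w v []) (11 * length w + 1) (st [] (rev w @ v) [])"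
proof (induction w arbitrary: v)
  case Nil
  show ?case unfolding move_input_def by (rule run_weaken, rule run.WhileF) auto
next
  case (Cons a w)
  then have a: "a \<in> {1, 2, 3, 4}" by simp
  have "run (Pop 0 ;; Push 1 a) (st (a # w) v []) (1 + 2) (st w (a # v) [])"
    by (rule run_weaken, (rule run.Seq run.Push run.Pop)+) simp_all
  then have "run (by_symbol 0 (\<lambda>a. Pop 0 ;; Push 1 a)) (st (a # w) v []) (1 + 2 + 6) (st w (a # v) [])"
    by (intro run_by_symbol) (use a in simp_all)
  moreover have "run move_input (st w (a # v) []) (11 * length w + 1) (st [] (rev w @ a # v) [])"
    by (rule Cons.IH) (use Cons.prems in simp)
  ultimately show ?case
    unfolding move_input_def by (elim run_WhileT) (use a in auto)
qed

definition read_input :: com where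
  "read_input = While 1 (\<lambda>x. x \<noteq> 0) (by_symbol 1 (\<lambda>a. Pop 1 ;; push_code (code (encd a)) ;; Push 0 2))"

lemma run_read_input:
  "v \<in> lists {1, 2, 3, 4} \<Longrightarrow>
   run read_input (st (code (encd w)) v []) (50 * length v + 1) (st (code (encd (rev v @ w))) [] [])"
proof (induction v arbitrary: w)
  case Nil
  show ?case unfolding read_input_def by (rule run_weaken, rule run.WhileF) auto
next
  case (Cons a v)
  then have a: "a \<in> {1, 2, 3, 4}" by simp
  \<comment> \<open>4 * 4 + 1 = 17 for the largest symbol, so one round pops, pushes at most 17
    symbols and adds the \<open>Node\<close> in at most 1 + 34 + 2 steps.\<close>
  then have "csize a \<le> 17" using csize_nat_le[of a] by auto
  have 1: "run (Pop 1) (st (code (encd w)) (a # v) []) 1 (st (code (encd w)) v [])"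
    by (rule run_Pop) simp
  have 2: "run (Push 0 2) (st (code (encd a) @ code (encd w)) v []) 2 (st (code (encd (a # w))) v [])"
    by (rule run_Push) simp
  have "run (Pop 1 ;; push_code (code (encd a)) ;; Push 0 2) (st (code (encd w)) (a # v) []) 40
      (st (code (encd (a # w))) v [])"
    by (rule run_weaken[OF run.Seq[OF 1 run.Seq[OF run_push_code 2]]])
      (use \<open>csize a \<le> 17\<close> in \<open>simp_all add: csize_def\<close>)
  then have "run (by_symbol 1 (\<lambda>a. Pop 1 ;; push_code (code (encd a)) ;; Push 0 2))
      (st (code (encd w)) (a # v) []) (40 + 6) (st (code (encd (a # w))) v [])"
    by (intro run_by_symbol) (use a in simp_all)
  moreover have "run read_input (st (code (encd (a # w))) v []) (50 * length v + 1)
      (st (code (encd (rev v @ a # w))) [] [])"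
    by (rule Cons.IH) (use Cons.prems in simp)
  ultimately show ?case
    unfolding read_input_def by (elim run_WhileT) (use a in auto)
qed

lemma stack_tapes_init: "stack_tapes (snd (init_config (machine prog) w)) (st w [] [])"
  by (auto simp: stack_tapes_def init_config_def machine_def stack_tape_def less_Suc_eq numeral_3_eq_3 st_def)

lemma in_P_polytime:
  fixes f :: "nat list \<Rightarrow> bool"
  assumes "polytime f"
  shows "in_P {1, 2, 3, 4} {w \<in> lists {1, 2, 3, 4}. f w}"
proof -
  obtain c T where c: "wf_com c" "polybound T" "\<And>w. does c (encd w) (T w) (encd (f w))"
    using assms by (rule polytimeE) blast
  obtain p where p: "\<And>w. T w \<le> poly p (csize w)" using c(2) unfolding polybound_def by blast
  let ?\<Sigma> = "{1, 2, 3, 4} :: nat set"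
  \<comment> \<open>\<open>Push 0 1\<close> supplies the code of the empty list, from which the word
    is built up.\<close>
  define prg where "prg = move_input ;; Push 0 1 ;; read_input ;; c"
  let ?l = "code_len prg"
  \<comment> \<open>\<open>True\<close> is coded by a \<open>Node\<close>, which starts with 2. The
    two targets are the halting states, as \<open>last\<close> is the only instruction after
    \<open>prg\<close>.\<close>
  define last where "last = ((0, \<lambda>x. (x, Stay, if x = 2 then ?l + 1 else ?l + 2)) :: instr)"
  define ins_list where "ins_list = compile 0 prg @ [last]"
  let ?M = "machine ins_list"
  have wf: "wf_com prg"
    using c(1) wf_push_code[OF code_lt5]
    by (auto simp: prg_def move_input_def read_input_def by_symbol_def)
  have time: "run prg (st w [] []) (61 * length w + 4 + poly p (18 * length w + 1)) (st (code (encd (f w))) [] [])"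
    if w: "w \<in> lists ?\<Sigma>" for w
  proof -
    have "csize w \<le> length w * (17 + 1) + 1"
    proof (rule csize_le_length_mult)
      fix a assume "a \<in> set w"
      then have "a \<le> 4" using w by auto
      then show "csize a \<le> 17" using csize_nat_le[of a] by simp
    qed
    then have le: "T w \<le> poly p (18 * length w + 1)"
      using p[of w] poly_mono[of "csize w" "18 * length w + 1" p] by (simp add: mult.commute)
    have rw: "run read_input (st (code (encd ([] :: nat list))) (rev w) []) (50 * length (rev w) + 1)
        (st (code (encd (rev (rev w) @ []))) [] [])"
      by (rule run_read_input) (use w in auto)
    have rc: "run c (st (code (encd w)) [] []) (T w) (st (code (encd (f w))) [] [])"
      using c(3)[of w] unfolding does_def by (metis append.right_neutral)
    have rp: "run (Push 0 1) (st [] (rev w @ []) []) 2 (st (code (encd ([] :: nat list))) (rev w) [])"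
      by (rule run_Push) simp
    have "run prg (st w [] []) ((11 * length w + 1) + (2 + ((50 * length (rev w) + 1) + T w)))
        (st (code (encd (f w))) [] [])"
      unfolding prg_def by (rule run.Seq[OF run_move_input[OF w] run.Seq[OF rp run.Seq[OF rw]]]) (use rc in simp)
    then show ?thesis by (rule run_weaken) (use le in simp_all)
  qed
  \<comment> \<open>11 + 50 = 61 steps per input symbol and 1 + 2 + 1 further ones before
    \<open>c\<close> starts, plus one for the final test. The code of the input has at most 18
    symbols per letter and one for its end.\<close>
  have dec: "decides_in_time ?M ?\<Sigma> {w \<in> lists ?\<Sigma>. f w}
      (poly ([:5, 61:] + pcompose p [:1, 18:]))"
    unfolding decides_in_time_def
  proof (intro ballI)
    fix w assume w: "w \<in> lists ?\<Sigma>"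
    have init: "init_config ?M w = (0, snd (init_config ?M w))"
      by (simp add: init_config_def machine_def)
    have at0: "code_at ins_list 0 (compile 0 prg)"
      unfolding code_at_def ins_list_def by (intro exI[of _ "[]"] exI[of _ "[last]"]) simp
    have at1: "code_at ins_list ?l ([last])"
      unfolding code_at_def ins_list_def by (intro exI[of _ "compile 0 prg"] exI[of _ "[]"]) simp
    obtain t ts where t: "t \<le> 61 * length w + 4 + poly p (18 * length w + 1)"
      "(step ?M ^^ t) (init_config ?M w) = (?l, ts)" "stack_tapes ts (st (code (encd (f w))) [] [])"
      using compile_correct[OF time[OF w] wf at0 stack_tapes_init[of ins_list w]] init by auto
    let ?q = "if top0 (code (encd (f w))) = 2 then ?l + 1 else ?l + 2"
    obtain ts' where "step ?M (?l, ts) = (?q, ts')"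
      using step_test[OF t(3) at1[unfolded last_def]] by auto
    then have 1: "(step ?M ^^ (t + 1)) (init_config ?M w) = (?q, ts')"
      by (intro funpow_chain[OF t(2)]) simp
    have 2: "?q = (if w \<in> {w \<in> lists ?\<Sigma>. f w} then accept ?M else reject ?M)"
      using w by (simp add: encd_bool_def machine_def ins_list_def)
    have 3: "t + 1 \<le> poly ([:5, 61:] + pcompose p [:1, 18:]) (length w)"
      using t(1) by (simp add: poly_pcompose algebra_simps)
    show "\<exists>t \<le> poly ([:5, 61:] + pcompose p [:1, 18:]) (length w).
        fst ((step ?M ^^ t) (init_config ?M w)) =
        (if w \<in> {w \<in> lists ?\<Sigma>. f w} then accept ?M else reject ?M)"
      by (intro exI[of _ "t + 1"] conjI 3) (simp only: 1 2 fst_conv)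
  qed
  have "wf_tm ?M"
  proof (rule wf_machine)
    fix ins assume "ins \<in> set ins_list"
    then consider "ins \<in> set (compile 0 prg)" | "ins = last" by (auto simp: ins_list_def)
    then show "wf_instr (length ins_list + 1) ins"
    proof cases
      case 1
      from wf_instr_compile[OF wf this] show ?thesis by (rule wf_instr_mono) (simp add: ins_list_def)
    qed (simp add: wf_instr_def last_def ins_list_def)
  qed
  moreover have "?\<Sigma> \<subseteq> {..<num_symbols ?M}" by (auto simp: machine_def)
  ultimately have "\<exists>M p. wf_tm M \<and> ?\<Sigma> \<subseteq> {..<num_symbols M} \<and> decides_in_time M ?\<Sigma> {w \<in> lists ?\<Sigma>. f w} (poly p)"
    using dec by (intro exI conjI)
  then show ?thesis unfolding in_P_def by (intro conjI) auto
qed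

section \<open>The number of voters preferring one candidate to another\<close>

definition after :: "'c \<Rightarrow> 'c list \<Rightarrow> 'c list" where
  "after c v = tl (dropWhile (\<lambda>x. x \<noteq> c) v)"

lemma takeWhile_dropWhile_neq:
  assumes "c \<notin> set as"
  shows "takeWhile (\<lambda>x. x \<noteq> c) (as @ bs) = as @ takeWhile (\<lambda>x. x \<noteq> c) bs"
    "dropWhile (\<lambda>x. x \<noteq> c) (as @ bs) = dropWhile (\<lambda>x. x \<noteq> c) bs"
  using assms by (induction as) auto

lemma split_ranking:
  assumes "c \<in> set v" "distinct v"
  obtains as bs where "v = as @ c # bs" "c \<notin> set as" "c \<notin> set bs"
    "takeWhile (\<lambda>x. x \<noteq> c) v = as" "dropWhile (\<lambda>x. x \<noteq> c) v = c # bs" "after c v = bs"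
proof -
  obtain as bs where v: "v = as @ c # bs" "c \<notin> set as" by (metis assms(1) split_list_first)
  then have "takeWhile (\<lambda>x. x \<noteq> c) v = as" "dropWhile (\<lambda>x. x \<noteq> c) v = c # bs"
    by (simp_all add: takeWhile_dropWhile_neq)
  with v assms(2) that show ?thesis by (auto simp: after_def)
qed

text \<open>Replaces positions by membership in a tail of the ranking, which is the form that the
  decision procedure computes.\<close>

lemma pos_less_iff:
  assumes "distinct v" "c \<in> set v" "x \<in> set v" "c \<noteq> x"
  shows "pos v c < pos v x \<longleftrightarrow> x \<in> set (after c v)"
  using assms(2,1)
proof (rule split_ranking)
  fix as bs
  assume v: "v = as @ c # bs" "takeWhile (\<lambda>x. x \<noteq> c) v = as" "after c v = bs"
  show ?thesis
  proof (cases "x \<in> set as")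
    case True
    then have "x \<notin> set bs" using assms(1) v(1) by auto
    moreover have "length (takeWhile (\<lambda>y. y \<noteq> x) v) \<le> length as"
      using True by (simp add: v(1) takeWhile_append1 length_takeWhile_le)
    ultimately show ?thesis by (simp add: pos_def v(2,3))
  next
    case False
    then have "x \<in> set bs" using assms(3,4) v(1) by auto
    moreover have "length (takeWhile (\<lambda>y. y \<noteq> x) v) > length as"
      using False assms(4) by (simp add: v(1) takeWhile_dropWhile_neq)
    ultimately show ?thesis by (simp add: pos_def v(2,3))
  qed
qed

lemma length_after: "distinct v \<Longrightarrow> c \<in> set v \<Longrightarrow> length (after c v) = length v - pos v c"
  by (erule (1) split_ranking) (simp add: pos_def)

lemma after_filter:
  assumes "distinct v" "c \<in> set v" "c \<noteq> d"
  shows "after c (filter (\<lambda>x. x \<noteq> d) v) = filter (\<lambda>x. x \<noteq> d) (after c v)"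
  using assms(2,1)
proof (rule split_ranking)
  fix as bs assume "v = as @ c # bs" "c \<notin> set as" "after c v = bs"
  moreover from this have "after c (filter (\<lambda>x. x \<noteq> d) as @ c # filter (\<lambda>x. x \<noteq> d) bs) = filter (\<lambda>x. x \<noteq> d) bs"
    by (simp add: after_def takeWhile_dropWhile_neq)
  ultimately show ?thesis using assms(3) by simp
qed

text \<open>The third equation governs all comparisons with \<open>d\<close>; the fourth governs all
  others, since these can be read off the ranking with \<open>d\<close> deleted. If \<open>t\<close>
  is too large, \<open>d\<close> just becomes last, but a valid price function makes such a shift
  infinitely expensive.\<close>

lemma shift_back_props:
  assumes "distinct v" "d \<in> set v"
  shows "distinct (shift_back d t v)" "set (shift_back d t v) = set v"
    "after d (shift_back d t v) = drop t (after d v)"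
    "filter (\<lambda>x. x \<noteq> d) (shift_back d t v) = filter (\<lambda>x. x \<noteq> d) v"
proof -
  obtain as bs where v: "v = as @ d # bs" "d \<notin> set as" "d \<notin> set bs" "after d v = bs"
    and s: "shift_back d t v = as @ take t bs @ d # drop t bs"
  proof (rule split_ranking[OF assms(2,1)], goal_cases)
    case (1 as bs)
    then show ?case by (intro 1(1)[of as bs]) (simp_all add: shift_back_def)
  qed
  have bs: "bs = take t bs @ drop t bs" by simp
  have dt: "distinct (take t bs @ drop t bs)" "set (take t bs @ drop t bs) = set bs"
    using assms(1) v(1) by (simp_all only: bs[symmetric] distinct_append distinct.simps)
  have du: "set (take t bs) \<union> set (drop t bs) = set bs" by (metis append_take_drop_id set_append)
  have nt: "d \<notin> set (take t bs)" "d \<notin> set (drop t bs)"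
    using v(3) by (auto dest: in_set_takeD in_set_dropD)
  show "distinct (shift_back d t v)"
    using assms(1) v(1-3) dt(1)[unfolded distinct_append] nt unfolding s
    by (auto dest: in_set_takeD in_set_dropD)
  show "set (shift_back d t v) = set v"
    unfolding s unfolding v(1) using du by auto
  show "after d (shift_back d t v) = drop t (after d v)"
    unfolding v(4) unfolding s after_def using v(2) nt(1) by (simp add: takeWhile_dropWhile_neq)
  have "filter (\<lambda>x. x \<noteq> d) (take t bs) @ filter (\<lambda>x. x \<noteq> d) (drop t bs) = filter (\<lambda>x. x \<noteq> d) bs"
    by (metis append_take_drop_id filter_append)
  then show "filter (\<lambda>x. x \<noteq> d) (shift_back d t v) = filter (\<lambda>x. x \<noteq> d) v"
    unfolding s unfolding v(1) by simp
qed

lemma pos_shift_back_others: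
  assumes "distinct v" "d \<in> set v" "c \<in> set v" "x \<in> set v" "c \<noteq> d" "x \<noteq> d" "c \<noteq> x"
  shows "pos (shift_back d t v) c < pos (shift_back d t v) x \<longleftrightarrow> pos v c < pos v x"
proof -
  note s = shift_back_props[OF assms(1,2), of t]
  have "x \<in> set (after c (shift_back d t v)) \<longleftrightarrow>
      x \<in> set (filter (\<lambda>x. x \<noteq> d) (after c (shift_back d t v)))" using assms(6) by simp
  also have "\<dots> \<longleftrightarrow> x \<in> set (filter (\<lambda>x. x \<noteq> d) (after c v))"
    using after_filter[OF s(1) _ assms(5)] after_filter[OF assms(1,3,5)] s(2,4) assms(3) by simp
  finally show ?thesis
    using pos_less_iff[OF s(1), of c x] pos_less_iff[OF assms(1,3,4,7)] s(2) assms by auto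
qed

text \<open>Indicator that the voter still ranks \<open>d\<close> above \<open>x\<close> after
  moving \<open>d\<close> back by \<open>t\<close> places.\<close>

definition hits :: "'c \<Rightarrow> 'c \<Rightarrow> 'c ranking \<Rightarrow> nat \<Rightarrow> nat" where
  "hits d x v t = of_bool (x \<in> set (drop t (after d v)))"

lemma num_prefer_sum: "num_prefer E c x = (\<Sum>v \<leftarrow> snd E. of_bool (pos v c < pos v x))"
proof -
  have "length (filter P vs) = (\<Sum>v \<leftarrow> vs. of_bool (P v))" for P :: "'a list \<Rightarrow> bool" and vs
    by (induction vs) auto
  then show ?thesis by (simp add: num_prefer_def)
qed

lemma num_prefer_shift_despised:
  assumes "is_election (C, V)" "d \<in> C" "x \<in> C" "x \<noteq> d" "length ts = length V"
  shows "num_prefer (C, map2 (shift_back d) ts V) d x = (\<Sum>(v, t) \<leftarrow> zip V ts. hits d x v t)"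
proof -
  have V: "\<forall>v \<in> set V. distinct v \<and> set v = C" using assms(1) by (simp add: is_election_def)
  have "map (\<lambda>v. of_bool (pos v d < pos v x)) (map2 (shift_back d) ts V) = map (\<lambda>(v, t). hits d x v t) (zip V ts)"
  proof (rule nth_equalityI)
    fix i assume "i < length (map (\<lambda>v. of_bool (pos v d < pos v x) :: nat) (map2 (shift_back d) ts V))"
    then have i: "i < length V" by simp
    then have v: "distinct (V ! i)" "set (V ! i) = C" using V by auto
    note s = shift_back_props[OF v(1), of d "ts ! i"]
    have "pos (shift_back d (ts ! i) (V ! i)) d < pos (shift_back d (ts ! i) (V ! i)) x
        \<longleftrightarrow> x \<in> set (after d (shift_back d (ts ! i) (V ! i)))"
      by (rule pos_less_iff) (use s v assms in auto)
    then show "map (\<lambda>v. of_bool (pos v d < pos v x)) (map2 (shift_back d) ts V) ! i =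
        map (\<lambda>(v, t). hits d x v t) (zip V ts) ! i"
      using i assms(5) s(3) v assms(2) by (simp add: hits_def)
  qed (use assms(5) in simp)
  then show ?thesis by (simp add: num_prefer_sum)
qed

lemma num_prefer_shift_others:
  assumes "is_election (C, V)" "d \<in> C" "c \<in> C" "x \<in> C" "c \<noteq> d" "x \<noteq> d" "c \<noteq> x" "length ts = length V"
  shows "num_prefer (C, map2 (shift_back d) ts V) c x = num_prefer (C, V) c x"
proof -
  have V: "\<forall>v \<in> set V. distinct v \<and> set v = C" using assms(1) by (simp add: is_election_def)
  have "map (\<lambda>v. of_bool (pos v c < pos v x) :: nat) (map2 (shift_back d) ts V) = map (\<lambda>v. of_bool (pos v c < pos v x)) V"
  proof (rule nth_equalityI)
    fix i assume "i < length (map (\<lambda>v. of_bool (pos v c < pos v x) :: nat) (map2 (shift_back d) ts V))"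
    then have i: "i < length V" by simp
    then have v: "distinct (V ! i)" "set (V ! i) = C" using V by auto
    have "pos (shift_back d (ts ! i) (V ! i)) c < pos (shift_back d (ts ! i) (V ! i)) x \<longleftrightarrow>
        pos (V ! i) c < pos (V ! i) x"
      by (rule pos_shift_back_others) (use v assms in auto)
    then show "map (\<lambda>v. of_bool (pos v c < pos v x) :: nat) (map2 (shift_back d) ts V) ! i =
        map (\<lambda>v. of_bool (pos v c < pos v x)) V ! i" using i assms(8) by simp
  qed (use assms(8) in simp)
  then show ?thesis by (simp add: num_prefer_sum)
qed

lemma is_election_shift:
  assumes "is_election (C, V)" "d \<in> C"
  shows "is_election (C, map2 (shift_back d) ts V)"
  using assms shift_back_props by (fastforce simp: is_election_def dest: set_zip_rightD)

lemma num_prefer_swap: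
  assumes "is_election (C, V)" "c \<in> C" "x \<in> C" "c \<noteq> x"
  shows "num_prefer (C, V) c x + num_prefer (C, V) x c = length V"
proof -
  have "pos v c \<noteq> pos v x" if "v \<in> set V" for v
  proof -
    have v: "distinct v" "c \<in> set v" "x \<in> set v" using assms that by (auto simp: is_election_def)
    have "x \<in> set (after c v) \<or> c \<in> set (after x v)"
    proof -
      obtain as bs where v': "v = as @ c # bs" "after c v = bs" "c \<notin> set as" using v by (auto elim: split_ranking)
      show ?thesis
      proof (cases "x \<in> set as")
        case True
        then obtain as1 as2 where "as = as1 @ x # as2" "x \<notin> set as1" by (metis split_list_first)
        then have "after x v = as2 @ c # bs" using v'(1) by (simp add: after_def takeWhile_dropWhile_neq)
        then show ?thesis by simp
      qed (use v v' assms(4) in auto)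
    qed
    then show ?thesis using pos_less_iff[OF v assms(4)] pos_less_iff[OF v(1,3,2)] assms(4) by auto
  qed
  then have "pos v x < pos v c \<longleftrightarrow> \<not> pos v c < pos v x" if "v \<in> set V" for v
    using that by (metis less_asym linorder_neqE_nat)
  then have "num_prefer (C, V) x c = length (filter (\<lambda>v. \<not> pos v c < pos v x) V)"
    unfolding num_prefer_def by (simp cong: filter_cong)
  then show ?thesis by (simp add: num_prefer_def sum_length_filter_compl)
qed

section \<open>When the despised candidate is not the unique Maximin winner\<close>

text \<open>Scores disappear because one minimum is at most another iff some element of the first
  set lies below all elements of the second. If \<open>d\<close> is the only candidate, both sides
  are false; its unspecified score is compared with itself only.\<close>

lemma maximin_not_unique:
  assumes "finite C" "d \<in> C"
  shows "maximin (C, V) \<noteq> {d} \<longleftrightarrow>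
    (\<exists>c \<in> C - {d}. \<exists>c' \<in> C - {d}. \<forall>x \<in> C - {c}. num_prefer (C, V) d c' \<le> num_prefer (C, V) c x)"
proof -
  let ?s = "maximin_score (C, V)" and ?N = "num_prefer (C, V)"
  have "maximin (C, V) \<noteq> {d} \<longleftrightarrow> (\<exists>c \<in> C - {d}. ?s d \<le> ?s c)"
  proof
    assume ne: "maximin (C, V) \<noteq> {d}"
    show "\<exists>c \<in> C - {d}. ?s d \<le> ?s c"
    proof (cases "d \<in> maximin (C, V)")
      case True
      then obtain c where "c \<in> maximin (C, V)" "c \<noteq> d" using ne by blast
      then show ?thesis using assms(2) by (auto simp: maximin_def)
    next
      case False
      then obtain c where "c \<in> C" "?s d < ?s c" using assms(2) by (auto simp: maximin_def not_le)
      then show ?thesis by (intro bexI[of _ c]) auto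
    qed
  next
    assume "\<exists>c \<in> C - {d}. ?s d \<le> ?s c"
    then obtain c where c: "c \<in> C" "c \<noteq> d" "?s d \<le> ?s c" by blast
    show "maximin (C, V) \<noteq> {d}"
    proof
      assume eq: "maximin (C, V) = {d}"
      then have "\<forall>c' \<in> C. ?s c' \<le> ?s d" by (auto simp: maximin_def)
      then have "c \<in> maximin (C, V)" using c by (auto simp: maximin_def intro: le_trans)
      with eq c(2) show False by simp
    qed
  qed
  also have "\<dots> \<longleftrightarrow> (\<exists>c \<in> C - {d}. \<exists>c' \<in> C - {d}. \<forall>x \<in> C - {c}. ?N d c' \<le> ?N c x)"
  proof (rule bex_cong[OF refl])
    fix c assume c: "c \<in> C - {d}"
    have fin: "finite (?N d ` (C - {d}))" "finite (?N c ` (C - {c}))" using assms(1) by auto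
    have ne: "?N d ` (C - {d}) \<noteq> {}" "?N c ` (C - {c}) \<noteq> {}" using c assms(2) by auto
    show "?s d \<le> ?s c \<longleftrightarrow> (\<exists>c' \<in> C - {d}. \<forall>x \<in> C - {c}. ?N d c' \<le> ?N c x)"
    proof
      assume le: "?s d \<le> ?s c"
      obtain c' where c': "c' \<in> C - {d}" "?s d = ?N d c'"
        using Min_in[OF fin(1) ne(1)] by (auto simp: maximin_score_def)
      have "?s d \<le> ?N c x" if "x \<in> C - {c}" for x
        using le Min_le[OF fin(2)] that by (fastforce simp: maximin_score_def)
      then show "\<exists>c' \<in> C - {d}. \<forall>x \<in> C - {c}. ?N d c' \<le> ?N c x" using c' by auto
    next
      assume "\<exists>c' \<in> C - {d}. \<forall>x \<in> C - {c}. ?N d c' \<le> ?N c x"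
      then obtain c' where c': "c' \<in> C - {d}" "\<And>x. x \<in> C - {c} \<Longrightarrow> ?N d c' \<le> ?N c x" by blast
      have "?s d \<le> ?N d c'" using c'(1) fin(1) by (simp add: maximin_score_def)
      also obtain x where x: "x \<in> C - {c}" "?s c = ?N c x"
        using Min_in[OF fin(2) ne(2)] by (auto simp: maximin_score_def)
      then have "?N d c' \<le> ?s c" using c'(2)[OF x(1)] by simp
      finally show "?s d \<le> ?s c" .
    qed
  qed
  finally show ?thesis .
qed

text \<open>The comparison for \<open>x = d\<close> is written as a sum of two counts, which avoids
  truncated subtraction and leaves only sums over voters that depend on the shifts.\<close>

lemma bribed_not_unique:
  assumes el: "is_election (C, V)" and d: "d \<in> C" and ts: "length ts = length V"
  shows "maximin (C, map2 (shift_back d) ts V) \<noteq> {d} \<longleftrightarrow>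
    (\<exists>c \<in> C - {d}. \<exists>c' \<in> C - {d}.
       (\<Sum>(v, t) \<leftarrow> zip V ts. hits d c' v t) + (\<Sum>(v, t) \<leftarrow> zip V ts. hits d c v t) \<le> length V \<and>
       (\<forall>x \<in> C. x \<noteq> c \<longrightarrow> x \<noteq> d \<longrightarrow> (\<Sum>(v, t) \<leftarrow> zip V ts. hits d c' v t) \<le> num_prefer (C, V) c x))"
proof -
  let ?W = "map2 (shift_back d) ts V"
  have fin: "finite C" using el by (simp add: is_election_def)
  have "(\<forall>x \<in> C - {c}. num_prefer (C, ?W) d c' \<le> num_prefer (C, ?W) c x) \<longleftrightarrow>
       (\<Sum>(v, t) \<leftarrow> zip V ts. hits d c' v t) + (\<Sum>(v, t) \<leftarrow> zip V ts. hits d c v t) \<le> length V \<and>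
       (\<forall>x \<in> C. x \<noteq> c \<longrightarrow> x \<noteq> d \<longrightarrow> (\<Sum>(v, t) \<leftarrow> zip V ts. hits d c' v t) \<le> num_prefer (C, V) c x)"
    if c: "c \<in> C - {d}" and c': "c' \<in> C - {d}" for c c'
  proof -
    have eq: "num_prefer (C, ?W) d x = (\<Sum>(v, t) \<leftarrow> zip V ts. hits d x v t)" if "x \<in> C - {d}" for x
      using num_prefer_shift_despised[OF el d _ _ ts] that by blast
    have "num_prefer (C, ?W) d c + num_prefer (C, ?W) c d = length V"
      using num_prefer_swap[OF is_election_shift[OF el d] d, of c] c ts by auto
    then have cd: "num_prefer (C, ?W) d c' \<le> num_prefer (C, ?W) c d \<longleftrightarrow>
        num_prefer (C, ?W) d c' + num_prefer (C, ?W) d c \<le> length V" by linarith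
    have "num_prefer (C, ?W) c x = num_prefer (C, V) c x" if "x \<in> C" "x \<noteq> c" "x \<noteq> d" for x
      using num_prefer_shift_others[OF el d _ _ _ _ _ ts] that c by blast
    moreover have "(\<forall>x \<in> C - {c}. num_prefer (C, ?W) d c' \<le> num_prefer (C, ?W) c x) \<longleftrightarrow>
        num_prefer (C, ?W) d c' \<le> num_prefer (C, ?W) c d \<and>
        (\<forall>x \<in> C. x \<noteq> c \<longrightarrow> x \<noteq> d \<longrightarrow> num_prefer (C, ?W) d c' \<le> num_prefer (C, ?W) c x)"
      using c d by blast
    ultimately show ?thesis using cd eq[OF c] eq[OF c'] by auto
  qed
  then show ?thesis unfolding maximin_not_unique[OF fin d] by (meson)
qed

section \<open>Dynamic programming over the voters\<close>

text \<open>
  A triple \<open>(X, Y, w)\<close> records the numbers of voters that rank \<open>d\<close> before \<open>c'\<close> and before \<open>c\<close>, and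
  the cost of the shifts made so far.
\<close>

type_synonym triple = "nat \<times> nat \<times> nat"

definition tplus :: "triple \<Rightarrow> triple \<Rightarrow> triple" where
  "tplus s u = (fst s + fst u, fst (snd s) + fst (snd u), snd (snd s) + snd (snd u))"

text \<open>One option per finite price. After \<open>t\<close> rounds the first component of the
  state is \<open>drop t (after d v)\<close>, so the shift \<open>t\<close> need not be computed as
  a number.\<close>

definition shift_opts :: "nat \<Rightarrow> nat \<Rightarrow> nat \<Rightarrow> nat list \<Rightarrow> nat list \<Rightarrow> triple list" where
  "shift_opts c' c d v ps = snd (fold (\<lambda>w s. (tl (fst s),
     (if c' \<in> set (fst s) then 1 else 0, if c \<in> set (fst s) then 1 else 0, w) # snd s)) ps (after d v, []))"

definition candidate_costs :: "nat \<Rightarrow> nat \<Rightarrow> nat \<Rightarrow> triple list \<Rightarrow> triple list \<Rightarrow> nat list" where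
  "candidate_costs B X Y us ss = concat (map (\<lambda>s. map (\<lambda>u. snd (snd (tplus s u)))
     (filter (\<lambda>u. fst (tplus s u) = X \<and> fst (snd (tplus s u)) = Y \<and> snd (snd (tplus s u)) \<le> B) us)) ss)"

definition best_entry :: "nat \<times> nat \<Rightarrow> nat list \<Rightarrow> triple list" where
  "best_entry k ws = (case ws of [] \<Rightarrow> [] | w # ws \<Rightarrow> [(fst k, snd k, fold min ws w)])"

text \<open>Collecting the costs separately for each target pair and keeping one minimum bounds the
  table by the number of pairs. Listing all extensions would multiply its length at every
  voter.\<close>

definition dp_step :: "(nat \<times> nat) list \<Rightarrow> nat \<Rightarrow> triple list \<Rightarrow> triple list \<Rightarrow> triple list" where
  "dp_step ks B us ss = concat (map (\<lambda>k. best_entry k (candidate_costs B (fst k) (snd k) us ss)) ks)"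

section \<open>Correctness of the pruned table relative to all reachable sums\<close>

primrec reachable :: "triple list list \<Rightarrow> triple \<Rightarrow> triple set" where
  "reachable [] s = {s}"
| "reachable (us # uss) s = (\<Union>u \<in> set us. reachable uss (tplus s u))"

definition dominates :: "triple \<Rightarrow> triple \<Rightarrow> bool" where
  "dominates t u \<longleftrightarrow> fst t = fst u \<and> fst (snd t) = fst (snd u) \<and> snd (snd t) \<le> snd (snd u)"

lemma fold_min: "fold min ws (w :: nat) = Min (set (w # ws))"
  by (simp only: Min.set_eq_fold)

lemma set_candidate_costs:
  "z \<in> set (candidate_costs B X Y us ss) \<longleftrightarrow>
   (\<exists>s \<in> set ss. \<exists>u \<in> set us. tplus s u = (X, Y, z) \<and> z \<le> B)"
  by (auto simp: candidate_costs_def prod_eq_iff image_iff)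

lemma best_entry_cases:
  "t \<in> set (best_entry k ws) \<longleftrightarrow> ws \<noteq> [] \<and> t = (fst k, snd k, Min (set ws))"
  by (cases ws) (simp_all only: best_entry_def list.case fold_min, auto)

lemma dp_step_sound:
  assumes "t \<in> set (dp_step ks B us ss)"
  shows "\<exists>s \<in> set ss. \<exists>u \<in> set us. t = tplus s u \<and> snd (snd t) \<le> B"
proof -
  from assms obtain k where k: "candidate_costs B (fst k) (snd k) us ss \<noteq> []"
    "t = (fst k, snd k, Min (set (candidate_costs B (fst k) (snd k) us ss)))"
    by (auto simp: dp_step_def best_entry_cases)
  then have "snd (snd t) \<in> set (candidate_costs B (fst k) (snd k) us ss)" by simp
  then obtain s u where su: "s \<in> set ss" "u \<in> set us" "tplus s u = (fst k, snd k, snd (snd t))" "snd (snd t) \<le> B"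
    unfolding set_candidate_costs by blast
  moreover have "t = tplus s u" unfolding su(3) by (subst (1 2) k(2)) simp
  ultimately show ?thesis by blast
qed

lemma dp_step_complete:
  assumes "s \<in> set ss" "u \<in> set us" "tplus s u = (X, Y, z)" "(X, Y) \<in> set ks" "z \<le> B"
  shows "\<exists>t \<in> set (dp_step ks B us ss). dominates t (X, Y, z)"
proof -
  let ?ws = "candidate_costs B X Y us ss"
  have "z \<in> set ?ws" unfolding set_candidate_costs using assms by blast
  then have "?ws \<noteq> []" "Min (set ?ws) \<le> z" by auto
  then have "(X, Y, Min (set ?ws)) \<in> set (dp_step ks B us ss)"
    using assms(4) by (auto simp: dp_step_def best_entry_cases intro!: bexI[of _ "(X, Y)"])
  then show ?thesis by (rule bexI[rotated]) (use \<open>Min (set ?ws) \<le> z\<close> in \<open>simp add: dominates_def\<close>)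
qed

lemma dp_sound:
  assumes "t \<in> set (fold (dp_step ks B) uss ss)" "\<forall>s \<in> set ss. snd (snd s) \<le> B"
  shows "snd (snd t) \<le> B \<and> (\<exists>s \<in> set ss. t \<in> reachable uss s)"
  using assms
proof (induction uss arbitrary: ss)
  case (Cons us uss)
  have "\<forall>s \<in> set (dp_step ks B us ss). snd (snd s) \<le> B" using dp_step_sound by blast
  from Cons.IH[OF _ this] Cons.prems(1) obtain s where
    s: "snd (snd t) \<le> B" "s \<in> set (dp_step ks B us ss)" "t \<in> reachable uss s" by auto
  with dp_step_sound[OF s(2)] show ?case by auto
qed auto

lemma reachable_mono:
  "t \<in> reachable uss s \<Longrightarrow> fst s \<le> fst t \<and> fst (snd s) \<le> fst (snd t) \<and> snd (snd s) \<le> snd (snd t)"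
proof (induction uss arbitrary: s)
  case (Cons us uss)
  then obtain u where "u \<in> set us" "t \<in> reachable uss (tplus s u)" by auto
  from Cons.IH[OF this(2)] show ?case by (auto simp: tplus_def)
qed auto

text \<open>Counts and costs only grow along a choice of options, so every partial sum of an
  admissible total is itself within the grid and the budget, and replacing it by a cheaper entry
  with the same counts does no harm.\<close>

lemma dp_complete:
  assumes "s' \<in> set ss" "dominates s' s" "t \<in> reachable uss s"
    and "fst t \<le> n" "fst (snd t) \<le> n" "snd (snd t) \<le> B"
    and ks: "\<And>X Y. X \<le> n \<Longrightarrow> Y \<le> n \<Longrightarrow> (X, Y) \<in> set ks"
  shows "\<exists>t' \<in> set (fold (dp_step ks B) uss ss). dominates t' t"
  using assms(1-6)
proof (induction uss arbitrary: s s' ss)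
  case (Cons us uss)
  then obtain u where u: "u \<in> set us" "t \<in> reachable uss (tplus s u)" by auto
  obtain X Y z where xyz: "tplus s' u = (X, Y, z)" by (metis prod_cases3)
  have "X \<le> n" "Y \<le> n" "z \<le> B" "dominates (X, Y, z) (tplus s u)"
    using reachable_mono[OF u(2)] Cons.prems(2,4-6) xyz by (auto simp: dominates_def tplus_def)
  with dp_step_complete[OF Cons.prems(1) u(1) xyz] ks obtain t1 where
    t1: "t1 \<in> set (dp_step ks B us ss)" "dominates t1 (X, Y, z)" by blast
  have "dominates t1 (tplus s u)" using t1(2) \<open>dominates (X, Y, z) (tplus s u)\<close> by (auto simp: dominates_def)
  from Cons.IH[OF t1(1) this u(2) Cons.prems(4-6)] show ?case by simp
qed auto

lemma set_shift_opts:
  "set (shift_opts c' c d v ps) = (\<lambda>t. (hits d c' v t, hits d c v t, ps ! t)) ` {..<length ps}"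
proof -
  let ?f = "\<lambda>w (s :: nat list \<times> triple list). (tl (fst s),
     (if c' \<in> set (fst s) then 1 else 0, if c \<in> set (fst s) then 1 else 0, w) # snd s)"
  have "set (snd (fold ?f ps (r, acc))) = set acc \<union>
      (\<lambda>t. (of_bool (c' \<in> set (drop t r)), of_bool (c \<in> set (drop t r)), ps ! t)) ` {..<length ps}" for r acc
  proof (induction ps arbitrary: r acc)
    case (Cons w ps)
    have eq: "{..<length (w # ps)} = insert 0 (Suc ` {..<length ps})"
      by (simp add: lessThan_Suc_eq_insert_0)
    have "set (snd (fold ?f (w # ps) (r, acc))) =
        insert (of_bool (c' \<in> set r), of_bool (c \<in> set r), w) (set acc) \<union>
        (\<lambda>t. (of_bool (c' \<in> set (drop t (tl r))), of_bool (c \<in> set (drop t (tl r))), ps ! t)) ` {..<length ps}"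
      by (simp add: Cons.IH of_bool_def)
    then show ?case unfolding eq image_insert image_image by (simp add: drop_Suc)
  qed simp
  from this[of "after d v" "[]"] show ?thesis by (simp add: shift_opts_def hits_def)
qed

section \<open>From tables to shifts and bribery costs\<close>

type_synonym voter_list = "(nat list \<times> nat list) list"

text \<open>Every chosen shift has a listed, hence finite, price; the budget is compared with
  \<open>total_cost\<close> separately.\<close>

abbreviation affordable :: "voter_list \<Rightarrow> nat list \<Rightarrow> bool" where
  "affordable \<equiv> list_all2 (\<lambda>vp t. t < length (snd vp))"

definition total_hits :: "nat \<Rightarrow> nat \<Rightarrow> voter_list \<Rightarrow> nat list \<Rightarrow> nat" where
  "total_hits d x vs ts = (\<Sum>(vp, t) \<leftarrow> zip vs ts. hits d x (fst vp) t)"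

definition total_cost :: "voter_list \<Rightarrow> nat list \<Rightarrow> nat" where
  "total_cost vs ts = (\<Sum>(vp, t) \<leftarrow> zip vs ts. snd vp ! t)"

lemma totals_simps [simp]:
  "total_hits d x [] ts = 0" "total_cost [] ts = 0"
  "total_hits d x (vp # vs) (t # ts) = hits d x (fst vp) t + total_hits d x vs ts"
  "total_cost (vp # vs) (t # ts) = snd vp ! t + total_cost vs ts"
  by (simp_all add: total_hits_def total_cost_def)

lemma ex_affordable_Cons:
  "(\<exists>ts. affordable (vp # vs) ts \<and> Q ts) \<longleftrightarrow> (\<exists>t < length (snd vp). \<exists>ts. affordable vs ts \<and> Q (t # ts))"
  by (auto simp: list_all2_Cons1)

lemma reachable_shift_opts:
  "u \<in> reachable (map (\<lambda>vp. shift_opts c' c d (fst vp) (snd vp)) vs) s \<longleftrightarrow>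
   (\<exists>ts. affordable vs ts \<and> u = tplus s (total_hits d c' vs ts, total_hits d c vs ts, total_cost vs ts))"
proof (induction vs arbitrary: s)
  case Nil
  then show ?case by (simp add: tplus_def)
next
  case (Cons vp vs)
  let ?tot = "\<lambda>vs ts. (total_hits d c' vs ts, total_hits d c vs ts, total_cost vs ts)"
  let ?o = "\<lambda>t. (hits d c' (fst vp) t, hits d c (fst vp) t, snd vp ! t)"
  have "u \<in> reachable (map (\<lambda>vp. shift_opts c' c d (fst vp) (snd vp)) (vp # vs)) s \<longleftrightarrow>
      (\<exists>t < length (snd vp). \<exists>ts. affordable vs ts \<and> u = tplus (tplus s (?o t)) (?tot vs ts))"
    by (simp add: Cons.IH set_shift_opts Bex_def)
  also have "\<dots> \<longleftrightarrow> (\<exists>ts. affordable (vp # vs) ts \<and> u = tplus s (?tot (vp # vs) ts))"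
  proof -
    have "tplus (tplus s (?o t)) (?tot vs ts) = tplus s (?tot (vp # vs) (t # ts))" for t ts
      by (simp add: tplus_def)
    then show ?thesis
      unfolding ex_affordable_Cons[where Q = "\<lambda>ts. u = tplus s (?tot (vp # vs) ts)"] by simp
  qed
  finally show ?case .
qed

text \<open>The numbers from \<open>length xs\<close> down to 0. Counting along a list keeps this
  polynomial, in contrast to counting up to a number given in binary.\<close>

definition counts :: "'a list \<Rightarrow> nat list" where
  "counts xs = fold (\<lambda>_ s. case s of [] \<Rightarrow> [] | k # ks \<Rightarrow> Suc k # k # ks) xs [0]"

lemma fold_counts:
  "fold (\<lambda>_ s. case s of [] \<Rightarrow> [] | k # ks \<Rightarrow> Suc k # k # ks) xs (rev [0..<Suc n]) = rev [0..<Suc (n + length xs)]"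
proof (induction xs arbitrary: n)
  case (Cons x xs)
  let ?f = "\<lambda>_ s. case s of [] \<Rightarrow> [] | k # ks \<Rightarrow> Suc k # k # ks"
  have "fold ?f (x # xs) (rev [0..<Suc n]) = fold ?f xs (rev [0..<Suc (Suc n)])" by simp
  also have "\<dots> = rev [0..<Suc (Suc n + length xs)]" by (rule Cons.IH)
  finally show ?case by simp
qed simp

lemma counts_eq: "counts xs = rev [0..<Suc (length xs)]"
  using fold_counts[of xs 0] by (simp add: counts_def)

definition grid :: "nat list \<Rightarrow> (nat \<times> nat) list" where
  "grid ns = concat (map (\<lambda>x. map (\<lambda>y. (x, y)) ns) ns)"

definition dp :: "nat \<Rightarrow> nat \<Rightarrow> nat \<Rightarrow> nat \<Rightarrow> voter_list \<Rightarrow> triple list" where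
  "dp c' c d B vs = fold (dp_step (grid (counts vs)) B)
     (map (\<lambda>vp. shift_opts c' c d (fst vp) (snd vp)) vs) [(0, 0, 0)]"

text \<open>A dominating entry has the same counts, so \<open>P\<close> carries over to it while the
  cost does not increase. The bound in the premise places the counts inside the grid; for the
  bribery condition it follows from \<open>X + Y \<le> length vs\<close>.\<close>

lemma dp_correct:
  assumes "\<And>X Y. P X Y \<Longrightarrow> X \<le> length vs \<and> Y \<le> length vs"
  shows "(\<exists>t \<in> set (dp c' c d B vs). P (fst t) (fst (snd t))) \<longleftrightarrow>
    (\<exists>ts. affordable vs ts \<and> total_cost vs ts \<le> B \<and> P (total_hits d c' vs ts) (total_hits d c vs ts))"
proof
  assume "\<exists>t \<in> set (dp c' c d B vs). P (fst t) (fst (snd t))"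
  then obtain t where t: "t \<in> set (dp c' c d B vs)" "P (fst t) (fst (snd t))" by blast
  from dp_sound[OF t(1)[unfolded dp_def]] t(2) show
    "\<exists>ts. affordable vs ts \<and> total_cost vs ts \<le> B \<and> P (total_hits d c' vs ts) (total_hits d c vs ts)"
    by (auto simp: reachable_shift_opts tplus_def)
next
  assume "\<exists>ts. affordable vs ts \<and> total_cost vs ts \<le> B \<and> P (total_hits d c' vs ts) (total_hits d c vs ts)"
  then obtain ts where ts: "affordable vs ts" "total_cost vs ts \<le> B"
    "P (total_hits d c' vs ts) (total_hits d c vs ts)" by blast
  let ?t = "(total_hits d c' vs ts, total_hits d c vs ts, total_cost vs ts)"
  have "?t \<in> reachable (map (\<lambda>vp. shift_opts c' c d (fst vp) (snd vp)) vs) (0, 0, 0)"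
    unfolding reachable_shift_opts using ts(1) by (auto simp: tplus_def)
  from dp_complete[of "(0, 0, 0)" "[(0, 0, 0)]", OF _ _ this, of "length vs" B "grid (counts vs)"]
  obtain t' where "t' \<in> set (dp c' c d B vs)" "dominates t' ?t"
    using ts assms[OF ts(3)] by (fastforce simp: dp_def dominates_def grid_def counts_eq)
  then show "\<exists>t \<in> set (dp c' c d B vs). P (fst t) (fst (snd t))"
    using ts(3) by (intro bexI[of _ t']) (auto simp: dominates_def)
qed

definition prefers :: "voter_list \<Rightarrow> nat \<Rightarrow> nat \<Rightarrow> nat" where
  "prefers vs c x = length (filter (\<lambda>vp. x \<in> set (after c (fst vp))) vs)"

text \<open>The set \<open>{1..m}\<close> may be exponentially large in the digits of
  \<open>m\<close>, so candidates are read off the first vote. Without voters all candidates tie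
  with score 0, and \<open>d\<close> fails to be the unique winner as soon as there is another
  candidate.\<close>

definition answer :: "nat \<Rightarrow> nat \<Rightarrow> nat \<Rightarrow> voter_list \<Rightarrow> bool" where
  "answer m d B vs = (case vs of [] \<Rightarrow> 2 \<le> m
    | vp # _ \<Rightarrow> \<exists>c \<in> set (fst vp). c \<noteq> d \<and> (\<exists>c' \<in> set (fst vp). c' \<noteq> d \<and>
        (\<exists>t \<in> set (dp c' c d B vs). fst t + fst (snd t) \<le> length vs \<and>
          (\<forall>x \<in> set (fst vp). x = c \<or> x = d \<or> fst t \<le> prefers vs c x))))"

text \<open>Inverse to \<open>finite_prices\<close> on valid price functions.\<close>

definition price_fun :: "nat list \<Rightarrow> nat \<Rightarrow> enat" where
  "price_fun ps t = (if t < length ps then enat (ps ! t) else \<infinity>)"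

lemma sum_price_fun:
  "length ts = length vs \<Longrightarrow> (\<Sum>i < length vs. price_fun (snd (vs ! i)) (ts ! i)) =
    (if affordable vs ts then enat (total_cost vs ts) else \<infinity>)"
proof (induction ts vs rule: list_induct2)
  case (Cons t ts vp vs)
  have "(\<Sum>i < length (vp # vs). price_fun (snd ((vp # vs) ! i)) ((t # ts) ! i)) =
      price_fun (snd vp) t + (\<Sum>i < length vs. price_fun (snd (vs ! i)) (ts ! i))"
    by (simp add: sum.lessThan_Suc_shift del: sum.lessThan_Suc)
  then show ?case unfolding Cons.IH by (simp add: price_fun_def)
qed (simp add: zero_enat_def)

lemma affordable_iff:
  "length ts = length vs \<and> (\<Sum>i < length vs. price_fun (snd (vs ! i)) (ts ! i)) \<le> enat B \<longleftrightarrow>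
   affordable vs ts \<and> total_cost vs ts \<le> B"
proof (cases "length ts = length vs")
  case True
  then show ?thesis unfolding sum_price_fun[OF True] by simp
next
  case False
  then have "\<not> affordable vs ts" using list_all2_lengthD by fastforce
  with False show ?thesis by simp
qed

definition mk_instance :: "nat \<Rightarrow> nat \<Rightarrow> nat \<Rightarrow> voter_list \<Rightarrow> nat bribery_instance" where
  "mk_instance m d B vs = \<lparr>election = ({1..m}, map fst vs), despised = d, budget = B,
     prices = map (\<lambda>vp. price_fun (snd vp)) vs\<rparr>"

lemma bex_minus_cong:
  "(\<And>c c'. c \<in> C \<Longrightarrow> P c c' \<longleftrightarrow> Q c c') \<Longrightarrow>
   (\<exists>c \<in> C - {d}. \<exists>c' \<in> C - {d}. P c c') \<longleftrightarrow> (\<exists>c \<in> C. c \<noteq> d \<and> (\<exists>c' \<in> C. c' \<noteq> d \<and> Q c c'))"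
  by blast

lemma answer_correct:
  assumes d: "1 \<le> d" "d \<le> m" and vs: "\<And>vp. vp \<in> set vs \<Longrightarrow> distinct (fst vp) \<and> set (fst vp) = {1..m}"
  shows "answer m d B vs \<longleftrightarrow> destructive_bribery_exists maximin (mk_instance m d B vs)"
proof -
  let ?C = "{1..m}" and ?V = "map fst vs"
  have el: "is_election (?C, ?V)" using vs by (auto simp: is_election_def)
  have dC: "d \<in> ?C" using d by simp
  have th: "(\<Sum>(v, t) \<leftarrow> zip ?V ts. hits d x v t) = total_hits d x vs ts" for x ts
    by (simp add: total_hits_def zip_map1 comp_def case_prod_unfold)
  have pr: "prefers vs c x = num_prefer (?C, ?V) c x" if "c \<in> ?C" "x \<in> ?C" "c \<noteq> x" for c x
  proof -
    have "num_prefer (?C, ?V) c x = length (filter (\<lambda>vp. pos (fst vp) c < pos (fst vp) x) vs)"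
      by (simp add: num_prefer_def filter_map comp_def)
    also have "filter (\<lambda>vp. pos (fst vp) c < pos (fst vp) x) vs = filter (\<lambda>vp. x \<in> set (after c (fst vp))) vs"
      by (rule filter_cong[OF refl], rule pos_less_iff) (use vs that in auto)
    finally show ?thesis by (simp add: prefers_def)
  qed
  define good where "good c X Y \<longleftrightarrow> X + Y \<le> length vs \<and>
    (\<forall>x \<in> ?C. x = c \<or> x = d \<or> X \<le> num_prefer (?C, ?V) c x)" for c X Y
  have "destructive_bribery_exists maximin (mk_instance m d B vs) \<longleftrightarrow>
    (\<exists>ts. length ts = length vs \<and> (\<Sum>i < length vs. price_fun (snd (vs ! i)) (ts ! i)) \<le> enat B \<and>
      maximin (?C, map2 (shift_back d) ts ?V) \<noteq> {d})"
    by (simp add: destructive_bribery_exists_def mk_instance_def)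
  also have "\<dots> \<longleftrightarrow> (\<exists>ts. affordable vs ts \<and> total_cost vs ts \<le> B \<and> maximin (?C, map2 (shift_back d) ts ?V) \<noteq> {d})"
    by (intro ex_cong1) (use affordable_iff[of _ vs B] in blast)
  also have "\<dots> \<longleftrightarrow> (\<exists>ts. affordable vs ts \<and> total_cost vs ts \<le> B \<and>
      (\<exists>c \<in> ?C - {d}. \<exists>c' \<in> ?C - {d}. good c (total_hits d c' vs ts) (total_hits d c vs ts)))"
  proof (intro ex_cong1 conj_cong refl)
    fix ts assume "affordable vs ts"
    then have len: "length ts = length ?V" by (simp add: list_all2_lengthD)
    show "maximin (?C, map2 (shift_back d) ts ?V) \<noteq> {d} \<longleftrightarrow>
        (\<exists>c \<in> ?C - {d}. \<exists>c' \<in> ?C - {d}. good c (total_hits d c' vs ts) (total_hits d c vs ts))"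
      unfolding bribed_not_unique[OF el dC len] th good_def by (intro bex_cong refl) auto
  qed
  also have "\<dots> \<longleftrightarrow> (\<exists>c \<in> ?C - {d}. \<exists>c' \<in> ?C - {d}. \<exists>t \<in> set (dp c' c d B vs). good c (fst t) (fst (snd t)))"
  proof -
    have "(\<exists>t \<in> set (dp c' c d B vs). good c (fst t) (fst (snd t))) \<longleftrightarrow>
      (\<exists>ts. affordable vs ts \<and> total_cost vs ts \<le> B \<and> good c (total_hits d c' vs ts) (total_hits d c vs ts))" for c c'
      by (rule dp_correct) (auto simp: good_def)
    then show ?thesis by blast
  qed
  also have "\<dots> \<longleftrightarrow> answer m d B vs"
  proof (cases vs)
    case Nil
    have "(\<exists>c \<in> ?C - {d}. \<exists>c' \<in> ?C - {d}. \<exists>t \<in> set (dp c' c d B vs). good c (fst t) (fst (snd t))) \<longleftrightarrow> ?C - {d} \<noteq> {}"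
      by (auto simp: good_def Nil dp_def)
    also have "\<dots> \<longleftrightarrow> 2 \<le> m"
    proof
      assume "?C - {d} \<noteq> {}"
      then obtain c where "c \<in> ?C - {d}" by blast
      then show "2 \<le> m" using d by (cases "c < d") auto
    next
      assume "2 \<le> m"
      then have "(if d = 1 then 2 else 1) \<in> ?C - {d}" by auto
      then show "?C - {d} \<noteq> {}" by blast
    qed
    finally show ?thesis by (simp add: answer_def Nil)
  next
    case (Cons vp vs')
    then have C: "set (fst vp) = ?C" using vs by simp
    have good: "(\<exists>t \<in> set (dp c' c d B vs). good c (fst t) (fst (snd t))) \<longleftrightarrow>
      (\<exists>t \<in> set (dp c' c d B vs). fst t + fst (snd t) \<le> length vs \<and>
          (\<forall>x \<in> ?C. x = c \<or> x = d \<or> fst t \<le> prefers vs c x))" if "c \<in> ?C" for c c'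
      unfolding good_def by (intro bex_cong conj_cong ball_cong refl) (use pr[OF that] in auto)
    have ans: "answer m d B vs \<longleftrightarrow> (\<exists>c \<in> ?C. c \<noteq> d \<and> (\<exists>c' \<in> ?C. c' \<noteq> d \<and>
        (\<exists>t \<in> set (dp c' c d B vs). fst t + fst (snd t) \<le> length vs \<and>
          (\<forall>x \<in> ?C. x = c \<or> x = d \<or> fst t \<le> prefers vs c x))))"
      unfolding answer_def C[symmetric] by (simp add: Cons)
    show ?thesis unfolding ans by (rule bex_minus_cong, rule good)
  qed
  finally show ?thesis by blast
qed

section \<open>Reading and validating the input\<close>

text \<open>
  The lists are accumulated from the right end of the word, so that every number and every list is
  opened by its terminator and closed by the next terminator to the left. The state consists of the
  lists read so far, each of them a list of bit strings.
\<close>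

definition parse_step :: "nat \<Rightarrow> bool list list list \<Rightarrow> bool list list list" where
  "parse_step a S = (if a = 4 then [] # S else
     (case S of [] \<Rightarrow> [] | L # Ls \<Rightarrow>
       if a = 3 then ([] # L) # Ls else
       (case L of [] \<Rightarrow> S | bs # L' \<Rightarrow> (((if a = 2 then True else False) # bs) # L') # Ls)))"

definition pair_up :: "'a list \<Rightarrow> ('a \<times> 'a) list" where
  "pair_up xs = rev (snd (fold (\<lambda>x s. case fst s of [] \<Rightarrow> ([x], snd s)
     | y # _ \<Rightarrow> ([], (y, x) # snd s)) xs ([], [])))"

text \<open>The three header numbers have no list terminator and end up in front of the first list
  read, that is, of the first vote or, without voters, of the initial empty list. That initial list
  otherwise remains as an unpaired last element, which \<open>pair_up\<close> drops.\<close>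

definition parse :: "nat list \<Rightarrow> nat \<times> nat \<times> nat \<times> voter_list" where
  "parse w = (case map (map bval) (foldr parse_step w [[]]) of
     [] \<Rightarrow> (0, 0, 0, [])
   | L # Ls \<Rightarrow> (case L of [] \<Rightarrow> (0, 0, 0, []) | m # L1 \<Rightarrow>
       (case L1 of [] \<Rightarrow> (0, 0, 0, []) | d # L2 \<Rightarrow>
         (case L2 of [] \<Rightarrow> (0, 0, 0, []) | B # v \<Rightarrow> (m, d, B, pair_up (v # Ls))))))"

definition encode_raw :: "nat \<Rightarrow> nat \<Rightarrow> nat \<Rightarrow> voter_list \<Rightarrow> nat list" where
  "encode_raw m d B vs = encode_nat m @ encode_nat d @ encode_nat B @
     concat (map (\<lambda>vp. encode_nats (fst vp) @ encode_nats (snd vp)) vs)"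

lemma binary_eq_bits: "binary n = map (\<lambda>b. if b then 2 else 1) (bits n)"
proof (induction n rule: binary.induct)
  case (1 n)
  then show ?case by (subst binary.simps, subst bits.simps) auto
qed

lemma parse_digits:
  "foldr parse_step (map (\<lambda>b. if b then 2 else 1) bs @ w) S =
   (case foldr parse_step w S of (cs # L) # Ls \<Rightarrow> ((bs @ cs) # L) # Ls | S' \<Rightarrow> S')"
  by (induction bs) (auto simp: parse_step_def split: list.splits)

lemma parse_encode_nat:
  "foldr parse_step w S = L # Ls \<Longrightarrow> foldr parse_step (encode_nat n @ w) S = (bits n # L) # Ls"
  using parse_digits[of "bits n" "3 # w" S]
  by (simp add: encode_nat_def binary_eq_bits parse_step_def del: foldr_append)

lemma parse_encode_nats:
  "foldr parse_step (encode_nats ns @ w) S = map bits ns # foldr parse_step w S"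
proof (induction ns)
  case (Cons n ns)
  have "foldr parse_step (encode_nat n @ (encode_nats ns @ w)) S = (bits n # map bits ns) # foldr parse_step w S"
    by (rule parse_encode_nat) (use Cons in simp)
  then show ?case by (simp add: encode_nats_def)
qed (simp add: encode_nats_def parse_step_def)

lemma fold_pair_up:
  "fold (\<lambda>x s. case fst s of [] \<Rightarrow> ([x], snd s) | y # _ \<Rightarrow> ([], (y, x) # snd s))
     (concat (map (\<lambda>p. [fst p, snd p]) ps)) ([], acc) = ([], rev ps @ acc)"
  by (induction ps arbitrary: acc) auto

lemma pair_up_concat: "pair_up (concat (map (\<lambda>p. [fst p, snd p]) ps) @ [x]) = ps"
  by (simp add: pair_up_def fold_pair_up)

lemma parse_encode_raw: "parse (encode_raw m d B vs) = (m, d, B, vs)"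
proof -
  let ?e = "\<lambda>vp. encode_nats (fst vp) @ encode_nats (snd vp)"
  have map_bits: "map (bval \<circ> bits) ns = ns" for ns by (simp add: map_idI)
  have body: "foldr parse_step (concat (map ?e vs)) [[]] =
      map (map bits) (concat (map (\<lambda>p. [fst p, snd p]) vs) @ [[]])" for vs
    by (induction vs) (simp_all add: parse_encode_nats del: foldr_append)
  obtain v Ls where vL: "concat (map (\<lambda>p. [fst p, snd p]) vs) @ [[]] = v # Ls"
    by (cases vs) auto
  have "foldr parse_step (concat (map ?e vs)) [[]] = map bits v # map (map bits) Ls"
    unfolding body vL by simp
  note * = parse_encode_nat[OF parse_encode_nat[OF parse_encode_nat[OF this]], of m d B]
  have "pair_up (v # Ls) = vs" using pair_up_concat[of vs "[]"] vL by simp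
  then show ?thesis
    unfolding parse_def encode_raw_def * by (simp add: map_bits comp_def)
qed

definition valid_prices :: "nat list \<Rightarrow> bool" where
  "valid_prices ps = ((case ps of [] \<Rightarrow> False | w # _ \<Rightarrow> w = 0) \<and>
     snd (fold (\<lambda>w s. (w, snd s \<and> fst s \<le> w)) ps (0, True)))"

text \<open>The length of the price list is only bounded from above, as a price function may become
  infinite before \<open>d\<close> reaches the end of the vote.\<close>

definition valid_vote :: "nat \<Rightarrow> nat \<Rightarrow> nat list \<Rightarrow> nat list \<Rightarrow> bool" where
  "valid_vote m d v ps = (length v = m \<and>
     (\<forall>x \<in> set v. 1 \<le> x \<and> x \<le> m \<and> length (filter (\<lambda>y. y = x) v) = 1) \<and>
     valid_prices ps \<and> length ps \<le> length (after d v) + 1)"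

definition valid_raw :: "nat \<Rightarrow> nat \<Rightarrow> voter_list \<Rightarrow> bool" where
  "valid_raw m d vs = (1 \<le> d \<and> d \<le> m \<and> (\<forall>vp \<in> set vs. valid_vote m d (fst vp) (snd vp)))"

definition decide :: "nat list \<Rightarrow> bool" where
  "decide w = (let r = parse w; m = fst r; d = fst (snd r); B = fst (snd (snd r)); vs = snd (snd (snd r))
     in encode_raw m d B vs = w \<and> valid_raw m d vs \<and> answer m d B vs)"

lemma valid_prices_iff: "valid_prices ps \<longleftrightarrow> ps \<noteq> [] \<and> hd ps = 0 \<and> sorted ps"
proof -
  have "snd (fold (\<lambda>w s. (w, snd s \<and> fst s \<le> w)) ps (a, b)) \<longleftrightarrow> b \<and> sorted (a # ps)" for a :: nat and b
  proof (induction ps arbitrary: a b)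
    case (Cons w ps)
    have "sorted (a # w # ps) \<longleftrightarrow> a \<le> w \<and> sorted (w # ps)" by (rule sorted2)
    then show ?case by (simp only: fold_simps comp_apply fst_conv snd_conv Cons.IH conj_assoc)
  qed simp
  from this[of 0 True] show ?thesis by (cases ps) (simp_all add: valid_prices_def)
qed

text \<open>Counting occurrences inside the vote avoids enumerating \<open>{1..m}\<close>. Single
  occurrences give distinctness, and a subset of \<open>{1..m}\<close> with \<open>m\<close>
  elements is everything.\<close>

lemma permutation_iff:
  "length v = m \<and> (\<forall>x \<in> set v. 1 \<le> x \<and> x \<le> m \<and> length (filter (\<lambda>y. y = x) v) = 1) \<longleftrightarrow>
   distinct v \<and> set v = {1..m}"
proof
  assume l: "length v = m \<and> (\<forall>x \<in> set v. 1 \<le> x \<and> x \<le> m \<and> length (filter (\<lambda>y. y = x) v) = 1)"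
  have "distinct v"
    unfolding distinct_conv_nth
  proof (intro allI impI)
    fix i j assume ij: "i < length v" "j < length v" "i \<noteq> j"
    have "length (filter (\<lambda>y. y = v ! i) v) = 1" using l ij(1) by simp
    then have "card {k. k < length v \<and> v ! k = v ! i} = 1" by (simp add: length_filter_conv_card)
    then obtain k where "{k. k < length v \<and> v ! k = v ! i} = {k}" by (rule card_1_singletonE)
    then show "v ! i \<noteq> v ! j" using ij by (metis (mono_tags, lifting) mem_Collect_eq singletonD)
  qed
  have "set v \<subseteq> {1..m}" using l by auto
  moreover have "card (set v) = card {1..m}" using distinct_card[OF \<open>distinct v\<close>] l by simp
  ultimately have "set v = {1..m}" by (intro card_subset_eq) simp_all
  with \<open>distinct v\<close> show "distinct v \<and> set v = {1..m}" by blast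
next
  assume r: "distinct v \<and> set v = {1..m}"
  then have "length v = m" using distinct_card[of v] by simp
  moreover have "length (filter (\<lambda>y. y = x) v) = 1" if "x \<in> set v" for x
  proof -
    have "length (filter (\<lambda>y. y = x) v) = card (set (filter (\<lambda>y. y = x) v))"
      by (rule distinct_card[symmetric]) (use r in simp)
    also have "set (filter (\<lambda>y. y = x) v) = {x}" using that by auto
    finally show ?thesis by simp
  qed
  ultimately show "length v = m \<and> (\<forall>x \<in> set v. 1 \<le> x \<and> x \<le> m \<and> length (filter (\<lambda>y. y = x) v) = 1)"
    using r by auto
qed

lemma finite_prices_price_fun: "finite_prices (price_fun ps) = ps"
proof -
  have "{i. price_fun ps i \<noteq> \<infinity>} = {..<length ps}" by (auto simp: price_fun_def)
  moreover have "sorted_list_of_set {..<length ps} = [0..<length ps]" by (simp add: lessThan_atLeast0)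
  ultimately have "finite_prices (price_fun ps) = map (\<lambda>i. the_enat (price_fun ps i)) [0..<length ps]"
    by (simp only: finite_prices_def)
  also have "\<dots> = ps" by (rule nth_equalityI) (simp_all add: price_fun_def)
  finally show ?thesis .
qed

lemma is_price_function_price_fun:
  assumes "valid_prices ps" "length ps \<le> m - j + 1"
  shows "is_price_function m j (price_fun ps)"
  using assms unfolding is_price_function_def valid_prices_iff
  by (auto simp: price_fun_def hd_conv_nth zero_enat_def intro: sorted_nth_mono)

lemma price_fun_finite_prices:
  assumes "is_price_function m j \<rho>"
  shows "price_fun (finite_prices \<rho>) = \<rho> \<and> valid_prices (finite_prices \<rho>) \<and> length (finite_prices \<rho>) \<le> m - j + 1"
proof -
  have zero: "\<rho> 0 = 0" and mono: "\<And>i i'. i < i' \<Longrightarrow> i' \<le> m - j \<Longrightarrow> \<rho> i \<le> \<rho> i'"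
    and inf: "\<And>i. i > m - j \<Longrightarrow> \<rho> i = \<infinity>" using assms by (auto simp: is_price_function_def)
  \<comment> \<open>The number of finite prices: it is positive since shifting by 0 is free, at most
    \<open>m - j + 1\<close>, and by monotonicity all prices from \<open>k\<close> on are
    infinite.\<close>
  define k where "k = (LEAST i. \<rho> i = \<infinity>)"
  have k: "\<rho> k = \<infinity>" unfolding k_def by (rule LeastI[of _ "m - j + 1"]) (simp add: inf)
  have below: "\<rho> i \<noteq> \<infinity>" if "i < k" for i using not_less_Least that unfolding k_def by blast
  have above: "\<rho> i = \<infinity>" if "k \<le> i" for i
  proof (cases "i \<le> m - j \<and> k < i")
    case True
    then have "\<rho> k \<le> \<rho> i" using mono by blast
    then show ?thesis using k by simp
  next
    case False
    then show ?thesis using that inf k by (metis le_neq_implies_less not_le)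
  qed
  have set: "{i. \<rho> i \<noteq> \<infinity>} = {..<k}" using above below by (auto simp: not_le[symmetric])
  have ps: "finite_prices \<rho> = map (\<lambda>i. the_enat (\<rho> i)) [0..<k]"
    unfolding finite_prices_def set by (simp add: lessThan_atLeast0)
  have k_le: "k \<le> m - j + 1" unfolding k_def by (rule Least_le) (simp add: inf)
  have k_pos: "0 < k" using k zero by (cases k) auto
  have eq: "price_fun (finite_prices \<rho>) i = \<rho> i" for i
    using below[of i] above[of i] by (auto simp: price_fun_def ps)
  moreover have "valid_prices (finite_prices \<rho>)"
  proof -
    have "the_enat (\<rho> i) \<le> the_enat (\<rho> i')" if "i \<le> i'" "i' < k" for i i'
    proof (cases "i = i'")
      case False
      then have "\<rho> i \<le> \<rho> i'" using mono[of i i'] that k_le by simp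
      then show ?thesis using below[of i] below[of i'] that by auto
    qed simp
    then have "sorted (finite_prices \<rho>)" by (auto simp: ps sorted_iff_nth_mono)
    then show ?thesis using k_pos zero by (simp add: valid_prices_iff ps hd_map zero_enat_def)
  qed
  ultimately show ?thesis using k_le by (auto simp: ps)
qed

lemma valid_vote_iff:
  assumes "1 \<le> d" "d \<le> m"
  shows "valid_vote m d v ps \<longleftrightarrow> distinct v \<and> set v = {1..m} \<and>
    valid_prices ps \<and> length ps \<le> m - pos v d + 1"
proof -
  have "length (after d v) = m - pos v d" if "distinct v" "set v = {1..m}"
    using length_after[of v d] that assms distinct_card[of v] by simp
  moreover have "valid_vote m d v ps \<longleftrightarrow>
      (length v = m \<and> (\<forall>x \<in> set v. 1 \<le> x \<and> x \<le> m \<and> length (filter (\<lambda>y. y = x) v) = 1)) \<and>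
      valid_prices ps \<and> length ps \<le> length (after d v) + 1"
    unfolding valid_vote_def by (simp only: conj_assoc)
  ultimately show ?thesis unfolding permutation_iff by auto
qed

lemma encodable_mk_instance:
  assumes "valid_raw m d vs"
  shows "encodable (mk_instance m d B vs)"
proof -
  have d: "1 \<le> d" "d \<le> m" and vs: "\<And>vp. vp \<in> set vs \<Longrightarrow> valid_vote m d (fst vp) (snd vp)"
    using assms by (auto simp: valid_raw_def)
  note vs' = vs[unfolded valid_vote_iff[OF d]]
  show ?thesis
    using d vs' nth_mem[of _ vs] is_price_function_price_fun
    by (auto simp: encodable_def valid_instance_def mk_instance_def is_election_def)
qed

lemma encode_mk_instance: "encode_instance (mk_instance m d B vs) = encode_raw m d B vs"
proof -
  have "map2 (\<lambda>v \<rho>. encode_nats v @ encode_nats (finite_prices \<rho>)) (map fst vs) (map (\<lambda>vp. price_fun (snd vp)) vs) =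
      map (\<lambda>vp. encode_nats (fst vp) @ encode_nats (snd vp)) vs"
    by (induction vs) (simp_all add: finite_prices_price_fun)
  then show ?thesis by (simp add: encode_instance_def mk_instance_def encode_raw_def)
qed

text \<open>Price functions are determined by their finite values, so every encodable instance is
  described by finite lists, on which the algorithm works.\<close>

lemma encodable_imp_mk_instance:
  assumes "encodable I"
  obtains m d B vs where "I = mk_instance m d B vs" "valid_raw m d vs"
proof -
  obtain m V where el: "election I = ({1..m}, V)" using assms by (cases "election I") (auto simp: encodable_def)
  let ?d = "despised I" and ?P = "prices I"
  have val: "is_election ({1..m}, V)" "?d \<in> {1..m}" "length ?P = length V"
    "\<And>i. i < length V \<Longrightarrow> is_price_function m (pos (V ! i) ?d) (?P ! i)"
    using assms el by (auto simp: encodable_def valid_instance_def)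
  let ?vs = "zip V (map finite_prices ?P)"
  have "map (\<lambda>vp. price_fun (snd vp)) ?vs = ?P"
    using val(3,4) price_fun_finite_prices by (intro nth_equalityI) auto
  moreover have "map fst ?vs = V" using val(3) by simp
  ultimately have "I = mk_instance m ?d (budget I) ?vs"
    using el by (simp add: mk_instance_def)
  moreover have "valid_raw m ?d ?vs"
    unfolding valid_raw_def
  proof (intro conjI ballI)
    show d: "1 \<le> ?d" "?d \<le> m" using val(2) by auto
    fix vp assume "vp \<in> set ?vs"
    then obtain i where i: "i < length V" "vp = (V ! i, finite_prices (?P ! i))"
      using val(3) by (auto simp: set_zip)
    have "V ! i \<in> set V" using i by simp
    then show "valid_vote m ?d (fst vp) (snd vp)"
      using val(1) price_fun_finite_prices[OF val(4)[OF i(1)]]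
      by (auto simp: valid_vote_iff[OF d] i(2) is_election_def)
  qed
  ultimately show ?thesis by (rule that)
qed

lemma encode_symbols: "encode_raw m d B vs \<in> lists {1, 2, 3, 4}"
proof -
  have n: "set (encode_nat n) \<subseteq> {1, 2, 3, 4}" for n
    using binary_symbols[of n] by (auto simp: encode_nat_def)
  then have ns: "set (encode_nats ns) \<subseteq> {1, 2, 3, 4}" for ns
    by (force simp: encode_nats_def)
  have "set (concat (map (\<lambda>vp. encode_nats (fst vp) @ encode_nats (snd vp)) vs)) \<subseteq> {1, 2, 3, 4}"
    by (induction vs) (use ns in simp_all)
  then show ?thesis using n unfolding encode_raw_def lists_eq_set
    by (simp only: set_append Un_subset_iff mem_Collect_eq)
qed

lemma Destructive_Shift_Bribery_eq:
  "Destructive_Shift_Bribery maximin = {w \<in> lists {1, 2, 3, 4}. decide w}"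
proof -
  have ans: "answer m d B vs \<longleftrightarrow> destructive_bribery_exists maximin (mk_instance m d B vs)"
    if "valid_raw m d vs" for m d vs and B
    by (rule answer_correct) (use that in \<open>auto simp: valid_raw_def valid_vote_iff\<close>)
  have "w \<in> lists {1, 2, 3, 4} \<and> decide w" if "w \<in> Destructive_Shift_Bribery maximin" for w
  proof -
    obtain I where I: "w = encode_instance I" "encodable I" "destructive_bribery_exists maximin I"
      using \<open>w \<in> _\<close> by (auto simp: Destructive_Shift_Bribery_def)
    obtain m d B vs where r: "I = mk_instance m d B vs" "valid_raw m d vs"
      by (rule encodable_imp_mk_instance[OF I(2)])
    show ?thesis using I r ans[OF r(2)] encode_symbols
      by (simp add: decide_def encode_mk_instance parse_encode_raw)
  qed
  moreover have "w \<in> Destructive_Shift_Bribery maximin" if dec: "decide w" for w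
  proof -
    obtain m d B vs where "parse w = (m, d, B, vs)" by (metis prod_cases4)
    then have r: "encode_raw m d B vs = w" "valid_raw m d vs" "answer m d B vs"
      using dec by (simp_all add: decide_def)
    then show ?thesis unfolding Destructive_Shift_Bribery_def
      using encodable_mk_instance[OF r(2), of B] ans[OF r(2), of B] encode_mk_instance[of m d B vs, symmetric]
      by blast
  qed
  ultimately show ?thesis by blast
qed

section \<open>The decision procedure runs in polynomial time\<close>

lemma polytime_min [polytime_intros]:
  fixes f g :: "'a::coded \<Rightarrow> nat"
  shows "polytime f \<Longrightarrow> polytime g \<Longrightarrow> polytime (\<lambda>x. min (f x) (g x))"
  unfolding min_def by (intro polytime_intros)

lemma polytime_member [polytime_intros]:
  fixes f :: "'a::coded \<Rightarrow> nat"
  assumes "polytime f" "polytime xs"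
  shows "polytime (\<lambda>x. f x \<in> set (xs x))"
proof -
  have "polytime (\<lambda>x. \<exists>y \<in> set (xs x). y = f x)"
    \<comment> \<open>Composing the assumptions with an arbitrary function lets them apply under
      bound variables, where the environment is a projection of a pair.\<close>
    by (intro polytime_intros assms[THEN polytime_comp])
  then show ?thesis by simp
qed

text \<open>The second list is consumed while folding over the first: the flag records a mismatch or
  a premature end, and a nonempty rest shows that the second list is longer.\<close>

lemma polytime_eq_nats [polytime_intros]:
  fixes f g :: "'a::coded \<Rightarrow> nat list"
  assumes "polytime f" "polytime g"
  shows "polytime (\<lambda>x. f x = g x)"
proof -
  let ?F = "\<lambda>a s. case fst s of [] \<Rightarrow> ([], False) | b # bs \<Rightarrow> (bs, snd s \<and> a = b)"
  have eq: "(fst (fold ?F xs (ys, r)) = [] \<and> snd (fold ?F xs (ys, r))) \<longleftrightarrow> r \<and> xs = ys"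
    for xs ys :: "nat list" and r
  proof (induction xs arbitrary: ys r)
    case (Cons a xs)
    have "fold ?F xs ([], False) = ([], False)" for xs by (induction xs) auto
    then show ?case by (cases ys) (auto simp: Cons.IH)
  qed auto
  have le: "csize (?F a s) \<le> csize s + 5" for a and s :: "nat list \<times> bool"
    using csize_bool[of "snd (?F a s)"] csize_pos[of "snd s"] by (cases s; cases "fst s") auto
  have "polytime (\<lambda>x. fold ?F (f x) (g x, True))"
    by (intro polytime_fold_additive[where B = "\<lambda>_. 5", OF _ _ _ _ le])
      (intro polytime_intros polybound_intros assms)+
  then have "polytime (\<lambda>x. fst (fold ?F (f x) (g x, True)) = [] \<and> snd (fold ?F (f x) (g x, True)))"
    by (intro polytime_intros)
  then show ?thesis unfolding eq by simp
qed

lemma polytime_after [polytime_intros]: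
  fixes c :: "'a::coded \<Rightarrow> nat"
  assumes "polytime c" "polytime v"
  shows "polytime (\<lambda>x. after (c x) (v x))"
  unfolding after_def by (intro polytime_intros assms[THEN polytime_comp])

lemma polytime_shift_opts [polytime_intros]:
  assumes "polytime c'" "polytime c" "polytime d" "polytime v" "polytime ps"
  shows "polytime (\<lambda>x. shift_opts (c' x) (c x) (d x) (v x) (ps x))"
proof -
  have le: "csize (tl (fst s), (if b then 1 else 0, if b' then 1 else 0, w) # snd s)
      \<le> csize s + (csize (e, w) + 13)" for s :: "nat list \<times> triple list" and e :: 'a and w b b'
  proof -
    have "csize (if b then 1 else 0 :: nat) \<le> 5" for b
      using csize_nat_le[of "if b then 1 else 0 :: nat"] by (cases b) auto
    from this[of b] this[of b'] show ?thesis
      using csize_tl[of "fst s"] by (cases s) simp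
  qed
  show ?thesis unfolding shift_opts_def
    by (intro polytime_snd polytime_fold_additive[where B = "\<lambda>p. csize p + 13", OF _ _ _ _ le])
      (intro polytime_intros polybound_intros assms[THEN polytime_comp])+
qed

lemma polytime_candidate_costs [polytime_intros]:
  assumes "polytime B" "polytime X" "polytime Y" "polytime us" "polytime ss"
  shows "polytime (\<lambda>x. candidate_costs (B x) (X x) (Y x) (us x) (ss x))"
  unfolding candidate_costs_def tplus_def fst_conv snd_conv
  by (intro polytime_intros assms[THEN polytime_comp])

lemma polytime_fold_min [polytime_intros]:
  fixes s :: "'a::coded \<Rightarrow> nat"
  assumes "polytime xs" "polytime s"
  shows "polytime (\<lambda>x. fold min (xs x) (s x))"
  by (rule polytime_fold_additive[where B = "\<lambda>p. csize p"])
    (intro polytime_intros polybound_intros assms | simp add: min_def)+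

lemma polytime_best_entry [polytime_intros]:
  assumes "polytime k" "polytime ws"
  shows "polytime (\<lambda>x. best_entry (k x) (ws x))"
  unfolding best_entry_def by (intro polytime_intros assms[THEN polytime_comp])

lemma polytime_dp_step [polytime_intros]:
  assumes "polytime ks" "polytime B" "polytime us" "polytime ss"
  shows "polytime (\<lambda>x. dp_step (ks x) (B x) (us x) (ss x))"
  unfolding dp_step_def by (intro polytime_intros assms[THEN polytime_comp])

text \<open>The bound involves neither \<open>us\<close> nor \<open>ss\<close>: there is at most one
  entry per pair in \<open>ks\<close>, and its cost is at most \<open>B\<close>, with a code at most
  twice as long. Thus the table cannot grow from voter to voter.\<close>

lemma csize_dp_step: "csize (dp_step ks B us ss) \<le> length ks * (csize ks + 2 * csize B + 2) + 1"
proof -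
  have "length (best_entry k ws) \<le> 1" for k ws by (simp add: best_entry_def split: list.split)
  then have "length (concat (map (\<lambda>k. best_entry k (F k)) ks)) \<le> length ks" for F
    by (induction ks) (auto intro: add_le_mono[of _ 1, simplified])
  then have len: "length (dp_step ks B us ss) \<le> length ks" by (simp add: dp_step_def)
  have "csize t \<le> csize ks + 2 * csize B + 1" if "t \<in> set (dp_step ks B us ss)" for t
  proof -
    have "snd (snd t) \<le> B" using dp_step_sound[OF that] by blast
    moreover have "(fst t, fst (snd t)) \<in> set ks"
      using that by (auto simp: dp_step_def best_entry_cases)
    ultimately show ?thesis
      using csize_nat_mono[of "snd (snd t)" B] csize_mem[of "(fst t, fst (snd t))" ks]
      by (cases t) auto
  qed
  then have "csize (dp_step ks B us ss) \<le> length (dp_step ks B us ss) * (csize ks + 2 * csize B + 1 + 1) + 1"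
    by (rule csize_le_length_mult)
  also have "\<dots> \<le> length ks * (csize ks + 2 * csize B + 2) + 1"
    using mult_le_mono1[OF len, of "csize ks + 2 * csize B + 2"] by simp
  finally show ?thesis .
qed

lemma polytime_counts [polytime_intros]:
  assumes "polytime xs"
  shows "polytime (\<lambda>x. counts (xs x))"
  unfolding counts_def
proof (rule polytime_fold_bounded[where B = "\<lambda>x. (length (xs x) + 1) * (4 * length (xs x) + 2) + 1"])
  fix e n
  let ?l = "length (take n (xs e))"
  have "csize (counts (take n (xs e))) \<le> length (counts (take n (xs e))) * (4 * length (xs e) + 1 + 1) + 1"
  proof (rule csize_le_length_mult)
    fix k assume "k \<in> set (counts (take n (xs e)))"
    then have "k \<le> length (xs e)" by (auto simp: counts_eq)
    then show "csize k \<le> 4 * length (xs e) + 1" using csize_nat_le[of k] by linarith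
  qed
  also have "\<dots> \<le> (length (xs e) + 1) * (4 * length (xs e) + 2) + 1"
    by (simp add: counts_eq del: upt_Suc) (intro mult_le_mono add_le_mono; simp)
  finally show "csize (fold (\<lambda>_ s. case s of [] \<Rightarrow> [] | k # ks \<Rightarrow> Suc k # k # ks) (take n (xs e)) [0]) \<le>
      (length (xs e) + 1) * (4 * length (xs e) + 2) + 1"
    by (simp add: counts_def)
qed (intro polytime_intros polybound_intros assms)+

lemma polytime_grid [polytime_intros]:
  assumes "polytime ns"
  shows "polytime (\<lambda>x. grid (ns x))"
  unfolding grid_def by (intro polytime_intros assms[THEN polytime_comp])

lemma polytime_dp [polytime_intros]:
  assumes "polytime c'" "polytime c" "polytime d" "polytime B" "polytime vs"
  shows "polytime (\<lambda>x. dp (c' x) (c x) (d x) (B x) (vs x))"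
  unfolding dp_def
proof (rule polytime_fold_absolute)
  let ?ks = "\<lambda>p. grid (counts (vs (fst p)))"
  show "polybound (\<lambda>p. length (?ks p) * (csize (?ks p) + 2 * csize (B (fst p)) + 2) + 1)"
    by (intro polybound_intros polytime_intros assms[THEN polytime_comp])
  show "csize (dp_step (grid (counts (vs e))) (B e) a s)
      \<le> length (?ks (e, a)) * (csize (?ks (e, a)) + 2 * csize (B (fst (e, a))) + 2) + 1" for e a s
    using csize_dp_step by simp
qed (intro polytime_intros assms[THEN polytime_comp])+

lemma polytime_prefers [polytime_intros]:
  assumes "polytime vs" "polytime c" "polytime x"
  shows "polytime (\<lambda>e. prefers (vs e) (c e) (x e))"
  unfolding prefers_def by (intro polytime_intros assms[THEN polytime_comp])

lemma polytime_answer [polytime_intros]: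
  assumes "polytime m" "polytime d" "polytime B" "polytime vs"
  shows "polytime (\<lambda>x. answer (m x) (d x) (B x) (vs x))"
  unfolding answer_def by (intro polytime_intros assms[THEN polytime_comp])

lemma polytime_valid_prices [polytime_intros]:
  assumes "polytime ps"
  shows "polytime (\<lambda>x. valid_prices (ps x))"
proof -
  have le: "csize (w, snd s \<and> fst s \<le> w) \<le> csize s + (csize (e, w) + 3)" for e :: 'a and w and s :: "nat \<times> bool"
    using csize_bool[of "snd s \<and> fst s \<le> w"] by simp
  have "polytime (\<lambda>x. snd (fold (\<lambda>w s. (w, snd s \<and> fst s \<le> w)) (ps x) (0, True)))"
    by (intro polytime_snd polytime_fold_additive[where B = "\<lambda>p. csize p + 3", OF _ _ _ _ le])
      (intro polytime_intros polybound_intros assms)+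
  with _ show ?thesis unfolding valid_prices_def
    by (rule polytime_conj) (intro polytime_intros assms)
qed

lemma polytime_valid_vote [polytime_intros]:
  assumes "polytime m" "polytime d" "polytime v" "polytime ps"
  shows "polytime (\<lambda>x. valid_vote (m x) (d x) (v x) (ps x))"
  unfolding valid_vote_def by (intro polytime_intros assms[THEN polytime_comp])

lemma polytime_valid_raw [polytime_intros]:
  assumes "polytime m" "polytime d" "polytime vs"
  shows "polytime (\<lambda>x. valid_raw (m x) (d x) (vs x))"
  unfolding valid_raw_def by (intro polytime_intros assms[THEN polytime_comp])

lemma polytime_encode_nat [polytime_intros]:
  "polytime f \<Longrightarrow> polytime (\<lambda>x. encode_nat (f x))"
  unfolding encode_nat_def binary_eq_bits by (intro polytime_intros)

lemma polytime_encode_nats [polytime_intros]: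
  "polytime f \<Longrightarrow> polytime (\<lambda>x. encode_nats (f x))"
  unfolding encode_nats_def by (intro polytime_intros)

lemma polytime_encode_raw [polytime_intros]:
  assumes "polytime m" "polytime d" "polytime B" "polytime vs"
  shows "polytime (\<lambda>x. encode_raw (m x) (d x) (B x) (vs x))"
  unfolding encode_raw_def by (intro polytime_intros assms)

lemma polytime_pair_up [polytime_intros]:
  assumes "polytime f"
  shows "polytime (\<lambda>x. pair_up (f x))"
proof -
  let ?F = "\<lambda>x s. case fst s of [] \<Rightarrow> ([x], snd s) | y # _ \<Rightarrow> ([], (y, x) # snd s)"
  have le: "csize (?F a s) \<le> csize s + (csize (e, a) + 3)"
    for e :: 'a and a :: 'b and s :: "'b list \<times> ('b \<times> 'b) list"
    by (cases s; cases "fst s") auto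
  show ?thesis unfolding pair_up_def
    by (intro polytime_rev polytime_snd polytime_fold_additive[where B = "\<lambda>p. csize p + 3", OF _ _ _ _ le])
      (intro polytime_intros polybound_intros assms)+
qed

lemma polytime_parse: "polytime parse"
proof -
  have le: "csize (parse_step a S) \<le> csize S + 10" for a S
    using csize_bool[of True] csize_bool[of False]
    by (auto simp: parse_step_def split: list.split)
  have "polytime (\<lambda>w. foldr parse_step w [[]])"
    by (rule polytime_foldr_additive[where B = "\<lambda>_. 10", OF _ _ _ _ le])
      (unfold parse_step_def, (intro polytime_intros polybound_intros)+)
  then show ?thesis unfolding parse_def by (intro polytime_intros)
qed

lemma polytime_decide: "polytime decide"
  unfolding decide_def Let_def by (intro polytime_intros polytime_comp[OF polytime_parse])

theorem theorem8: "in_P {1, 2, 3, 4} (Destructive_Shift_Bribery maximin)"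
  unfolding Destructive_Shift_Bribery_eq by (rule in_P_polytime[OF polytime_decide])

end
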